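(* Let $\mathbb{K}$ be an algebraically closed field of characteristic $0$ and let $n\ge 1$. (1) In the affine Cremona group $Aut(n,\mathbb{K})$: (1a) Two affine automorphisms of $\mathbb{K}^n$ that each fix a point of $\mathbb{K}^n$ are conjugate in $Aut(n,\mathbb{K})$ if and only if they have the same Jordan normal form (as in $GL(n,\mathbb{K})$). (1b) Any affine automorphism of $\mathbb{K}^n$ that fixes no point of $\mathbb{K}^n$ is conjugate in $Aut(n,\mathbb{K})$ to an almost-diagonal automorphism, and this almost-diagonal automorphism is unique up to a permutation of its eigenvalues. (2) In the Cremona group $Bir(\mathbb{K}^n)$: (2a) Any affine automorphism of $\mathbb{K}^n$ is conjugate in $Bir(\mathbb{K}^n)$ either to a diagonal automorphism or to an almost-diagonal automorphism of $\mathbb{K}^n$, and these two possibilities exclude each other. (2b) Two diagonal automorphisms $\rho(\mu),\rho(\mu')$, with $\mu,\mu'\in(\mathbb{K}^* )^n$, are conjugate in $Bir(\mathbb{K}^n)$ if and only if $\mu'=A\bullet\mu$ for some $A\in GL(n,\mathbb{Z})$, equivalently if and only if they are conjugate by an element $T(A)$, $A \in GL(n,\mathbb{Z})$. Two almost-diagonal automorphisms $\theta(\nu),\theta(\nu')$, with $\nu,\nu'\in(\mathbb{K}^* )^{n-1}$, are conjugate in $Bir(\mathbb{K}^n)$ if and only if $\nu'=B\bullet\nu$ for some $B\in GL(n-1,\mathbb{Z})$, equivalently if and only if they are conjugate by an element $S(B)$, $B\in GL(n-1,\mathbb{Z})$. (2c) In particular, if $n>1$, any two affine automorphisms of $\mathbb{K}^n$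 of the same finite order are conjugate in $Bir(\mathbb{K}^n)$.
   Context: $Bir(\mathbb{K}^n)$ is the group of birational maps of affine $n$-space $\mathbb{K}^n$ to itself (the Cremona group); $Aut(n,\mathbb{K})\subset Bir(\mathbb{K}^n)$ is the subgroup of biregular (polynomial) automorphisms of $\mathbb{K}^n$ (the affine Cremona group). An affine automorphism of $\mathbb{K}^n$ is a map $x\mapsto Mx+b$ with $M\in GL(n,\mathbb{K})$, $b\in\mathbb{K}^n$. Jordan normal form of an affine automorphism with a fixed point: such an automorphism is conjugate, in the group of affine automorphisms, to an element of $GL(n,\mathbb{K})$; its Jordan normal form is the Jordan normal form (up to order of the blocks) of that linear map, which does not depend on the choice of the linear map. Diagonal automorphism: for $\mu=(\mu_1,\dots,\mu_n)\in(\mathbb{K}^* )^n$, $\rho(\mu):(x_1,\dots,x_n)\mapsto(\mu_1x_1,\dots,\mu_nx_n)$. Almost-diagonal automorphism: for $\nu=(\nu_2,\dots,\nu_n)\in(\mathbb{K}^* )^{n-1}$, $\theta(\nu):(x_1,\dots,x_n)\mapsto(x_1+1,\nu_2x_2,\dots,\nu_nx_n)$; the $\nu_2,\dots,\nu_n$ are called its eigenvalues. For $m\geq 0$, $GL(m,\mathbb{Z})$ is the automorphism group of the algebraic torus $(\mathbb{K}^* )^m$ and acts on it by $A\bullet(\mu_1,\dots,\mu_m)=(\mu_1^{a_{11}}\cdots\mu_m^{a_{1m}},\dots,\mu_1^{a_{m1}}\cdots\mu_m^{a_{mm}})$ for $A=(a_{ij})$. $T:GL(n,\mathbb{Z})\to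 Bir(\mathbb{K}^n)$ is the injective homomorphism sending $A=(a_{ij})_{i,j=1}^n$ to the monomial map $(x_1,\dots,x_n)\dashrightarrow(x_1^{a_{11}}\cdots x_n^{a_{1n}},\dots,x_1^{a_{n1}}\cdots x_n^{a_{nn}})$; one has $T(A)\rho(\mu)T(A)^{-1}=\rho(A\bullet\mu)$. $S:GL(n-1,\mathbb{Z})\to Bir(\mathbb{K}^n)$ is the injective homomorphism sending $B=(b_{ij})_{i,j=2}^n$ to $(x_1,\dots,x_n)\dashrightarrow(x_1,x_2^{b_{22}}\cdots x_n^{b_{2n}},\dots,x_2^{b_{n2}}\cdots x_n^{b_{nn}})$; one has $S(B)\theta(\nu)S(B)^{-1}=\theta(B\bullet\nu)$. *)

theory Defs
  imports
    "HOL-Library.Poly_Mapping"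
    "HOL-Computational_Algebra.Polynomial_Factorial"
    "HOL-Algebra.Multiplicative_Group"
    "HOL-Combinatorics.Permutations"
    "Jordan_Normal_Form.Jordan_Normal_Form"
begin

section \<open>Rational functions in \<open>n\<close> variables\<close>

text \<open>
  Coordinates are indexed by \<open>0, \<dots>, n - 1\<close>; index \<open>0\<close> is the first coordinate.
  Polynomials and rational functions live in types with countably many variables; the
  sets \<open>polys n\<close> and \<open>ratfuns n\<close> are the polynomial ring and the rational function
  field in the first \<open>n\<close> of them.
\<close>

type_synonym 'k mpoly = "(nat \<Rightarrow>\<^sub>0 nat) \<Rightarrow>\<^sub>0 'k"
type_synonym 'k ratfun = "'k mpoly fract"

definition polys :: "nat \<Rightarrow> 'k::field mpoly set" where
  "polys n = {p. \<forall>m \<in> Poly_Mapping.keys p. Poly_Mapping.keys m \<subseteq> {..<n}}"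

definition ratfuns :: "nat \<Rightarrow> 'k::field ratfun set" where
  "ratfuns n = {Fract p q | p q. p \<in> polys n \<and> q \<in> polys n \<and> q \<noteq> 0}"

definition scalar :: "'k::field \<Rightarrow> 'k ratfun" where
  "scalar c = to_fract (Poly_Mapping.single 0 c)"

definition coord :: "nat \<Rightarrow> 'k::field ratfun" where
  "coord i = to_fract (Poly_Mapping.single (Poly_Mapping.single i 1) 1)"

section \<open>Rational and birational maps of affine space\<close>

text \<open>
  A rational map from affine \<open>n\<close>-space to itself is the vector of its \<open>n\<close> component functions.
  \<open>poly_subst g p\<close> is the pullback of the polynomial \<open>p\<close> along \<open>g\<close>, that is
  \<open>p(g\<^sub>0, \<dots>, g\<^sub>n\<^sub>-\<^sub>1)\<close>.
\<close>

definition ratmaps :: "nat \<Rightarrow> 'k::field ratfun vec set" where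
  "ratmaps n = {f \<in> carrier_vec n. \<forall>i<n. f $ i \<in> ratfuns n}"

definition poly_subst :: "'k::field ratfun vec \<Rightarrow> 'k mpoly \<Rightarrow> 'k ratfun" where
  "poly_subst g p = (\<Sum>m \<in> Poly_Mapping.keys p. scalar (Poly_Mapping.lookup p m) *
     (\<Prod>i \<in> Poly_Mapping.keys m. (g $ i) ^ Poly_Mapping.lookup m i))"

text \<open>The image of a dominant map lies in no hypersurface.\<close>

definition dominant :: "'k::field ratfun vec \<Rightarrow> bool" where
  "dominant g \<longleftrightarrow> (\<forall>p \<in> polys (dim_vec g). poly_subst g p = 0 \<longrightarrow> p = 0)"

text \<open>
  The pullback of a rational function does not depend on the fraction chosen to represent it, as
  long as the denominator does not vanish identically on the image of \<open>g\<close>. For dominant \<open>g\<close> it is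
  defined everywhere.
\<close>

definition rat_subst :: "'k::field ratfun vec \<Rightarrow> 'k ratfun \<Rightarrow> 'k ratfun" where
  "rat_subst g r = (THE s. \<exists>p \<in> polys (dim_vec g). \<exists>q \<in> polys (dim_vec g).
     r = Fract p q \<and> poly_subst g q \<noteq> 0 \<and> s = poly_subst g p / poly_subst g q)"

definition rat_comp :: "'k::field ratfun vec \<Rightarrow> 'k ratfun vec \<Rightarrow> 'k ratfun vec" where
  "rat_comp f g = map_vec (rat_subst g) f"

definition rat_id :: "nat \<Rightarrow> 'k::field ratfun vec" where
  "rat_id n = vec n coord"

definition birational :: "nat \<Rightarrow> 'k::field ratfun vec \<Rightarrow> bool" where
  "birational n f \<longleftrightarrow> f \<in> ratmaps n \<and> dominant f \<and>
     (\<exists>g \<in> ratmaps n. dominant g \<and> rat_comp f g = rat_id n \<and> rat_comp g f = rat_id n)"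

definition Bir :: "nat \<Rightarrow> 'k::field ratfun vec monoid" where
  "Bir n = \<lparr>carrier = {f. birational n f}, monoid.mult = rat_comp, one = rat_id n\<rparr>"

definition polymaps :: "nat \<Rightarrow> 'k::field ratfun vec set" where
  "polymaps n = {f \<in> carrier_vec n. \<forall>i<n. f $ i \<in> to_fract ` polys n}"

definition Aut :: "nat \<Rightarrow> 'k::field ratfun vec monoid" where
  "Aut n = (Bir n)\<lparr>carrier :=
     {f \<in> carrier (Bir n). f \<in> polymaps n \<and> inv\<^bsub>Bir n\<^esub> f \<in> polymaps n}\<rparr>"

definition conjugate_in :: "('a, 'b) monoid_scheme \<Rightarrow> 'a \<Rightarrow> 'a \<Rightarrow> bool" where
  "conjugate_in G f g \<longleftrightarrow> (\<exists>h \<in> carrier G. h \<otimes>\<^bsub>G\<^esub> f \<otimes>\<^bsub>G\<^esub> inv\<^bsub>G\<^esub> h = g)"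

section \<open>Affine automorphisms\<close>

definition GL :: "nat \<Rightarrow> 'a::semiring_1 mat set" where
  "GL m = {A \<in> carrier_mat m m. invertible_mat A}"

text \<open>\<open>affine_map M b\<close> is the map \<open>x \<mapsto> M x + b\<close>.\<close>

definition affine_map :: "'k::field mat \<Rightarrow> 'k vec \<Rightarrow> 'k ratfun vec" where
  "affine_map M b = vec (dim_row M)
     (\<lambda>i. (\<Sum>j<dim_col M. scalar (M $$ (i, j)) * coord j) + scalar (b $ i))"

definition affine_data :: "nat \<Rightarrow> ('k::field mat \<times> 'k vec) set" where
  "affine_data n = GL n \<times> carrier_vec n"

definition fixes_point :: "'k::field mat \<Rightarrow> 'k vec \<Rightarrow> bool" where
  "fixes_point M b \<longleftrightarrow> (\<exists>x \<in> carrier_vec (dim_row M). M *\<^sub>v x + b = x)"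

definition Aff :: "nat \<Rightarrow> 'k::field ratfun vec monoid" where
  "Aff n = (Bir n)\<lparr>carrier := {affine_map M b | M b. (M, b) \<in> affine_data n}\<rparr>"

text \<open>
  \<open>J\<close> is the multiset of Jordan blocks (size, eigenvalue) of a linear map conjugate to \<open>f\<close> in the
  affine group.
\<close>

definition has_affine_jnf :: "nat \<Rightarrow> 'k::field ratfun vec \<Rightarrow> (nat \<times> 'k) multiset \<Rightarrow> bool" where
  "has_affine_jnf n f J \<longleftrightarrow> (\<exists>L n_as. L \<in> GL n \<and> conjugate_in (Aff n) f (affine_map L (0\<^sub>v n)) \<and>
     jordan_nf L n_as \<and> mset n_as = J)"

section \<open>Diagonal, almost-diagonal and monomial maps\<close>

definition torus :: "nat \<Rightarrow> 'k::field vec set" where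
  "torus m = {\<mu> \<in> carrier_vec m. \<forall>i<m. \<mu> $ i \<noteq> 0}"

definition diag_aut :: "'k::field vec \<Rightarrow> 'k ratfun vec" where
  "diag_aut \<mu> = vec (dim_vec \<mu>) (\<lambda>i. scalar (\<mu> $ i) * coord i)"

text \<open>
  The parameter of \<open>almost_diag_aut\<close> has one entry less than the map has coordinates: its entry
  \<open>j\<close> is the eigenvalue on coordinate \<open>Suc j\<close>. The same shift applies to \<open>monomial_map1\<close>.
\<close>

definition almost_diag_aut :: "'k::field vec \<Rightarrow> 'k ratfun vec" where
  "almost_diag_aut \<nu> = vec (Suc (dim_vec \<nu>))
     (\<lambda>i. case i of 0 \<Rightarrow> coord 0 + 1 | Suc j \<Rightarrow> scalar (\<nu> $ j) * coord (Suc j))"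

definition torus_act :: "int mat \<Rightarrow> 'k::field vec \<Rightarrow> 'k vec" where
  "torus_act A \<mu> = vec (dim_row A) (\<lambda>i. \<Prod>j<dim_col A. (\<mu> $ j) powi (A $$ (i, j)))"

definition monomial_map :: "int mat \<Rightarrow> 'k::field ratfun vec" where
  "monomial_map A = vec (dim_row A) (\<lambda>i. \<Prod>j<dim_col A. coord j powi (A $$ (i, j)))"

definition monomial_map1 :: "int mat \<Rightarrow> 'k::field ratfun vec" where
  "monomial_map1 B = vec (Suc (dim_row B))
     (\<lambda>i. case i of 0 \<Rightarrow> coord 0 | Suc k \<Rightarrow> \<Prod>j<dim_col B. coord (Suc j) powi (B $$ (k, j)))"

end

theory Submission
  imports Defs "Jordan_Normal_Form.Jordan_Normal_Form_Existence"
begin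

text \<open>
  \<^emph>\<open>Affine group of automorphisms.\<close> The linear part at a fixed point is a conjugacy invariant by the
  chain rule. A fixed point free affine map is affinely conjugate to a triangular map
  \<open>(x\<^sub>0 + 1, \<mu>\<^sub>i x\<^sub>i + q\<^sub>i(x\<^sub>0, \<dots>, x\<^sub>i\<^sub>-\<^sub>1))\<close>; the \<open>q\<^sub>i\<close> are removed one by one because \<open>r \<mapsto> \<sigma> r - a r\<close> is
  surjective on polynomials, where \<open>\<sigma>\<close> is the pullback. The eigenvalues are recovered from a nonzero
  term of the Leibniz expansion of the determinant of the linear part of a conjugating map.

  \<^emph>\<open>Cremona group.\<close> If the linear part has a Jordan block of size at least two, the quotient of two
  of its coordinates, suitably scaled, is translated by \<open>1\<close>, which makes the map triangular.
  Conversely, the possible denominators of a rational function \<open>r\<close> with \<open>\<sigma> r = a r + b\<close> form a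
  \<open>\<sigma>\<close>-stable space and hence contain an eigenvector of \<open>\<sigma>\<close>; all monomials of an eigenvector have the
  same weight and do not involve the translated variable. So the eigenvalues of conjugate maps are
  Laurent monomials in each other. Under \<open>GL(m, \<int>)\<close> they take the form \<open>(\<alpha>\<^sub>0, \<dots>, \<alpha>\<^sub>r\<^sub>-\<^sub>1, \<zeta>, 1, \<dots>, 1)\<close> with
  \<open>\<alpha>\<close> multiplicatively independent and \<open>\<zeta>\<close> a root of unity. Two such tuples which are Laurent monomials in
  each other lie in the same orbit, except that for \<open>m = r + 1\<close> one needs \<open>\<zeta>' = \<zeta>\<^sup>\<plusminus>\<^sup>1\<close>. In this case the last
  component of the conjugating map is a monomial times a function of \<open>x\<^sub>r\<close> alone, and comparing
  leading monomials in its left inverse determines \<open>\<zeta>'\<close>.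
\<close>

text \<open>The only access to an arbitrary conjugating birational map is through its components,
  which are semi-invariants of the given map; every obstruction is read off from them. Eigenvectors
  of \<open>\<sigma>\<close> come from a descent rather than from a characteristic polynomial:
  subtracting from \<open>\<sigma> q\<close> the multiple of \<open>q\<close> given by the weight of
  a monomial of top degree in the first variable shrinks the support.

  That two eigenvalue tuples are Laurent monomials in each other does not yet place them in one
  orbit. After normalization the roots of unity \<zeta> and \<zeta>' generate the same group. A
  spare coordinate equal to 1 lets integer row operations exchange one generator for the other.
  Without it, a unimodular matrix fixing the independent coordinates can act on \<zeta> only by the
  exponents 1 and -1, so the missing information has to come from the geometry of the conjugating
  map.

  Diagonal and almost-diagonal maps are handled together: the translated variable has weight 1, so
  weights do not see it, and a Boolean parameter switches the translation on or off.\<close>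

abbreviation keys :: "('a \<Rightarrow>\<^sub>0 'b::zero) \<Rightarrow> 'a set" where "keys \<equiv> Poly_Mapping.keys"
abbreviation lookup :: "('a \<Rightarrow>\<^sub>0 'b::zero) \<Rightarrow> 'a \<Rightarrow> 'b" where "lookup \<equiv> Poly_Mapping.lookup"
abbreviation single :: "'a \<Rightarrow> 'b \<Rightarrow> 'a \<Rightarrow>\<^sub>0 'b::zero" where "single \<equiv> Poly_Mapping.single"

abbreviation Const :: "'k::zero \<Rightarrow> (nat \<Rightarrow>\<^sub>0 nat) \<Rightarrow>\<^sub>0 'k" where "Const c \<equiv> single 0 c"
definition Var :: "nat \<Rightarrow> (nat \<Rightarrow>\<^sub>0 nat) \<Rightarrow>\<^sub>0 'k::{zero,one}" where "Var i = single (single i 1) 1"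

section \<open>Evaluation of polynomials\<close>

definition monom_eval :: "(nat \<Rightarrow> 'a::comm_monoid_mult) \<Rightarrow> (nat \<Rightarrow>\<^sub>0 nat) \<Rightarrow> 'a" where
  "monom_eval f m = (\<Prod>i\<in>keys m. f i ^ lookup m i)"

lemma monom_eval_superset:
  assumes "finite A" "keys m \<subseteq> A"
  shows "monom_eval f m = (\<Prod>i\<in>A. f i ^ lookup m i)"
  unfolding monom_eval_def
  by (rule prod.mono_neutral_left) (use assms in \<open>auto simp: in_keys_iff\<close>)

lemma monom_eval_add: "monom_eval f (m + m') = monom_eval f m * monom_eval f m'"
proof -
  let ?A = "keys m \<union> keys m'"
  have "keys (m + m') \<subseteq> ?A" by (rule keys_add)
  then show ?thesis
    by (simp add: monom_eval_superset[of ?A] lookup_add power_add prod.distrib)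
qed

lemma monom_eval_0 [simp]: "monom_eval f 0 = 1"
  by (simp add: monom_eval_def)

lemma monom_eval_single: "monom_eval f (single i k) = f i ^ k"
  by (simp add: monom_eval_def)

lemma monom_eval_cong: "(\<And>i. i \<in> keys m \<Longrightarrow> f i = g i) \<Longrightarrow> monom_eval f m = monom_eval g m"
  by (simp add: monom_eval_def)

text \<open>The coefficient map is a parameter so that substitution of rational functions
  (\<open>scalar\<close>) and of polynomials (\<open>Const\<close>) share one calculus.\<close>

definition peval :: "('k::zero \<Rightarrow> 'a::comm_semiring_1) \<Rightarrow> (nat \<Rightarrow> 'a) \<Rightarrow> ((nat \<Rightarrow>\<^sub>0 nat) \<Rightarrow>\<^sub>0 'k) \<Rightarrow> 'a" where
  "peval \<phi> f p = (\<Sum>m\<in>keys p. \<phi> (lookup p m) * monom_eval f m)"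

lemma mpoly_sum_singles: "(\<Sum>m\<in>keys p. single m (lookup p m)) = p"
  by (rule poly_mapping_eqI) (auto simp: lookup_sum lookup_single when_def sum.delta in_keys_iff)

text \<open>The set \<open>K\<close> confines the monomials, which allows induction inside a subring
  such as \<open>polys n\<close>.\<close>

lemma mpoly_induct_keys [case_names single add]:
  fixes p :: "'a \<Rightarrow>\<^sub>0 'b::comm_monoid_add"
  assumes s: "\<And>m a. m \<in> K \<Longrightarrow> P (single m a)"
    and a: "\<And>p q. P p \<Longrightarrow> P q \<Longrightarrow> P (p + q)"
    and 0: "P 0" and K: "keys p \<subseteq> K"
  shows "P p"
proof -
  have "P (\<Sum>m\<in>F. single m (lookup p m))" if "finite F" "F \<subseteq> K" for F
    using that by (induction F rule: finite_induct) (auto intro: s a 0)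
  from this[of "keys p"] K show ?thesis by (simp add: mpoly_sum_singles)
qed

lemma peval_cong: "(\<And>m i. m \<in> keys p \<Longrightarrow> i \<in> keys m \<Longrightarrow> f i = g i) \<Longrightarrow> peval \<phi> f p = peval \<phi> g p"
  unfolding peval_def by (intro sum.cong refl arg_cong2[of _ _ _ _ "(*)"] monom_eval_cong) auto

context comm_ring_hom
begin

lemma peval_superset:
  assumes "finite A" "keys p \<subseteq> A"
  shows "peval hom f p = (\<Sum>m\<in>A. hom (lookup p m) * monom_eval f m)"
  unfolding peval_def
  by (rule sum.mono_neutral_left) (use assms in \<open>auto simp: in_keys_iff\<close>)

lemma peval_add: "peval hom f (p + q) = peval hom f p + peval hom f q"
proof -
  let ?A = "keys p \<union> keys q"
  have "keys (p + q) \<subseteq> ?A" by (rule keys_add)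
  then show ?thesis
    by (simp add: peval_superset[of ?A] lookup_add hom_add distrib_right sum.distrib)
qed

lemma peval_0 [simp]: "peval hom f 0 = 0"
  by (simp add: peval_def)

lemma peval_single: "peval hom f (single m a) = hom a * monom_eval f m"
  by (simp add: peval_def)

lemma peval_mult: "peval hom f (p * q) = peval hom f p * peval hom f q"
proof (induction p rule: mpoly_induct_keys[where K = UNIV])
  case (single m a)
  show ?case
    by (induction q rule: mpoly_induct_keys[where K = UNIV])
      (simp_all add: peval_single peval_add mult_single hom_mult monom_eval_add distrib_left distrib_right mult_ac)
qed (simp_all add: peval_add distrib_right)

lemma peval_Const: "peval hom f (Const c) = hom c"
  by (simp add: peval_single)

lemma peval_Var: "peval hom f (Var i) = f i"
  by (simp add: Var_def peval_single monom_eval_single)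

lemma peval_1: "peval hom f 1 = 1"
  using peval_Const[of f 1] by simp

lemma peval_comm_ring_hom: "comm_ring_hom (peval hom f)"
  by unfold_locales (simp_all add: peval_add peval_mult peval_1)

end

text \<open>With \<open>h\<close> itself an evaluation this is associativity of substitution; with
  \<open>h = to_fract\<close> it passes from polynomials to fractions.\<close>

lemma peval_hom_comp:
  assumes "comm_ring_hom h"
  shows "h (peval \<phi> f p) = peval (\<lambda>c. h (\<phi> c)) (\<lambda>i. h (f i)) p"
proof -
  interpret comm_ring_hom h by fact
  show ?thesis by (simp add: peval_def monom_eval_def hom_sum hom_mult hom_prod hom_power)
qed

section \<open>The polynomial rings and the rational function fields\<close>

lemma comm_ring_hom_Const: "comm_ring_hom (Const :: 'k::comm_ring_1 \<Rightarrow> _)"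
  by unfold_locales (simp_all add: single_add mult_single)

lemma comm_ring_hom_to_fract: "comm_ring_hom (to_fract :: 'a::idom \<Rightarrow> _)"
  by unfold_locales simp_all

lemma comm_ring_hom_scalar: "comm_ring_hom (scalar :: 'k::field \<Rightarrow> _)"
  by unfold_locales (simp_all add: scalar_def single_add mult_single flip: to_fract_mult)

interpretation Const: comm_ring_hom "Const :: 'k::comm_ring_1 \<Rightarrow> _" by (rule comm_ring_hom_Const)
interpretation to_fract: comm_ring_hom "to_fract :: 'a::idom \<Rightarrow> _" by (rule comm_ring_hom_to_fract)
interpretation scalar: comm_ring_hom "scalar :: 'k::field \<Rightarrow> _" by (rule comm_ring_hom_scalar)

lemma scalar_eq_iff [simp]: "scalar a = scalar b \<longleftrightarrow> a = b"
  by (metis lookup_single_eq scalar_def to_fract_eq_iff)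

lemma scalar_eq_0_iff [simp]: "scalar a = 0 \<longleftrightarrow> a = 0"
  using scalar_eq_iff[of a 0] by (simp del: scalar_eq_iff)

lemma scalar_divide: "scalar (a / b) = scalar a / scalar b"
proof (cases "b = 0")
  case False
  then have "scalar (a / b) * scalar b = scalar a" by (simp flip: scalar.hom_mult)
  with False show ?thesis by (simp add: field_simps)
qed simp

lemma to_fract_Const: "to_fract (Const c) = scalar c"
  by (simp add: scalar_def)

lemma to_fract_Var: "to_fract (Var i) = coord i"
  by (simp add: coord_def Var_def)

lemma coord_nonzero [simp]: "coord i \<noteq> 0"
  unfolding coord_def to_fract_eq_0_iff by (metis keys_single keys_zero insert_not_empty one_neq_zero)

lemma poly_subst_peval: "poly_subst g = peval scalar (\<lambda>i. g $ i)"
  by (rule ext) (simp add: poly_subst_def peval_def monom_eval_def)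

lemma polysD: "p \<in> polys n \<Longrightarrow> m \<in> keys p \<Longrightarrow> keys m \<subseteq> {..<n}"
  by (auto simp: polys_def)

lemma polys_0 [simp]: "0 \<in> polys n" by (simp add: polys_def)
lemma polys_Const [simp]: "Const c \<in> polys n" by (simp add: polys_def)
lemma polys_1 [simp]: "1 \<in> polys n" using polys_Const[of 1 n] by simp
lemma polys_Var [simp]: "i < n \<Longrightarrow> Var i \<in> polys n" by (simp add: polys_def Var_def)

lemma polys_single: "keys m \<subseteq> {..<n} \<Longrightarrow> single m a \<in> polys n"
  by (simp add: polys_def)

lemma polys_add: "p \<in> polys n \<Longrightarrow> q \<in> polys n \<Longrightarrow> p + q \<in> polys n"
  unfolding polys_def using keys_add[of p q] by blast

lemma polys_uminus: "p \<in> polys n \<Longrightarrow> - p \<in> polys n"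
  by (simp add: polys_def)

lemma polys_diff: "p \<in> polys n \<Longrightarrow> q \<in> polys n \<Longrightarrow> p - q \<in> polys n"
  using polys_add[OF _ polys_uminus] by fastforce

lemma polys_mult: "p \<in> polys n \<Longrightarrow> q \<in> polys n \<Longrightarrow> p * q \<in> polys n"
proof -
  assume pq: "p \<in> polys n" "q \<in> polys n"
  have "x < n" if m: "m \<in> keys (p * q)" and x: "x \<in> keys m" for m x
  proof -
  obtain a b where ab: "m = a + b" "a \<in> keys p" "b \<in> keys q"
    using keys_mult[of p q] m by blast
  with x keys_add[of a b] have "x \<in> keys a \<union> keys b" by blast
  with polysD[OF pq(1) ab(2)] polysD[OF pq(2) ab(3)] show "x < n" by blast
  qed
  then show ?thesis by (auto simp: polys_def)
qed

lemma polys_sum: "(\<And>i. i \<in> A \<Longrightarrow> f i \<in> polys n) \<Longrightarrow> sum f A \<in> polys n"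
  by (induction A rule: infinite_finite_induct) (auto intro: polys_add)

lemma polys_mono: "m \<le> n \<Longrightarrow> p \<in> polys m \<Longrightarrow> p \<in> polys n"
  unfolding polys_def using order.strict_trans2[of _ m n] by blast

lemma single_conv_monom_eval: "single m a = Const (a :: 'a::comm_ring_1) * monom_eval Var m"
proof -
  have "monom_eval Var m = (single m 1 :: (nat \<Rightarrow>\<^sub>0 nat) \<Rightarrow>\<^sub>0 'a)"
  proof -
    have pw: "Var i ^ k = (single (single i k) 1 :: (nat \<Rightarrow>\<^sub>0 nat) \<Rightarrow>\<^sub>0 'a)" for i k
      by (induction k) (simp_all add: Var_def mult_single flip: single_add)
    have "monom_eval Var (\<Sum>i\<in>F. single i (lookup m i)) = (single (\<Sum>i\<in>F. single i (lookup m i)) 1 :: (nat \<Rightarrow>\<^sub>0 nat) \<Rightarrow>\<^sub>0 'a)"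
      if "finite F" for F
      using that
      by (induction F rule: finite_induct) (simp_all add: monom_eval_add monom_eval_single pw mult_single)
    from this[of "keys m"] show ?thesis by (simp add: mpoly_sum_singles)
  qed
  then show ?thesis by (simp add: mult_single)
qed

lemma polys_induct [consumes 1, case_names Const Var add mult]:
  assumes p: "p \<in> polys n"
    and C: "\<And>c. P (Const c)" and V: "\<And>i. i < n \<Longrightarrow> P (Var i)"
    and A: "\<And>p q. P p \<Longrightarrow> P q \<Longrightarrow> P (p + q)" and M: "\<And>p q. P p \<Longrightarrow> P q \<Longrightarrow> P (p * q)"
  shows "P p"
proof (rule mpoly_induct_keys[of "{m. keys m \<subseteq> {..<n}}"])
  fix m :: "nat \<Rightarrow>\<^sub>0 nat" and a :: 'a
  assume m: "m \<in> {m. keys m \<subseteq> {..<n}}"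
  have pw: "P (Var i ^ k)" if "i < n" for i k
    using C[of 1] by (induction k) (auto intro: M V that)
  have "P (\<Prod>i\<in>F. Var i ^ lookup m i)" if "finite F" "F \<subseteq> {..<n}" for F
    using that C[of 1] by (induction F rule: finite_induct) (auto intro: M pw)
  then have "P (monom_eval Var m)" using m by (simp add: monom_eval_def)
  then show "P (single m a)" unfolding single_conv_monom_eval[of m a] by (intro M C)
next
  show "P 0" using C[of 0] by simp
  show "keys p \<subseteq> {m. keys m \<subseteq> {..<n}}" using p by (auto simp: polys_def)
qed (rule A)

lemma peval_Var_id: "peval Const Var p = (p :: (nat \<Rightarrow>\<^sub>0 nat) \<Rightarrow>\<^sub>0 'a::comm_ring_1)"
proof -
  have "peval Const Var p = (\<Sum>m\<in>keys p. single m (lookup p m))"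
    unfolding peval_def by (rule sum.cong[OF refl]) (rule single_conv_monom_eval[symmetric])
  then show ?thesis by (simp add: mpoly_sum_singles)
qed

lemma peval_coord: "peval scalar coord p = to_fract p"
  using peval_hom_comp[OF comm_ring_hom_to_fract, of Const Var p]
  by (simp add: peval_Var_id to_fract_Const to_fract_Var)

lemma peval_to_fract: "peval scalar (\<lambda>i. to_fract (F i)) p = to_fract (peval Const F p)"
  using peval_hom_comp[OF comm_ring_hom_to_fract, of Const F p] by (simp add: to_fract_Const)

lemma polys_peval:
  assumes "p \<in> polys k" "\<And>i. i < k \<Longrightarrow> F i \<in> polys n"
  shows "peval Const F p \<in> polys n"
  using assms
  by (induction p rule: polys_induct)
    (auto simp: Const.peval_single Const.peval_Var monom_eval_single Const.peval_add Const.peval_mult intro: polys_add polys_mult)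

lemma ratfunsI: "p \<in> polys n \<Longrightarrow> q \<in> polys n \<Longrightarrow> q \<noteq> 0 \<Longrightarrow> Fract p q \<in> ratfuns n"
  by (auto simp: ratfuns_def)

lemma ratfunsE:
  assumes "r \<in> ratfuns n"
  obtains p q where "p \<in> polys n" "q \<in> polys n" "q \<noteq> 0" "r = Fract p q"
  using assms by (auto simp: ratfuns_def)

lemma ratfuns_to_fract: "p \<in> polys n \<Longrightarrow> to_fract p \<in> ratfuns n"
  unfolding to_fract_def by (rule ratfunsI) auto

lemma ratfuns_scalar [simp]: "scalar c \<in> ratfuns n"
  unfolding scalar_def by (rule ratfuns_to_fract) simp

lemma ratfuns_coord [simp]: "i < n \<Longrightarrow> coord i \<in> ratfuns n"
  unfolding to_fract_Var[symmetric] by (rule ratfuns_to_fract) simp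

lemma ratfuns_0 [simp]: "0 \<in> ratfuns n" and ratfuns_1 [simp]: "1 \<in> ratfuns n"
  using ratfuns_scalar[of 0 n] ratfuns_scalar[of 1 n] by simp_all

lemma ratfuns_add: "r \<in> ratfuns n \<Longrightarrow> s \<in> ratfuns n \<Longrightarrow> r + s \<in> ratfuns n"
  by (elim ratfunsE) (auto intro!: ratfunsI polys_add polys_mult)

lemma ratfuns_mult: "r \<in> ratfuns n \<Longrightarrow> s \<in> ratfuns n \<Longrightarrow> r * s \<in> ratfuns n"
  by (elim ratfunsE) (auto intro!: ratfunsI polys_add polys_mult)

lemma ratfuns_inverse: "r \<in> ratfuns n \<Longrightarrow> inverse r \<in> ratfuns n"
proof (elim ratfunsE)
  fix p q assume *: "p \<in> polys n" "q \<in> polys n" "q \<noteq> 0" "r = Fract p q"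
  show ?thesis
  proof (cases "p = 0")
    case True
    then have "r = 0" using * by (simp add: fract_collapse)
    then show ?thesis by simp
  qed (use * in \<open>auto intro!: ratfunsI\<close>)
qed

lemma ratfuns_divide: "r \<in> ratfuns n \<Longrightarrow> s \<in> ratfuns n \<Longrightarrow> r / s \<in> ratfuns n"
  by (simp add: divide_inverse ratfuns_mult ratfuns_inverse)

lemma ratfuns_power: "r \<in> ratfuns n \<Longrightarrow> r ^ k \<in> ratfuns n"
  by (induction k) (auto intro: ratfuns_mult)

lemma ratfuns_powi: "r \<in> ratfuns n \<Longrightarrow> r powi k \<in> ratfuns n"
  by (auto simp: power_int_def intro: ratfuns_power ratfuns_inverse)

lemma ratfuns_prod: "(\<And>i. i \<in> A \<Longrightarrow> f i \<in> ratfuns n) \<Longrightarrow> prod f A \<in> ratfuns n"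
  by (induction A rule: infinite_finite_induct) (auto intro: ratfuns_mult)

lemma ratfuns_peval:
  assumes "p \<in> polys k" "\<And>i. i < k \<Longrightarrow> f i \<in> ratfuns n"
  shows "peval scalar f p \<in> ratfuns n"
  using assms
  by (induction p rule: polys_induct)
    (auto simp: scalar.peval_Const scalar.peval_Var scalar.peval_add scalar.peval_mult
      intro: ratfuns_add ratfuns_mult)

section \<open>Substitution into rational functions\<close>

text \<open>The local ring of the image of \<open>g\<close>.\<close>

definition reg :: "'k::field ratfun vec \<Rightarrow> 'k ratfun set" where
  "reg g = {Fract p q | p q. p \<in> polys (dim_vec g) \<and> q \<in> polys (dim_vec g) \<and> poly_subst g q \<noteq> 0}"

text \<open>The definite description is unambiguous: cross-multiplying two representations gives a
  polynomial identity, and substitution preserves it.\<close>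

lemma rat_subst_Fract:
  assumes "p \<in> polys (dim_vec g)" "q \<in> polys (dim_vec g)" "poly_subst g q \<noteq> 0"
  shows "rat_subst g (Fract p q) = poly_subst g p / poly_subst g q"
  unfolding rat_subst_def
proof (rule the_equality)
  show "\<exists>p'\<in>polys (dim_vec g). \<exists>q'\<in>polys (dim_vec g). Fract p q = Fract p' q' \<and>
    poly_subst g q' \<noteq> 0 \<and> poly_subst g p / poly_subst g q = poly_subst g p' / poly_subst g q'"
    using assms by blast
next
  fix s
  assume "\<exists>p'\<in>polys (dim_vec g). \<exists>q'\<in>polys (dim_vec g). Fract p q = Fract p' q' \<and>
    poly_subst g q' \<noteq> 0 \<and> s = poly_subst g p' / poly_subst g q'"
  then obtain p' q' where *: "Fract p q = Fract p' q'" "poly_subst g q' \<noteq> 0"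
    "s = poly_subst g p' / poly_subst g q'" by blast
  have "q \<noteq> 0" "q' \<noteq> 0" using assms(3) *(2) by (auto simp: poly_subst_peval)
  with *(1) have "p * q' = p' * q" by (simp add: eq_fract)
  then have "poly_subst g p * poly_subst g q' = poly_subst g p' * poly_subst g q"
    by (metis poly_subst_peval scalar.peval_mult)
  with assms(3) *(2) show "s = poly_subst g p / poly_subst g q" unfolding *(3) by (simp add: field_simps)
qed

lemma regI: "p \<in> polys (dim_vec g) \<Longrightarrow> q \<in> polys (dim_vec g) \<Longrightarrow> poly_subst g q \<noteq> 0 \<Longrightarrow> Fract p q \<in> reg g"
  by (auto simp: reg_def)

lemma regE:
  assumes "r \<in> reg g"
  obtains p q where "p \<in> polys (dim_vec g)" "q \<in> polys (dim_vec g)" "poly_subst g q \<noteq> 0" "q \<noteq> 0"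
    "r = Fract p q"
proof -
  obtain p q where "p \<in> polys (dim_vec g)" "q \<in> polys (dim_vec g)" "poly_subst g q \<noteq> 0" "r = Fract p q"
    using assms by (auto simp: reg_def)
  moreover have "q \<noteq> 0" using calculation(3) by (auto simp: poly_subst_peval)
  ultimately show thesis using that by blast
qed

lemma reg_poly: "p \<in> polys (dim_vec g) \<Longrightarrow> to_fract p \<in> reg g"
  unfolding to_fract_def by (rule regI) (simp_all add: poly_subst_peval scalar.peval_1)

lemma rat_subst_poly: "p \<in> polys (dim_vec g) \<Longrightarrow> rat_subst g (to_fract p) = poly_subst g p"
  unfolding to_fract_def by (subst rat_subst_Fract) (simp_all add: poly_subst_peval scalar.peval_1)

lemma reg_scalar [simp]: "scalar c \<in> reg g"
  and rat_subst_scalar [simp]: "rat_subst g (scalar c) = scalar c"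
  using reg_poly[of "Const c" g] rat_subst_poly[of "Const c" g]
  by (simp_all add: poly_subst_peval to_fract_Const scalar.peval_Const)

lemma reg_0 [simp]: "0 \<in> reg g" and rat_subst_0 [simp]: "rat_subst g 0 = 0"
  and reg_1 [simp]: "1 \<in> reg g" and rat_subst_1 [simp]: "rat_subst g 1 = 1"
  using reg_scalar[of 0 g] rat_subst_scalar[of g 0] reg_scalar[of 1 g] rat_subst_scalar[of g 1] by simp_all

lemma reg_coord [simp]: "i < dim_vec g \<Longrightarrow> coord i \<in> reg g"
  and rat_subst_coord [simp]: "i < dim_vec g \<Longrightarrow> rat_subst g (coord i) = g $ i"
  using reg_poly[of "Var i" g] rat_subst_poly[of "Var i" g]
  by (simp_all add: poly_subst_peval to_fract_Var scalar.peval_Var)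

lemma reg_add_mult:
  assumes "r \<in> reg g" "s \<in> reg g"
  shows "r + s \<in> reg g" "rat_subst g (r + s) = rat_subst g r + rat_subst g s"
    and "r * s \<in> reg g" "rat_subst g (r * s) = rat_subst g r * rat_subst g s"
proof -
  obtain p q where r: "p \<in> polys (dim_vec g)" "q \<in> polys (dim_vec g)" "poly_subst g q \<noteq> 0" "q \<noteq> 0"
    "r = Fract p q" using assms(1) by (rule regE)
  obtain p' q' where s: "p' \<in> polys (dim_vec g)" "q' \<in> polys (dim_vec g)" "poly_subst g q' \<noteq> 0" "q' \<noteq> 0"
    "s = Fract p' q'" using assms(2) by (rule regE)
  have h: "poly_subst g (a * b) = poly_subst g a * poly_subst g b"
    "poly_subst g (a + b) = poly_subst g a + poly_subst g b" for a b
    by (simp_all add: poly_subst_peval scalar.peval_mult scalar.peval_add)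
  show "r + s \<in> reg g" "r * s \<in> reg g" using r s by (auto intro!: regI polys_add polys_mult simp: h)
  show "rat_subst g (r + s) = rat_subst g r + rat_subst g s"
    "rat_subst g (r * s) = rat_subst g r * rat_subst g s"
    using r s by (auto simp: rat_subst_Fract h polys_add polys_mult divide_simps)
qed

lemma reg_inverse:
  assumes "r \<in> reg g" "rat_subst g r \<noteq> 0"
  shows "inverse r \<in> reg g" "rat_subst g (inverse r) = inverse (rat_subst g r)"
proof -
  obtain p q where r: "p \<in> polys (dim_vec g)" "q \<in> polys (dim_vec g)" "poly_subst g q \<noteq> 0" "q \<noteq> 0"
    "r = Fract p q" using assms(1) by (rule regE)
  with assms(2) have "poly_subst g p \<noteq> 0" by (auto simp: rat_subst_Fract)
  with r show "inverse r \<in> reg g" "rat_subst g (inverse r) = inverse (rat_subst g r)"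
    by (auto simp: rat_subst_Fract intro: regI)
qed

lemma reg_divide:
  assumes "r \<in> reg g" "s \<in> reg g" "rat_subst g s \<noteq> 0"
  shows "r / s \<in> reg g" "rat_subst g (r / s) = rat_subst g r / rat_subst g s"
  using assms by (simp_all add: divide_inverse reg_inverse reg_add_mult)

lemma reg_power:
  assumes "r \<in> reg g"
  shows "r ^ k \<in> reg g \<and> rat_subst g (r ^ k) = rat_subst g r ^ k"
  using assms by (induction k) (auto simp: reg_add_mult)

lemma reg_powi:
  assumes "r \<in> reg g" "rat_subst g r \<noteq> 0"
  shows "r powi k \<in> reg g \<and> rat_subst g (r powi k) = rat_subst g r powi k"
  using assms by (simp add: power_int_def reg_power reg_inverse)

lemma reg_prod:
  assumes "\<And>i. i \<in> A \<Longrightarrow> f i \<in> reg g"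
  shows "prod f A \<in> reg g \<and> rat_subst g (prod f A) = (\<Prod>i\<in>A. rat_subst g (f i))"
  using assms by (induction A rule: infinite_finite_induct) (auto simp: reg_add_mult)

lemma reg_peval:
  assumes "p \<in> polys k" "\<And>i. i < k \<Longrightarrow> f i \<in> reg g"
  shows "peval scalar f p \<in> reg g \<and> rat_subst g (peval scalar f p) = peval scalar (\<lambda>i. rat_subst g (f i)) p"
  using assms
  by (induction p rule: polys_induct)
    (auto simp: scalar.peval_Const scalar.peval_Var scalar.peval_add scalar.peval_mult reg_add_mult)

text \<open>No nonzero denominator is killed by a dominant substitution, so the local ring is the
  whole function field.\<close>

lemma reg_dominant:
  assumes "dominant g"
  shows "reg g = ratfuns (dim_vec g)"
proof -
  have "poly_subst g q \<noteq> 0 \<longleftrightarrow> q \<noteq> 0" if "q \<in> polys (dim_vec g)" for q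
    using assms that by (auto simp: dominant_def poly_subst_peval)
  then show ?thesis unfolding reg_def ratfuns_def by blast
qed

lemma dim_rat_comp [simp]: "dim_vec (rat_comp f g) = dim_vec f"
  by (simp add: rat_comp_def)

lemma rat_comp_index [simp]: "i < dim_vec f \<Longrightarrow> rat_comp f g $ i = rat_subst g (f $ i)"
  by (simp add: rat_comp_def)

lemma rat_id_index [simp]: "i < n \<Longrightarrow> rat_id n $ i = coord i" "dim_vec (rat_id n) = n"
  by (simp_all add: rat_id_def)

lemma poly_subst_coords:
  assumes "p \<in> polys n" "\<And>i. i < n \<Longrightarrow> f $ i = coord i"
  shows "poly_subst f p = to_fract p"
  unfolding poly_subst_peval peval_coord[symmetric] by (rule peval_cong) (use assms polysD in blast)

lemma poly_subst_rat_comp: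
  assumes "p \<in> polys (dim_vec f)" "\<And>i. i < dim_vec f \<Longrightarrow> f $ i \<in> reg g"
  shows "poly_subst f p \<in> reg g" "rat_subst g (poly_subst f p) = poly_subst (rat_comp f g) p"
proof -
  have "peval scalar (\<lambda>i. rat_subst g (f $ i)) p = peval scalar (\<lambda>i. rat_comp f g $ i) p"
    by (rule peval_cong) (use assms polysD in force)
  with reg_peval[OF assms(1), of "\<lambda>i. f $ i" g] assms(2)
  show "poly_subst f p \<in> reg g" "rat_subst g (poly_subst f p) = poly_subst (rat_comp f g) p"
    by (simp_all add: poly_subst_peval)
qed

text \<open>A left inverse under substitution forces algebraic independence.\<close>

lemma dominantI:
  assumes "dim_vec f = dim_vec g" "\<And>i. i < dim_vec g \<Longrightarrow> g $ i \<in> reg f"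
    and "\<And>i. i < dim_vec g \<Longrightarrow> rat_subst f (g $ i) = coord i"
  shows "dominant g"
  unfolding dominant_def
proof safe
  fix p assume p: "p \<in> polys (dim_vec g)" "poly_subst g p = 0"
  have "poly_subst (rat_comp g f) p = to_fract p"
    by (rule poly_subst_coords[OF p(1)]) (simp add: assms)
  with poly_subst_rat_comp(2)[OF p(1) assms(2)] p(2) have "to_fract p = 0" by simp
  then show "p = 0" by simp
qed

section \<open>The Cremona group\<close>

lemma ratmapsI: "dim_vec f = n \<Longrightarrow> (\<And>i. i < n \<Longrightarrow> f $ i \<in> ratfuns n) \<Longrightarrow> f \<in> ratmaps n"
  unfolding ratmaps_def using carrier_vecI[of f n] by blast

lemma ratmapsD:
  assumes "f \<in> ratmaps n"
  shows "dim_vec f = n" "i < n \<Longrightarrow> f $ i \<in> ratfuns n"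
  using assms carrier_vecD[of f n] unfolding ratmaps_def by blast+

lemma rat_subst_ratfuns:
  assumes "f \<in> ratmaps n" "r \<in> reg f"
  shows "rat_subst f r \<in> ratfuns n"
  using assms(2)
proof (elim regE)
  fix p q assume *: "p \<in> polys (dim_vec f)" "q \<in> polys (dim_vec f)" "poly_subst f q \<noteq> 0" "r = Fract p q"
  have "poly_subst f p \<in> ratfuns n" "poly_subst f q \<in> ratfuns n"
    using *(1,2) unfolding poly_subst_peval ratmapsD(1)[OF assms(1)]
    by (blast intro: ratfuns_peval ratmapsD(2)[OF assms(1)])+
  then show ?thesis unfolding *(4) rat_subst_Fract[OF *(1-3)] by (rule ratfuns_divide)
qed

lemma rat_comp_ratmaps:
  assumes "f \<in> ratmaps n" "g \<in> ratmaps n" "dominant g"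
  shows "rat_comp f g \<in> ratmaps n"
proof (rule ratmapsI)
  show "dim_vec (rat_comp f g) = n" using ratmapsD(1)[OF assms(1)] by simp
  fix i assume "i < n"
  moreover from this have "f $ i \<in> reg g"
    using ratmapsD(2)[OF assms(1)] reg_dominant[OF assms(3)] ratmapsD(1)[OF assms(2)] by simp
  ultimately show "rat_comp f g $ i \<in> ratfuns n"
    using rat_subst_ratfuns[OF assms(2)] ratmapsD(1)[OF assms(1)] by (metis rat_comp_index)
qed

text \<open>Pullback along a dominant map is a ring homomorphism on the whole function field, hence
  injective because \<open>r\<close> times its inverse goes to 1. Injectivity gives dominance of the
  composite, and contravariance follows from the polynomial case by taking quotients.\<close>

lemma rat_subst_rat_comp:
  assumes "f \<in> ratmaps n" "g \<in> ratmaps n" "dominant f" "dominant g"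
  shows "dominant (rat_comp f g)"
    and "r \<in> ratfuns n \<Longrightarrow> rat_subst (rat_comp f g) r = rat_subst g (rat_subst f r)"
proof -
  note d = ratmapsD[OF assms(1)] ratmapsD[OF assms(2)]
  have *: "poly_subst (rat_comp f g) p = rat_subst g (poly_subst f p)" "poly_subst f p \<in> reg g" if "p \<in> polys n" for p
  proof -
    have p: "p \<in> polys (dim_vec f)" and f: "f $ i \<in> reg g" if "i < dim_vec f" for i
      using that \<open>p \<in> polys n\<close> d reg_dominant[OF assms(4)] by simp_all
    show "poly_subst (rat_comp f g) p = rat_subst g (poly_subst f p)" "poly_subst f p \<in> reg g"
      using poly_subst_rat_comp[of p f g, OF _ f] \<open>p \<in> polys n\<close> d(1) by simp_all
  qed
  have nz: "rat_subst g r \<noteq> 0" if "r \<noteq> 0" "r \<in> ratfuns n" for r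
  proof -
    have "r \<in> reg g" "inverse r \<in> reg g" using that d(3) reg_dominant[OF assms(4)] by (simp_all add: ratfuns_inverse)
    from reg_add_mult(4)[OF this] have "rat_subst g r * rat_subst g (inverse r) = rat_subst g 1"
      using that(1) by simp
    then show ?thesis by (metis mult_zero_left rat_subst_1 zero_neq_one)
  qed
  have dom: "poly_subst (rat_comp f g) p \<noteq> 0" if "p \<in> polys n" "p \<noteq> 0" for p
  proof -
    have "poly_subst f p \<noteq> 0" using assms(3) that d(1) by (auto simp: dominant_def)
    moreover have "poly_subst f p \<in> ratfuns n" using *(2)[OF that(1)] d(3) reg_dominant[OF assms(4)] by simp
    ultimately show ?thesis unfolding *(1)[OF that(1)] by (rule nz)
  qed
  then show "dominant (rat_comp f g)" using d(1) by (auto simp: dominant_def)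
  assume "r \<in> ratfuns n"
  then show "rat_subst (rat_comp f g) r = rat_subst g (rat_subst f r)"
  proof (elim ratfunsE)
    fix p q assume pq: "p \<in> polys n" "q \<in> polys n" "q \<noteq> 0" "r = Fract p q"
    have f: "poly_subst f q \<noteq> 0" using assms(3) pq(2,3) d(1) by (auto simp: dominant_def)
    have "rat_subst (rat_comp f g) r = poly_subst (rat_comp f g) p / poly_subst (rat_comp f g) q"
      using pq dom d(1) by (simp add: rat_subst_Fract)
    also have "\<dots> = rat_subst g (poly_subst f p) / rat_subst g (poly_subst f q)"
      using *(1)[OF pq(1)] *(1)[OF pq(2)] by simp
    also have "\<dots> = rat_subst g (poly_subst f p / poly_subst f q)"
      by (rule reg_divide(2)[symmetric]) (use *[OF pq(1)] *[OF pq(2)] dom[OF pq(2,3)] in simp_all)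
    also have "\<dots> = rat_subst g (rat_subst f r)" using pq f d(1) by (simp add: rat_subst_Fract)
    finally show ?thesis .
  qed
qed

lemma rat_comp_assoc:
  assumes "f \<in> ratmaps n" "g \<in> ratmaps n" "h \<in> ratmaps n" "dominant g" "dominant h"
  shows "rat_comp (rat_comp f g) h = rat_comp f (rat_comp g h)"
proof (rule eq_vecI)
  fix i assume "i < dim_vec (rat_comp f (rat_comp g h))"
  then have "i < n" "i < dim_vec f" using ratmapsD[OF assms(1)] by auto
  then show "rat_comp (rat_comp f g) h $ i = rat_comp f (rat_comp g h) $ i"
    using rat_subst_rat_comp(2)[OF assms(2,3,4,5)] ratmapsD[OF assms(1)] by simp
qed simp

lemma rat_id_ratmaps: "rat_id n \<in> ratmaps n"
  by (rule ratmapsI) auto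

lemma dominant_rat_id: "dominant (rat_id n)"
proof -
  have "poly_subst (rat_id n) p = to_fract p" if "p \<in> polys n" for p :: "'a mpoly"
    by (rule poly_subst_coords[OF that]) simp
  then show ?thesis unfolding dominant_def rat_id_index(2) by (metis to_fract_eq_0_iff)
qed

lemma rat_comp_id_left: "f \<in> ratmaps n \<Longrightarrow> rat_comp (rat_id n) f = f"
  using ratmapsD(1)[of f n] by (intro eq_vecI) simp_all

lemma birationalD: "birational n f \<Longrightarrow> f \<in> ratmaps n" "birational n f \<Longrightarrow> dominant f"
  by (auto simp: birational_def)

lemma rat_comp_rat_comp_inverse:
  assumes f: "f \<in> ratmaps n" "g \<in> ratmaps n" "f' \<in> ratmaps n" "g' \<in> ratmaps n"
    and d: "dominant g" "dominant f'" "dominant g'"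
    and inv: "rat_comp f f' = rat_id n" "rat_comp g g' = rat_id n"
  shows "rat_comp (rat_comp f g) (rat_comp g' f') = rat_id n"
proof -
  have "rat_comp (rat_comp f g) (rat_comp g' f') = rat_comp f (rat_comp g (rat_comp g' f'))"
    by (intro rat_comp_assoc[OF f(1,2)] rat_comp_ratmaps rat_subst_rat_comp(1)[OF f(4,3)] f d)
  also have "rat_comp g (rat_comp g' f') = rat_comp (rat_comp g g') f'"
    by (rule rat_comp_assoc[symmetric]) (rule f d)+
  also have "\<dots> = f'" unfolding inv(2) by (rule rat_comp_id_left) (rule f)
  finally show ?thesis unfolding inv(1) .
qed

lemma birational_rat_comp:
  assumes "birational n f" "birational n g"
  shows "birational n (rat_comp f g)"
proof -
  note d = birationalD[OF assms(1)] birationalD[OF assms(2)]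
  from assms obtain f' g' where
    f': "f' \<in> ratmaps n" "dominant f'" "rat_comp f f' = rat_id n" "rat_comp f' f = rat_id n" and
    g': "g' \<in> ratmaps n" "dominant g'" "rat_comp g g' = rat_id n" "rat_comp g' g = rat_id n"
    unfolding birational_def by blast
  note * = d f' g'
  show ?thesis unfolding birational_def
  proof (intro conjI bexI[of _ "rat_comp g' f'"])
    show "rat_comp (rat_comp f g) (rat_comp g' f') = rat_id n"
      by (rule rat_comp_rat_comp_inverse) (rule *)+
    show "rat_comp (rat_comp g' f') (rat_comp f g) = rat_id n"
      by (rule rat_comp_rat_comp_inverse) (rule *)+
    show "dominant (rat_comp f g)" by (rule rat_subst_rat_comp(1)) (rule *)+
    show "dominant (rat_comp g' f')" by (rule rat_subst_rat_comp(1)) (rule *)+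
    show "rat_comp f g \<in> ratmaps n" by (rule rat_comp_ratmaps) (rule *)+
    show "rat_comp g' f' \<in> ratmaps n" by (rule rat_comp_ratmaps) (rule *)+
  qed
qed

lemma Bir_simps [simp]: "f \<otimes>\<^bsub>Bir n\<^esub> g = rat_comp f g" "\<one>\<^bsub>Bir n\<^esub> = rat_id n"
    "f \<in> carrier (Bir n) \<longleftrightarrow> birational n f"
  by (simp_all add: Bir_def)

lemma birational_rat_id: "birational n (rat_id n)"
  unfolding birational_def using rat_id_ratmaps dominant_rat_id rat_comp_id_left by blast

lemma group_Bir: "group (Bir n :: 'k::field ratfun vec monoid)"
proof (rule groupI, unfold Bir_simps)
  show "birational n (rat_id n)" by (rule birational_rat_id)
  fix f :: "'k ratfun vec" assume f: "birational n f"
  then show "rat_comp (rat_id n) f = f" using birationalD rat_comp_id_left by blast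
  from f obtain g' where g': "g' \<in> ratmaps n" "dominant g'" "rat_comp f g' = rat_id n" "rat_comp g' f = rat_id n"
    unfolding birational_def by blast
  then have "birational n g'"
    unfolding birational_def using birationalD[OF f] by blast
  with g'(4) show "\<exists>g\<in>carrier (Bir n). rat_comp g f = rat_id n" by auto
  fix g h :: "'k ratfun vec"
  assume g: "birational n g"
  show "birational n (rat_comp f g)" using f g by (rule birational_rat_comp)
  assume h: "birational n h"
  show "rat_comp (rat_comp f g) h = rat_comp f (rat_comp g h)"
    by (rule rat_comp_assoc) (use f g h birationalD in blast)+
qed

text \<open>The \<open>reg\<close> premises make the substitutions meaningful before dominance is
  known. Each map inverts the other under substitution, and \<open>dominantI\<close> turns this into
  dominance of both.\<close>

lemma birationalI:
  assumes "f \<in> ratmaps n" "g \<in> ratmaps n"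
    and "\<And>i. i < n \<Longrightarrow> g $ i \<in> reg f \<and> rat_subst f (g $ i) = coord i"
    and "\<And>i. i < n \<Longrightarrow> f $ i \<in> reg g \<and> rat_subst g (f $ i) = coord i"
  shows "birational n f" "birational n g" "inv\<^bsub>Bir n\<^esub> f = g" "inv\<^bsub>Bir n\<^esub> g = f"
proof -
  note d = ratmapsD[OF assms(1)] ratmapsD[OF assms(2)]
  have "dominant f" "dominant g"
    by (rule dominantI[of g f]; use assms(4) d(1,3) in simp)
      (rule dominantI[of f g]; use assms(3) d(1,3) in simp)
  moreover have "rat_comp f g = rat_id n" "rat_comp g f = rat_id n"
    by (rule eq_vecI; use assms(3,4) d(1,3) in simp)+
  ultimately show *: "birational n f" "birational n g" using assms(1,2) unfolding birational_def by blast+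
  interpret group "Bir n" by (rule group_Bir)
  show "inv\<^bsub>Bir n\<^esub> f = g" "inv\<^bsub>Bir n\<^esub> g = f"
    using inv_equality[of g f] inv_equality[of f g] * \<open>rat_comp f g = rat_id n\<close> \<open>rat_comp g f = rat_id n\<close>
    by simp_all
qed

lemma birational_inv:
  assumes "birational n f"
  shows "birational n (inv\<^bsub>Bir n\<^esub> f)" "rat_comp f (inv\<^bsub>Bir n\<^esub> f) = rat_id n" "rat_comp (inv\<^bsub>Bir n\<^esub> f) f = rat_id n"
proof -
  interpret group "Bir n" by (rule group_Bir)
  show "birational n (inv\<^bsub>Bir n\<^esub> f)" "rat_comp f (inv\<^bsub>Bir n\<^esub> f) = rat_id n" "rat_comp (inv\<^bsub>Bir n\<^esub> f) f = rat_id n"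
    using inv_closed[of f] r_inv[of f] l_inv[of f] assms by simp_all
qed

section \<open>Conjugacy in a group and in its subgroups\<close>

lemma conjugate_in_subgroup:
  assumes "group G" "subgroup H G"
  shows "conjugate_in (G\<lparr>carrier := H\<rparr>) f g \<longleftrightarrow> (\<exists>h\<in>H. h \<otimes>\<^bsub>G\<^esub> f \<otimes>\<^bsub>G\<^esub> inv\<^bsub>G\<^esub> h = g)"
  using group.m_inv_consistent[OF assms] by (auto simp: conjugate_in_def)

lemma conjugate_in_sym:
  assumes "group G" "f \<in> carrier G" "conjugate_in G f g"
  shows "conjugate_in G g f"
proof -
  interpret group G by fact
  obtain h where h: "h \<in> carrier G" "h \<otimes>\<^bsub>G\<^esub> f \<otimes>\<^bsub>G\<^esub> inv\<^bsub>G\<^esub> h = g"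
    using assms(3) by (auto simp: conjugate_in_def)
  then have "inv\<^bsub>G\<^esub> h \<otimes>\<^bsub>G\<^esub> g \<otimes>\<^bsub>G\<^esub> inv\<^bsub>G\<^esub> (inv\<^bsub>G\<^esub> h) = f"
    using assms(2) by (metis inv_closed inv_inv inv_solve_left' inv_solve_right m_assoc m_closed)
  with h show ?thesis unfolding conjugate_in_def by blast
qed

lemma conjugate_in_closed:
  assumes "group G" "f \<in> carrier G" "conjugate_in G f g"
  shows "g \<in> carrier G"
proof -
  interpret group G by fact
  show ?thesis using assms(2,3) by (auto simp: conjugate_in_def)
qed

lemma conjugate_in_trans:
  assumes "group G" "f \<in> carrier G" "conjugate_in G f g" "conjugate_in G g k"
  shows "conjugate_in G f k"
proof -
  interpret group G by fact
  obtain a b where a: "a \<in> carrier G" "a \<otimes>\<^bsub>G\<^esub> f \<otimes>\<^bsub>G\<^esub> inv\<^bsub>G\<^esub> a = g"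
    and b: "b \<in> carrier G" "b \<otimes>\<^bsub>G\<^esub> g \<otimes>\<^bsub>G\<^esub> inv\<^bsub>G\<^esub> b = k"
    using assms(3,4) by (auto simp: conjugate_in_def)
  have "(b \<otimes>\<^bsub>G\<^esub> a) \<otimes>\<^bsub>G\<^esub> f \<otimes>\<^bsub>G\<^esub> inv\<^bsub>G\<^esub> (b \<otimes>\<^bsub>G\<^esub> a) =
    b \<otimes>\<^bsub>G\<^esub> (a \<otimes>\<^bsub>G\<^esub> f \<otimes>\<^bsub>G\<^esub> inv\<^bsub>G\<^esub> a) \<otimes>\<^bsub>G\<^esub> inv\<^bsub>G\<^esub> b"
    using assms(2) a(1) b(1) by (simp add: inv_mult_group m_assoc)
  then have "(b \<otimes>\<^bsub>G\<^esub> a) \<otimes>\<^bsub>G\<^esub> f \<otimes>\<^bsub>G\<^esub> inv\<^bsub>G\<^esub> (b \<otimes>\<^bsub>G\<^esub> a) = k"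
    unfolding a(2) b(2) .
  with a b show ?thesis unfolding conjugate_in_def by blast
qed

lemma conjugate_in_mono:
  assumes "group G" "subgroup H G" "conjugate_in (G\<lparr>carrier := H\<rparr>) f g"
  shows "conjugate_in G f g"
  using assms subgroup.subset[OF assms(2)] unfolding conjugate_in_subgroup[OF assms(1,2)]
  by (auto simp: conjugate_in_def)

section \<open>Polynomial automorphisms\<close>

text \<open>Keeps the polynomials themselves at hand, so that composition and inversion of
  polynomial maps become identities of \<open>peval Const\<close> without fractions.\<close>

definition pmap :: "nat \<Rightarrow> (nat \<Rightarrow> 'k::field mpoly) \<Rightarrow> 'k ratfun vec" where
  "pmap n F = vec n (\<lambda>i. to_fract (F i))"

lemma pmap_index [simp]: "dim_vec (pmap n F) = n" "i < n \<Longrightarrow> pmap n F $ i = to_fract (F i)"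
  by (simp_all add: pmap_def)

lemma pmap_cong: "(\<And>i. i < n \<Longrightarrow> F i = G i) \<Longrightarrow> pmap n F = pmap n G"
  by (rule eq_vecI) simp_all

lemma pmap_ratmaps: "(\<And>i. i < n \<Longrightarrow> F i \<in> polys n) \<Longrightarrow> pmap n F \<in> ratmaps n"
  by (rule ratmapsI) (simp_all add: ratfuns_to_fract)

lemma polymaps_iff: "f \<in> polymaps n \<longleftrightarrow> (\<exists>F. (\<forall>i<n. F i \<in> polys n) \<and> f = pmap n F)"
proof
  assume f: "f \<in> polymaps n"
  then have "\<forall>i\<in>{..<n}. \<exists>p. p \<in> polys n \<and> f $ i = to_fract p" unfolding polymaps_def by blast
  then obtain F where F: "\<forall>i\<in>{..<n}. F i \<in> polys n \<and> f $ i = to_fract (F i)" by metis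
  have "f \<in> carrier_vec n" using f unfolding polymaps_def by blast
  then have "dim_vec f = n" by (rule carrier_vecD)
  with F have "f = pmap n F" by (intro eq_vecI) simp_all
  with F show "\<exists>F. (\<forall>i<n. F i \<in> polys n) \<and> f = pmap n F" by blast
next
  assume "\<exists>F. (\<forall>i<n. F i \<in> polys n) \<and> f = pmap n F"
  then obtain F where F: "\<forall>i<n. F i \<in> polys n" "f = pmap n F" by blast
  moreover have "pmap n F \<in> carrier_vec n" by (simp add: pmap_def)
  ultimately show "f \<in> polymaps n" unfolding polymaps_def by simp
qed

lemma poly_subst_pmap:
  assumes "p \<in> polys n"
  shows "poly_subst (pmap n F) p = to_fract (peval Const F p)"
  unfolding poly_subst_peval peval_to_fract[symmetric]
  by (rule peval_cong) (use polysD[OF assms] in force)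

lemma rat_subst_pmap:
  assumes "p \<in> polys n"
  shows "rat_subst (pmap n F) (to_fract p) = to_fract (peval Const F p)" "to_fract p \<in> reg (pmap n F)"
  using assms by (simp_all add: rat_subst_poly poly_subst_pmap reg_poly)

lemma rat_comp_pmap:
  assumes "\<And>i. i < n \<Longrightarrow> G i \<in> polys n"
  shows "rat_comp (pmap n G) (pmap n F) = pmap n (\<lambda>i. peval Const F (G i))"
  by (rule eq_vecI) (simp_all add: rat_subst_pmap assms)

lemma rat_id_pmap: "rat_id n = pmap n Var"
  by (rule eq_vecI) (simp_all add: to_fract_Var)

lemma Aut_carrier: "f \<in> carrier (Aut n) \<longleftrightarrow> birational n f \<and> f \<in> polymaps n \<and> inv\<^bsub>Bir n\<^esub> f \<in> polymaps n"
  by (simp add: Aut_def)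

lemma Aut_alt: "Aut n = (Bir n)\<lparr>carrier := carrier (Aut n)\<rparr>"
  by (simp add: Aut_def)

lemma pmap_Aut:
  assumes "\<And>i. i < n \<Longrightarrow> F i \<in> polys n" "\<And>i. i < n \<Longrightarrow> G i \<in> polys n"
    and "\<And>i. i < n \<Longrightarrow> peval Const F (G i) = Var i" "\<And>i. i < n \<Longrightarrow> peval Const G (F i) = Var i"
  shows "pmap n F \<in> carrier (Aut n)" "inv\<^bsub>Bir n\<^esub> (pmap n F) = pmap n G" "birational n (pmap n F)"
proof -
  have b: "birational n (pmap n F)" "inv\<^bsub>Bir n\<^esub> (pmap n F) = pmap n G"
    by (rule birationalI[of "pmap n F" n "pmap n G"];
        use assms in \<open>simp add: pmap_ratmaps rat_subst_pmap to_fract_Var\<close>)+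
  moreover have "pmap n F \<in> polymaps n" "pmap n G \<in> polymaps n"
    using assms(1,2) unfolding polymaps_iff by blast+
  ultimately show "pmap n F \<in> carrier (Aut n)" "inv\<^bsub>Bir n\<^esub> (pmap n F) = pmap n G" "birational n (pmap n F)"
    unfolding Aut_carrier by simp_all
qed

lemma AutE:
  assumes "f \<in> carrier (Aut n)"
  obtains F G where "\<And>i. i < n \<Longrightarrow> F i \<in> polys n" "\<And>i. i < n \<Longrightarrow> G i \<in> polys n"
    "f = pmap n F" "inv\<^bsub>Bir n\<^esub> f = pmap n G"
    "\<And>i. i < n \<Longrightarrow> peval Const F (G i) = Var i" "\<And>i. i < n \<Longrightarrow> peval Const G (F i) = Var i"
proof -
  obtain F where F: "\<forall>i<n. F i \<in> polys n" "f = pmap n F"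
    using assms unfolding Aut_carrier polymaps_iff by blast
  obtain G where G: "\<forall>i<n. G i \<in> polys n" "inv\<^bsub>Bir n\<^esub> f = pmap n G"
    using assms unfolding Aut_carrier polymaps_iff by blast
  have f: "birational n f" using assms unfolding Aut_carrier by blast
  have 1: "pmap n (\<lambda>i. peval Const F (G i)) = pmap n Var"
    using birational_inv(3)[OF f] unfolding G(2) unfolding F(2) rat_id_pmap
    by (subst (asm) rat_comp_pmap) (use G(1) in blast)+
  have 2: "pmap n (\<lambda>i. peval Const G (F i)) = pmap n Var"
    using birational_inv(2)[OF f] unfolding G(2) unfolding F(2) rat_id_pmap
    by (subst (asm) rat_comp_pmap) (use F(1) in blast)+
  have "peval Const F (G i) = Var i" "peval Const G (F i) = Var i" if "i < n" for i
    using arg_cong[OF 1, of "\<lambda>v. v $ i"] arg_cong[OF 2, of "\<lambda>v. v $ i"] that by simp_all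
  with F G show thesis using that by blast
qed

lemma subgroup_Aut: "subgroup (carrier (Aut n)) (Bir n :: 'k::field ratfun vec monoid)"
proof (rule group.subgroupI[OF group_Bir])
  show "carrier (Aut n) \<subseteq> carrier (Bir n)" using Aut_carrier by fastforce
  have "pmap n Var \<in> carrier (Aut n :: 'k ratfun vec monoid)" by (rule pmap_Aut) (simp_all add: Const.peval_Var)
  then show "carrier (Aut n :: 'k ratfun vec monoid) \<noteq> {}" by blast
  fix f assume f: "f \<in> carrier (Aut n :: 'k ratfun vec monoid)"
  then show "inv\<^bsub>Bir n\<^esub> f \<in> carrier (Aut n)" unfolding Aut_carrier
    using birational_inv(1)[of n f] group.inv_inv[OF group_Bir, of f n] by simp
  fix g assume g: "g \<in> carrier (Aut n :: 'k ratfun vec monoid)"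
  from f obtain F F' where F: "\<And>i. i < n \<Longrightarrow> F i \<in> polys n" "\<And>i. i < n \<Longrightarrow> F' i \<in> polys n"
    "f = pmap n F" "\<And>i. i < n \<Longrightarrow> peval Const F (F' i) = Var i" "\<And>i. i < n \<Longrightarrow> peval Const F' (F i) = Var i"
    by (rule AutE) blast
  from g obtain G G' where G: "\<And>i. i < n \<Longrightarrow> G i \<in> polys n" "\<And>i. i < n \<Longrightarrow> G' i \<in> polys n"
    "g = pmap n G" "\<And>i. i < n \<Longrightarrow> peval Const G (G' i) = Var i" "\<And>i. i < n \<Longrightarrow> peval Const G' (G i) = Var i"
    by (rule AutE) blast
  have comp: "peval Const H (peval Const K p) = peval Const (\<lambda>i. peval Const H (K i)) p"
    for H K :: "nat \<Rightarrow> 'k mpoly" and p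
    using peval_hom_comp[OF Const.peval_comm_ring_hom[of H], of Const K p] by (simp add: Const.peval_Const)
  \<comment> \<open>One computation for both sides of the inverse of a composite; it is applied once
    to each order of the factors.\<close>
  have inv: "peval Const (\<lambda>i. peval Const K (H i)) (peval Const H' (K' i)) = Var i"
    if "\<And>i. i < n \<Longrightarrow> H i \<in> polys n" "\<And>i. i < n \<Longrightarrow> H' i \<in> polys n" "\<And>i. i < n \<Longrightarrow> K' i \<in> polys n"
      "\<And>i. i < n \<Longrightarrow> peval Const H (H' i) = Var i" "\<And>i. i < n \<Longrightarrow> peval Const K (K' i) = Var i" "i < n"
    for H H' K K' :: "nat \<Rightarrow> 'k mpoly" and i
  proof -
    have "peval Const (\<lambda>i. peval Const K (H i)) (peval Const H' (K' i)) =
      peval Const K (peval Const (\<lambda>j. peval Const H (H' j)) (K' i))"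
      by (simp add: comp[symmetric])
    also have "peval Const (\<lambda>j. peval Const H (H' j)) (K' i) = peval Const Var (K' i)"
      by (rule peval_cong) (use polysD[OF that(3)[OF that(6)]] that(4) in blast)
    finally show ?thesis using that(5,6) by (simp add: peval_Var_id)
  qed
  have "pmap n (\<lambda>i. peval Const G (F i)) \<in> carrier (Aut n)"
  proof (rule pmap_Aut)
    show "peval Const (\<lambda>i. peval Const G (F i)) (peval Const F' (G' i)) = Var i" if "i < n" for i
      by (rule inv[of F F' G' G]) (use F G that in blast)+
    show "peval Const (\<lambda>i. peval Const F' (G' i)) (peval Const G (F i)) = Var i" if "i < n" for i
      by (rule inv[of G' G F F']) (use F G that in blast)+
  qed (use F G in \<open>blast intro: polys_peval\<close>)+
  then show "f \<otimes>\<^bsub>Bir n\<^esub> g \<in> carrier (Aut n)"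
    unfolding F(3) G(3) Bir_simps by (subst rat_comp_pmap) (use F(1) in blast)+
qed

lemma group_Aut: "group (Aut n :: 'k::field ratfun vec monoid)"
  using group.subgroup_imp_group[OF group_Bir subgroup_Aut] by (simp flip: Aut_alt)

lemma conjugate_in_Aut_iff:
  "conjugate_in (Aut n) f g \<longleftrightarrow> (\<exists>h\<in>carrier (Aut n). rat_comp (rat_comp h f) (inv\<^bsub>Bir n\<^esub> h) = g)"
  using conjugate_in_subgroup[OF group_Bir subgroup_Aut, of n f g] by (simp flip: Aut_alt)

lemma conjugate_in_Aut_Bir: "conjugate_in (Aut n) f g \<Longrightarrow> conjugate_in (Bir n) f g"
  using conjugate_in_mono[OF group_Bir subgroup_Aut] by (simp flip: Aut_alt)

section \<open>Affine automorphisms\<close>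

definition affine_poly :: "nat \<Rightarrow> 'k::field mat \<Rightarrow> 'k vec \<Rightarrow> nat \<Rightarrow> 'k mpoly" where
  "affine_poly n M b i = (\<Sum>j<n. Const (M $$ (i, j)) * Var j) + Const (b $ i)"

lemma polys_affine_poly [simp]: "affine_poly n M b i \<in> polys n"
  unfolding affine_poly_def by (intro polys_add polys_sum polys_mult) simp_all

lemma affine_map_pmap: "M \<in> carrier_mat n n \<Longrightarrow> affine_map M b = pmap n (affine_poly n M b)"
  by (rule eq_vecI) (simp_all add: affine_map_def affine_poly_def to_fract_Const to_fract_Var)

lemma peval_sum:
  fixes f :: "'b \<Rightarrow> (nat \<Rightarrow>\<^sub>0 nat) \<Rightarrow>\<^sub>0 'a::comm_ring_1"
  shows "peval Const F (sum f A) = (\<Sum>x\<in>A. peval Const F (f x))"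
  by (induction A rule: infinite_finite_induct) (simp_all add: Const.peval_add)

lemma peval_affine_poly:
  "peval Const F (affine_poly n M b i) = (\<Sum>j<n. Const (M $$ (i, j)) * F j) + Const (b $ i)"
  by (simp add: affine_poly_def Const.peval_add Const.peval_mult Const.peval_Const Const.peval_Var
      peval_sum)

lemma affine_poly_comp:
  assumes "M \<in> carrier_mat n n" "N \<in> carrier_mat n n" "b \<in> carrier_vec n" "c \<in> carrier_vec n" "i < n"
  shows "peval Const (affine_poly n N c) (affine_poly n M b i) = affine_poly n (M * N) (M *\<^sub>v c + b) i"
proof -
  have "(\<Sum>j<n. Const (M $$ (i, j)) * affine_poly n N c j) =
    (\<Sum>j<n. \<Sum>k<n. Const (M $$ (i, j) * N $$ (j, k)) * Var k) + (\<Sum>j<n. Const (M $$ (i, j) * c $ j))"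
    by (simp add: affine_poly_def distrib_left sum.distrib sum_distrib_left mult.assoc Const.hom_mult)
  also have "(\<Sum>j<n. \<Sum>k<n. Const (M $$ (i, j) * N $$ (j, k)) * Var k) =
    (\<Sum>k<n. Const ((M * N) $$ (i, k)) * Var k)"
    by (subst sum.swap) (use assms in \<open>simp add: scalar_prod_def atLeast0LessThan Const.hom_sum sum_distrib_right\<close>)
  also have "(\<Sum>j<n. Const (M $$ (i, j) * c $ j)) = Const ((M *\<^sub>v c) $ i)"
    using assms by (simp add: scalar_prod_def atLeast0LessThan Const.hom_sum)
  finally have "peval Const (affine_poly n N c) (affine_poly n M b i) =
    (\<Sum>k<n. Const ((M * N) $$ (i, k)) * Var k) + Const ((M *\<^sub>v c) $ i) + Const (b $ i)"
    by (simp only: peval_affine_poly)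
  then show ?thesis
    using assms by (simp add: affine_poly_def single_add add.assoc)
qed

lemma rat_comp_affine_map:
  assumes "M \<in> carrier_mat n n" "N \<in> carrier_mat n n" "b \<in> carrier_vec n" "c \<in> carrier_vec n"
  shows "rat_comp (affine_map M b) (affine_map N c) = affine_map (M * N) (M *\<^sub>v c + b)"
proof -
  have "M * N \<in> carrier_mat n n" using assms by simp
  then show ?thesis using assms by (simp add: affine_map_pmap[of _ n] rat_comp_pmap affine_poly_comp cong: pmap_cong)
qed

lemma affine_poly_id: "i < n \<Longrightarrow> affine_poly n (1\<^sub>m n) (0\<^sub>v n) i = (Var i :: 'k::field mpoly)"
proof -
  assume i: "i < n"
  have "(\<Sum>j<n. Const ((1\<^sub>m n) $$ (i, j)) * Var j) = (\<Sum>j<n. if j = i then Var j else (0 :: 'k mpoly))"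
    using i by (intro sum.cong) auto
  also have "\<dots> = Var i" using i by simp
  finally show ?thesis using i by (simp add: affine_poly_def)
qed

lemma GL_inverse:
  assumes "M \<in> GL n"
  obtains N where "N \<in> GL n" "M * N = 1\<^sub>m n" "N * M = 1\<^sub>m n"
proof -
  have M: "M \<in> carrier_mat n n" using assms by (simp add: GL_def)
  obtain N where N: "M * N = 1\<^sub>m (dim_row M)" "N * M = 1\<^sub>m (dim_row N)"
    using assms by (auto simp: GL_def invertible_mat_def inverts_mat_def)
  have "dim_col (M * N) = dim_row M" "dim_col (N * M) = dim_row N" by (simp_all only: N index_one_mat)
  then have Nc: "N \<in> carrier_mat n n" using M by auto
  with N M have "M * N = 1\<^sub>m n" "N * M = 1\<^sub>m n" by auto
  moreover from this M Nc have "N \<in> GL n"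
    by (auto simp: GL_def invertible_mat_def inverts_mat_def)
  ultimately show thesis using that by blast
qed

lemma GLI: "M \<in> carrier_mat n n \<Longrightarrow> N \<in> carrier_mat n n \<Longrightarrow> M * N = 1\<^sub>m n \<Longrightarrow> N * M = 1\<^sub>m n \<Longrightarrow> M \<in> GL n"
  by (auto simp: GL_def invertible_mat_def inverts_mat_def)

lemma GL_carrier: "M \<in> GL n \<Longrightarrow> M \<in> carrier_mat n n"
  by (simp add: GL_def)

lemma mult_mat_vec_uminus:
  fixes A :: "'a::comm_ring_1 mat"
  assumes "A \<in> carrier_mat nr nc" "v \<in> carrier_vec nc"
  shows "A *\<^sub>v (- v) = - (A *\<^sub>v v)"
  using assms by (intro eq_vecI) (simp_all add: scalar_prod_def sum_negf)

lemma affine_map_Aut: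
  assumes M: "M \<in> carrier_mat n n" "N \<in> carrier_mat n n" "M * N = 1\<^sub>m n" "N * M = 1\<^sub>m n" and b: "b \<in> carrier_vec n"
  shows "affine_map M b \<in> carrier (Aut n)"
    and "inv\<^bsub>Bir n\<^esub> (affine_map M b) = affine_map N (- (N *\<^sub>v b))"
proof -
  have c: "- (N *\<^sub>v b) \<in> carrier_vec n" using M b by simp
  have 1: "M *\<^sub>v (- (N *\<^sub>v b)) + b = 0\<^sub>v n"
  proof -
    have "M *\<^sub>v (- (N *\<^sub>v b)) = - (M *\<^sub>v (N *\<^sub>v b))"
      using M b by (intro mult_mat_vec_uminus[of _ n n]) simp_all
    also have "M *\<^sub>v (N *\<^sub>v b) = b" using M b by (simp flip: assoc_mult_mat_vec)
    finally show ?thesis using b by simp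
  qed
  have 2: "N *\<^sub>v b + (- (N *\<^sub>v b)) = 0\<^sub>v n" using M b by simp
  have "peval Const (affine_poly n M b) (affine_poly n N (- (N *\<^sub>v b)) i) = Var i"
    "peval Const (affine_poly n N (- (N *\<^sub>v b))) (affine_poly n M b i) = Var i" if "i < n" for i
    using that M b c by (simp_all add: affine_poly_comp 1 2 affine_poly_id)
  from pmap_Aut[OF polys_affine_poly polys_affine_poly this]
  show "affine_map M b \<in> carrier (Aut n)" "inv\<^bsub>Bir n\<^esub> (affine_map M b) = affine_map N (- (N *\<^sub>v b))"
    using M by (simp_all add: affine_map_pmap)
qed

lemma affine_data_Aut:
  assumes "(M, b) \<in> affine_data n"
  shows "affine_map M b \<in> carrier (Aut n)" "birational n (affine_map M b)"
proof -
  have M: "M \<in> GL n" "b \<in> carrier_vec n" using assms by (simp_all add: affine_data_def)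
  from GL_inverse[OF M(1)] obtain N where "N \<in> GL n" "M * N = 1\<^sub>m n" "N * M = 1\<^sub>m n" .
  with M show "affine_map M b \<in> carrier (Aut n)" by (intro affine_map_Aut) (simp_all add: GL_def)
  then show "birational n (affine_map M b)" by (simp add: Aut_carrier)
qed

lemma GL_mult:
  fixes M :: "'a::comm_ring_1 mat"
  assumes "M \<in> GL n" "N \<in> GL n"
  shows "M * N \<in> GL n"
proof -
  from GL_inverse[OF assms(1)] obtain M' where M': "M' \<in> GL n" "M * M' = 1\<^sub>m n" "M' * M = 1\<^sub>m n" .
  from GL_inverse[OF assms(2)] obtain N' where N': "N' \<in> GL n" "N * N' = 1\<^sub>m n" "N' * N = 1\<^sub>m n" .
  note c = GL_carrier[OF assms(1)] GL_carrier[OF assms(2)] GL_carrier[OF M'(1)] GL_carrier[OF N'(1)]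
  show ?thesis
  proof (rule GLI)
    have "(M * N) * (N' * M') = M * ((N * N') * M')" using c by (simp add: assoc_mult_mat[of _ n n _ n _ n])
    then show "(M * N) * (N' * M') = 1\<^sub>m n" using c M' N' by simp
    have "(N' * M') * (M * N) = N' * ((M' * M) * N)" using c by (simp add: assoc_mult_mat[of _ n n _ n _ n])
    then show "(N' * M') * (M * N) = 1\<^sub>m n" using c M' N' by simp
  qed (use c in auto)
qed

lemma Aff_carrier: "f \<in> carrier (Aff n) \<longleftrightarrow> (\<exists>M b. f = affine_map M b \<and> M \<in> GL n \<and> b \<in> carrier_vec n)"
  by (auto simp: Aff_def affine_data_def)

lemma Aff_alt: "Aff n = (Bir n)\<lparr>carrier := carrier (Aff n)\<rparr>"
  by (simp add: Aff_def)

lemma Aff_subset_Aut: "carrier (Aff n) \<subseteq> carrier (Aut n)"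
proof
  fix f :: "'a ratfun vec" assume "f \<in> carrier (Aff n)"
  then obtain M b where "f = affine_map M b" "(M, b) \<in> affine_data n"
    unfolding Aff_carrier affine_data_def by blast
  then show "f \<in> carrier (Aut n)" using affine_data_Aut(1) by blast
qed

lemma GL_one: "(1\<^sub>m n :: 'a::semiring_1 mat) \<in> GL n"
  by (rule GLI[where N = "1\<^sub>m n"]) simp_all

lemma subgroup_Aff: "subgroup (carrier (Aff n)) (Bir n :: 'k::field ratfun vec monoid)"
proof (rule group.subgroupI[OF group_Bir])
  show "carrier (Aff n) \<subseteq> carrier (Bir n)" using Aff_subset_Aut Aut_carrier by fastforce
  show "carrier (Aff n :: 'k ratfun vec monoid) \<noteq> {}"
    using GL_one[of n] zero_carrier_vec[of n] Aff_carrier[of _ n] by blast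
  fix f g :: "'k ratfun vec" assume "f \<in> carrier (Aff n)"
  then obtain M b where f: "f = affine_map M b" "M \<in> GL n" "b \<in> carrier_vec n" unfolding Aff_carrier by blast
  from GL_inverse[OF f(2)] obtain M' where M': "M' \<in> GL n" "M * M' = 1\<^sub>m n" "M' * M = 1\<^sub>m n" .
  note cf = GL_carrier[OF f(2)] GL_carrier[OF M'(1)]
  have "inv\<^bsub>Bir n\<^esub> f = affine_map M' (- (M' *\<^sub>v b))"
    unfolding f(1) by (rule affine_map_Aut) (use cf M' f in simp_all)
  moreover have "- (M' *\<^sub>v b) \<in> carrier_vec n" using cf f by simp
  ultimately show "inv\<^bsub>Bir n\<^esub> f \<in> carrier (Aff n)" using M' unfolding Aff_carrier by blast
  assume "g \<in> carrier (Aff n)"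
  then obtain N c where g: "g = affine_map N c" "N \<in> GL n" "c \<in> carrier_vec n" unfolding Aff_carrier by blast
  have "f \<otimes>\<^bsub>Bir n\<^esub> g = affine_map (M * N) (M *\<^sub>v c + b)"
    unfolding f(1) g(1) Bir_simps by (rule rat_comp_affine_map) (use f g GL_carrier in blast)+
  moreover have "M *\<^sub>v c + b \<in> carrier_vec n" using cf f g by simp
  ultimately show "f \<otimes>\<^bsub>Bir n\<^esub> g \<in> carrier (Aff n)" using GL_mult[OF f(2) g(2)] unfolding Aff_carrier by blast
qed

lemma conjugate_in_Aff_Aut: "conjugate_in (Aff n) f g \<Longrightarrow> conjugate_in (Aut n) f g"
  using conjugate_in_subgroup[OF group_Bir subgroup_Aff, of n f g] Aff_subset_Aut
  by (auto simp: conjugate_in_Aut_iff simp flip: Aff_alt)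

lemma conjugate_in_Aff_iff:
  "conjugate_in (Aff n) f g \<longleftrightarrow> (\<exists>h\<in>carrier (Aff n). rat_comp (rat_comp h f) (inv\<^bsub>Bir n\<^esub> h) = g)"
  using conjugate_in_subgroup[OF group_Bir subgroup_Aff, of n f g] by (simp flip: Aff_alt)

text \<open>The conjugating map is \<open>affine_map P c\<close>. It is specialized below to changes
  of basis (\<open>c\<close> zero) and to translations (\<open>P\<close> the identity).\<close>

lemma conjugate_affine_map:
  assumes "M \<in> carrier_mat n n" "b \<in> carrier_vec n" "P \<in> carrier_mat n n" "Q \<in> carrier_mat n n"
    and "P * Q = 1\<^sub>m n" "Q * P = 1\<^sub>m n" "c \<in> carrier_vec n"
  shows "conjugate_in (Aff n) (affine_map M b) (affine_map (P * M * Q) (P *\<^sub>v b + c - P * M * Q *\<^sub>v c))"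
proof -
  have P: "P \<in> GL n" by (rule GLI) (use assms in auto)
  then have h: "affine_map P c \<in> carrier (Aff n)" using assms unfolding Aff_carrier by blast
  have "rat_comp (rat_comp (affine_map P c) (affine_map M b)) (inv\<^bsub>Bir n\<^esub> (affine_map P c)) =
    affine_map (P * M * Q) (P * M *\<^sub>v (- (Q *\<^sub>v c)) + (P *\<^sub>v b + c))"
    using assms by (simp add: affine_map_Aut(2)[OF assms(3-6)] rat_comp_affine_map[of _ n])
  also have "P * M *\<^sub>v (- (Q *\<^sub>v c)) + (P *\<^sub>v b + c) = P *\<^sub>v b + c - P * M * Q *\<^sub>v c"
  proof -
    have "P * M *\<^sub>v (- (Q *\<^sub>v c)) = - (P * M *\<^sub>v (Q *\<^sub>v c))"
      using assms by (intro mult_mat_vec_uminus[of _ n n]) simp_all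
    also have "P * M *\<^sub>v (Q *\<^sub>v c) = P * M * Q *\<^sub>v c"
      using assms by (simp add: assoc_mult_mat_vec[of _ n n _ n])
    finally show ?thesis using assms by (intro eq_vecI) auto
  qed
  finally show ?thesis using h unfolding conjugate_in_Aff_iff by blast
qed

lemma conjugate_in_subgroup_closed:
  assumes "group G" "subgroup H G" "f \<in> carrier G" "conjugate_in (G\<lparr>carrier := H\<rparr>) f g"
  shows "g \<in> carrier G"
  by (rule conjugate_in_closed[OF assms(1,3) conjugate_in_mono[OF assms(1,2,4)]])

lemma conjugate_in_subgroup_trans:
  assumes "group G" "subgroup H G" "f \<in> carrier G"
    and "conjugate_in (G\<lparr>carrier := H\<rparr>) f g" "conjugate_in (G\<lparr>carrier := H\<rparr>) g k"
  shows "conjugate_in (G\<lparr>carrier := H\<rparr>) f k"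
proof -
  interpret group G by fact
  obtain a b where a: "a \<in> H" "a \<otimes>\<^bsub>G\<^esub> f \<otimes>\<^bsub>G\<^esub> inv\<^bsub>G\<^esub> a = g"
    and b: "b \<in> H" "b \<otimes>\<^bsub>G\<^esub> g \<otimes>\<^bsub>G\<^esub> inv\<^bsub>G\<^esub> b = k"
    using assms(4,5) unfolding conjugate_in_subgroup[OF assms(1,2)] by blast
  have ab: "a \<in> carrier G" "b \<in> carrier G" using a(1) b(1) subgroup.subset[OF assms(2)] by auto
  have "(b \<otimes>\<^bsub>G\<^esub> a) \<otimes>\<^bsub>G\<^esub> f \<otimes>\<^bsub>G\<^esub> inv\<^bsub>G\<^esub> (b \<otimes>\<^bsub>G\<^esub> a) =
    b \<otimes>\<^bsub>G\<^esub> (a \<otimes>\<^bsub>G\<^esub> f \<otimes>\<^bsub>G\<^esub> inv\<^bsub>G\<^esub> a) \<otimes>\<^bsub>G\<^esub> inv\<^bsub>G\<^esub> b"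
    using assms(3) ab by (simp add: inv_mult_group m_assoc)
  then have "(b \<otimes>\<^bsub>G\<^esub> a) \<otimes>\<^bsub>G\<^esub> f \<otimes>\<^bsub>G\<^esub> inv\<^bsub>G\<^esub> (b \<otimes>\<^bsub>G\<^esub> a) = k"
    unfolding a(2) b(2) .
  moreover have "b \<otimes>\<^bsub>G\<^esub> a \<in> H" using subgroup.m_closed[OF assms(2) b(1) a(1)] .
  ultimately show ?thesis unfolding conjugate_in_subgroup[OF assms(1,2)] by blast
qed

lemma conjugate_in_subgroup_refl:
  assumes "group G" "subgroup H G" "f \<in> carrier G"
  shows "conjugate_in (G\<lparr>carrier := H\<rparr>) f f"
proof -
  interpret group G by fact
  have "\<one>\<^bsub>G\<^esub> \<otimes>\<^bsub>G\<^esub> f \<otimes>\<^bsub>G\<^esub> inv\<^bsub>G\<^esub> \<one>\<^bsub>G\<^esub> = f" using assms(3) by simp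
  then show ?thesis using subgroup.one_closed[OF assms(2)] unfolding conjugate_in_subgroup[OF assms(1,2)] by blast
qed

lemma conjugate_in_Aut_refl: "birational n f \<Longrightarrow> conjugate_in (Aut n) f f"
  using conjugate_in_subgroup_refl[OF group_Bir subgroup_Aut, of f n] by (simp flip: Aut_alt)

lemma conjugate_in_Aut_closed: "birational n f \<Longrightarrow> conjugate_in (Aut n) f g \<Longrightarrow> birational n g"
  using conjugate_in_subgroup_closed[OF group_Bir subgroup_Aut, of f n g] by (simp flip: Aut_alt)

lemma conjugate_in_Aut_trans:
  "birational n f \<Longrightarrow> conjugate_in (Aut n) f g \<Longrightarrow> conjugate_in (Aut n) g k \<Longrightarrow> conjugate_in (Aut n) f k"
  using conjugate_in_subgroup_trans[OF group_Bir subgroup_Aut, of f n g k] by (simp flip: Aut_alt)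

section \<open>Straightening triangular automorphisms\<close>

text \<open>\<open>shift_diag True \<mu>\<close> with \<open>\<mu> 0 = 1\<close> is an almost-diagonal and \<open>shift_diag False \<mu>\<close> a diagonal
  automorphism; both are treated at once.\<close>

definition shift_diag :: "bool \<Rightarrow> (nat \<Rightarrow> 'k::field) \<Rightarrow> nat \<Rightarrow> 'k mpoly" where
  "shift_diag c \<mu> i = Const (\<mu> i) * Var i + (if c \<and> i = 0 then 1 else 0)"

lemma polys_shift_diag [simp]: "i < n \<Longrightarrow> shift_diag c \<mu> i \<in> polys n"
  unfolding shift_diag_def by (intro polys_add polys_mult) auto

lemma monom_eval_scale:
  "monom_eval (\<lambda>i. Const (\<mu> i) * Var i) m = (single m (monom_eval \<mu> m) :: (nat \<Rightarrow>\<^sub>0 nat) \<Rightarrow>\<^sub>0 'k::comm_ring_1)"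
proof -
  have "monom_eval (\<lambda>i. Const (\<mu> i) * Var i) m = (\<Prod>i\<in>keys m. Const (\<mu> i ^ lookup m i)) * monom_eval (Var :: nat \<Rightarrow> (nat \<Rightarrow>\<^sub>0 nat) \<Rightarrow>\<^sub>0 'k) m"
    by (simp add: monom_eval_def power_mult_distrib prod.distrib Const.hom_power)
  also have "(\<Prod>i\<in>keys m. Const (\<mu> i ^ lookup m i)) = Const (monom_eval \<mu> m)"
    by (simp add: monom_eval_def Const.hom_prod)
  finally show ?thesis by (simp only: single_conv_monom_eval[symmetric])
qed

text \<open>The first variable is split off, being the only one that is translated.\<close>

lemma monomial_split0:
  obtains k and m' :: "nat \<Rightarrow>\<^sub>0 nat" where "m = single 0 k + m'" "lookup m' 0 = 0" "keys m' \<subseteq> keys m" "k = lookup m 0"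
proof
  let ?m' = "m - single 0 (lookup m 0)"
  show "m = single 0 (lookup m 0) + ?m'"
    by (rule poly_mapping_eqI) (simp add: lookup_add lookup_minus lookup_single when_def)
  show "lookup ?m' 0 = 0" by (simp add: lookup_minus)
  show "keys ?m' \<subseteq> keys m" by (auto simp: in_keys_iff lookup_minus)
qed simp

lemma peval_shift_diag_single:
  assumes "lookup m 0 = 0" and c: "c \<Longrightarrow> \<mu> 0 = 1"
  shows "peval Const (shift_diag c \<mu>) (single (single 0 k + m) a) =
    (if c then (Var 0 + 1) ^ k else (Const (\<mu> 0) * Var 0) ^ k) * single m (a * monom_eval \<mu> m)"
proof -
  have "monom_eval (shift_diag c \<mu>) m = monom_eval (\<lambda>i. Const (\<mu> i) * Var i) m"
  proof (rule monom_eval_cong)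
    fix i assume "i \<in> keys m"
    then have "i \<noteq> 0" using assms(1) by (intro notI) (simp add: in_keys_iff)
    then show "shift_diag c \<mu> i = Const (\<mu> i) * Var i" by (simp add: shift_diag_def)
  qed
  then have "peval Const (shift_diag c \<mu>) (single (single 0 k + m) a) =
    Const a * (shift_diag c \<mu> 0 ^ k * single m (monom_eval \<mu> m))"
    by (simp add: Const.peval_single monom_eval_add monom_eval_single monom_eval_scale)
  also have "\<dots> = shift_diag c \<mu> 0 ^ k * single m (a * monom_eval \<mu> m)"
    by (simp add: mult.left_commute[of "Const a"] mult_single)
  finally show ?thesis using c by (auto simp: shift_diag_def)
qed

lemma Var_0_power: "Var i ^ k = (single (single i k) 1 :: (nat \<Rightarrow>\<^sub>0 nat) \<Rightarrow>\<^sub>0 'a::comm_ring_1)"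
  by (induction k) (simp_all add: Var_def mult_single flip: single_add)

lemma binomial_expansion_Var:
  "(Var 0 + 1 :: (nat \<Rightarrow>\<^sub>0 nat) \<Rightarrow>\<^sub>0 'a::comm_ring_1) ^ k = (\<Sum>j\<le>k. single (single 0 j) (of_nat (k choose j)))"
  unfolding binomial_ring by (intro sum.cong refl) (simp add: Var_0_power mult_single flip: single_of_nat)

text \<open>On a monomial, \<open>\<sigma> - a\<close> either preserves or lowers by one the degree in the translated variable,
  with nonzero leading coefficient; hence it is surjective.\<close>

lemma shift_diag_minus_surj:
  fixes \<mu> :: "nat \<Rightarrow> 'k::field_char_0"
  assumes a: "a \<noteq> 0" and \<mu>: "\<mu> 0 = 1" "\<And>i. i < k \<Longrightarrow> \<mu> i \<noteq> 0" and k: "0 < k" and q: "q \<in> polys k"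
  shows "\<exists>r\<in>polys k. peval Const (shift_diag True \<mu>) r - Const a * r = q"
proof -
  let ?T = "\<lambda>r. peval Const (shift_diag True \<mu>) r - Const a * r"
  let ?I = "{q. \<exists>r\<in>polys k. ?T r = q}"
  have add: "p + q \<in> ?I" if "p \<in> ?I" "q \<in> ?I" for p q
  proof -
    from that obtain r s where "r \<in> polys k" "s \<in> polys k" "?T r = p" "?T s = q" by blast
    then have "r + s \<in> polys k" "?T (r + s) = p + q"
      by (auto simp: Const.peval_add polys_add distrib_left)
    then show ?thesis by blast
  qed
  have scale: "Const b * p \<in> ?I" if "p \<in> ?I" for b p
  proof -
    from that obtain r where "r \<in> polys k" "?T r = p" by blast
    then have "Const b * r \<in> polys k" "?T (Const b * r) = Const b * p"
      by (auto simp: Const.peval_mult Const.peval_Const polys_mult right_diff_distrib mult.left_commute)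
    then show ?thesis by blast
  qed
  have zero: "0 \<in> ?I" by (rule CollectI, rule bexI[of _ 0]) simp_all
  have sums: "sum f A \<in> ?I" if "\<And>x. x \<in> A \<Longrightarrow> f x \<in> ?I" for f :: "nat \<Rightarrow> 'k mpoly" and A
    using that
  proof (induction A rule: infinite_finite_induct)
    case (insert x F)
    then show ?case using add[of "f x" "sum f F"] by simp
  qed (use zero in simp_all)
  have T: "?T (single (single 0 d + m) 1) =
      (\<Sum>j<d. single (single 0 j + m) (of_nat (d choose j) * monom_eval \<mu> m)) + single (single 0 d + m) (monom_eval \<mu> m - a)"
    if "lookup m 0 = 0" for d m
  proof -
    have "peval Const (shift_diag True \<mu>) (single (single 0 d + m) 1) =
      (\<Sum>j\<le>d. single (single 0 j + m) (of_nat (d choose j) * monom_eval \<mu> m))"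
      using that \<mu>(1) by (simp add: peval_shift_diag_single binomial_expansion_Var sum_distrib_right mult_single)
    also have "\<dots> = (\<Sum>j<d. single (single 0 j + m) (of_nat (d choose j) * monom_eval \<mu> m)) + single (single 0 d + m) (monom_eval \<mu> m)"
      by (simp add: lessThan_Suc_atMost[symmetric])
    finally show ?thesis by (simp add: mult_single single_diff)
  qed
  have mono: "single (single 0 d + m) 1 \<in> ?I" if m: "lookup m 0 = 0" "keys m \<subseteq> {..<k}" for d m
  proof (induction d rule: less_induct)
    case (less d)
    have keys: "keys (single 0 j + m) \<subseteq> {..<k}" for j
      using keys_add[of "single 0 j" m] m(2) k by (auto split: if_splits)
    have low: "single (single 0 j + m) b \<in> ?I" if "j < d" for j b
      using scale[OF less[OF that], of b] by (simp add: mult_single)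
    have mn: "monom_eval \<mu> m \<noteq> 0"
      unfolding monom_eval_def using m(2) \<mu>(2) by auto
    show ?case
    proof (cases "monom_eval \<mu> m = a")
      case False
      let ?p = "single (single 0 d + m) 1 :: 'k mpoly"
      have "single (single 0 d + m) (monom_eval \<mu> m - a) =
        ?T ?p + Const (-1) * (\<Sum>j<d. single (single 0 j + m) (of_nat (d choose j) * monom_eval \<mu> m))"
        unfolding T[OF m(1)] by (simp add: single_uminus)
      also have "\<dots> \<in> ?I"
        by (rule add[OF _ scale[OF sums]]) (use polys_single[OF keys, of d 1] low in auto)
      finally have "Const (1 / (monom_eval \<mu> m - a)) * single (single 0 d + m) (monom_eval \<mu> m - a) \<in> ?I" by (rule scale)
      then show ?thesis using False by (simp add: mult_single)
    next
      case True
      \<comment> \<open>Resonance: the diagonal term vanishes, so the monomial one degree higher is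
        used. Its image has degree \<open>d\<close> coefficient \<open>Suc d\<close> times the
        weight, which is nonzero in characteristic 0.\<close>
      let ?p = "single (single 0 (Suc d) + m) 1 :: 'k mpoly"
      let ?c = "of_nat (Suc d) * monom_eval \<mu> m"
      have c: "?c \<noteq> 0" using mn by (simp del: of_nat_Suc)
      have "single (single 0 d + m) ?c =
        ?T ?p + Const (-1) * (\<Sum>j<d. single (single 0 j + m) (of_nat (Suc d choose j) * monom_eval \<mu> m))"
        unfolding T[OF m(1)] using True by (simp add: single_uminus)
      also have "\<dots> \<in> ?I"
        by (rule add[OF _ scale[OF sums]]) (use polys_single[OF keys, of "Suc d" 1] low in auto)
      finally have "Const (1 / ?c) * single (single 0 d + m) ?c \<in> ?I" by (rule scale)
      then show ?thesis using c by (simp add: mult_single)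
    qed
  qed
  have "q \<in> ?I"
  proof (rule mpoly_induct_keys[where K = "{m. keys m \<subseteq> {..<k}}" and P = "\<lambda>q. q \<in> ?I" and p = q])
    fix m and b :: 'k assume m: "m \<in> {m :: nat \<Rightarrow>\<^sub>0 nat. keys m \<subseteq> {..<k}}"
    obtain d m' where "m = single 0 d + m'" "lookup m' 0 = 0" "keys m' \<subseteq> keys m" by (rule monomial_split0[of m])
    with m mono[of m' d] have "single m 1 \<in> ?I" by auto
    from scale[OF this, of b] show "single m b \<in> ?I" by (simp add: mult_single)
  next
    show "keys q \<subseteq> {m. keys m \<subseteq> {..<k}}" using q by (auto simp: polys_def)
  qed (fact add, fact zero)
  then show ?thesis by blast
qed

text \<open>The triangular map \<open>x\<^sub>0 \<mapsto> x\<^sub>0 + 1, x\<^sub>i \<mapsto> \<mu>\<^sub>i x\<^sub>i + q\<^sub>i(x\<^sub>0, \<dots>, x\<^sub>i\<^sub>-\<^sub>1)\<close>.\<close>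

definition tri :: "(nat \<Rightarrow> 'k::field) \<Rightarrow> (nat \<Rightarrow> 'k mpoly) \<Rightarrow> nat \<Rightarrow> 'k mpoly" where
  "tri \<mu> q i = shift_diag True \<mu> i + (if i = 0 then 0 else q i)"

lemma peval_eq_on:
  assumes "p \<in> polys k" "\<And>i. i < k \<Longrightarrow> F i = G i"
  shows "peval Const F p = peval Const G p"
proof (rule peval_cong)
  fix m i assume "m \<in> keys p" "i \<in> keys m"
  with polysD[OF assms(1)] have "i < k" by blast
  then show "F i = G i" by (rule assms(2))
qed

lemma peval_Var_on: "p \<in> polys k \<Longrightarrow> (\<And>i. i < k \<Longrightarrow> F i = Var i) \<Longrightarrow> peval Const F p = p"
  using peval_eq_on[of p k F Var] by (simp add: peval_Var_id)

text \<open>Since \<open>r\<close> involves only variables below \<open>k\<close>, it is fixed by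
  the map, so adding and subtracting it undo each other.\<close>

lemma elementary_Aut:
  fixes r :: "'k::field mpoly"
  assumes "r \<in> polys k" "k < n"
  shows "pmap n (Var(k := Var k + r)) \<in> carrier (Aut n)"
    "inv\<^bsub>Bir n\<^esub> (pmap n (Var(k := Var k + r))) = pmap n (Var(k := Var k - r))"
proof -
  have r: "r \<in> polys n" by (rule polys_mono[of k]) (use assms in auto)
  have "peval Const (Var(k := Var k + s)) s = s" if "s \<in> polys k" for s :: "'k mpoly"
    by (rule peval_Var_on[OF that]) simp
  from this[of r] this[of "-r"] assms(1)
  have e: "peval Const (Var(k := Var k + r)) r = r" "peval Const (Var(k := Var k - r)) r = r"
    by (auto intro: peval_Var_on[of r k])
  have d: "peval Const F (Var k - r) = peval Const F (Var k) - peval Const F r" for F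
    by (metis Const.peval_add add_diff_cancel_right' diff_add_cancel)
  have *: "peval Const (Var(k := Var k + r)) ((Var(k := Var k - r)) i) = Var i"
     "peval Const (Var(k := Var k - r)) ((Var(k := Var k + r)) i) = Var i" for i
    by (auto simp: Const.peval_add d Const.peval_Var e)
  show "pmap n (Var(k := Var k + r)) \<in> carrier (Aut n)"
    "inv\<^bsub>Bir n\<^esub> (pmap n (Var(k := Var k + r))) = pmap n (Var(k := Var k - r))"
    by (rule pmap_Aut; (rule * | use r assms(2) in \<open>auto intro: polys_add polys_diff\<close>))+
qed

text \<open>Conjugation by the elementary map that adds \<open>r\<close> to coordinate
  \<open>k\<close> replaces \<open>q k\<close> by \<open>q k + \<sigma> r - \<mu> k * r\<close>, and
  \<open>r\<close> is chosen to make this zero. The terms \<open>q i\<close> with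
  \<open>i > k\<close> change by a substitution but still involve only variables below
  \<open>i\<close>.\<close>

lemma tri_step:
  fixes \<mu> :: "nat \<Rightarrow> 'k::field_char_0"
  assumes k: "0 < k" "k < n" and \<mu>: "\<mu> 0 = 1" "\<And>i. i < n \<Longrightarrow> \<mu> i \<noteq> 0"
    and q: "\<And>i. i < n \<Longrightarrow> q i \<in> polys i" and q0: "\<And>i. i < k \<Longrightarrow> q i = 0"
    and f: "birational n (pmap n (tri \<mu> q))"
  shows "\<exists>q'. (\<forall>i<n. q' i \<in> polys i) \<and> (\<forall>i<Suc k. q' i = 0) \<and>
    conjugate_in (Aut n) (pmap n (tri \<mu> q)) (pmap n (tri \<mu> q'))"
proof -
  from shift_diag_minus_surj[of "\<mu> k" \<mu> k "- q k"] obtain r where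
    r: "r \<in> polys k" "peval Const (shift_diag True \<mu>) r - Const (\<mu> k) * r = - q k"
    using k \<mu> polys_uminus[OF q[OF k(2)]] by auto
  let ?E = "Var(k := Var k + r)" and ?E' = "Var(k := Var k - r)"
  note E = elementary_Aut[OF r(1) k(2)]
  define q' where "q' i = (if i < Suc k then 0 else peval Const ?E' (q i))" for i
  have q': "q' i \<in> polys i" if "i < n" for i
  proof (cases "i < Suc k")
    case False
    then have "?E' j \<in> polys i" if "j < i" for j
      using that polys_mono[OF _ r(1), of i] by (auto intro!: polys_diff)
    with False show ?thesis unfolding q'_def using polys_peval[OF q[OF \<open>i < n\<close>], of ?E' i] by simp
  qed (simp add: q'_def)
  have tri_polys: "tri \<mu> q i \<in> polys n" if "i < n" for i
    unfolding tri_def using that polys_mono[OF _ q[OF that], of n] by (auto intro!: polys_add)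
  have E'q: "peval Const ?E' (q i) = q i" if "i \<le> k" for i
    by (rule peval_Var_on[OF q]) (use that k in auto)
  define f' where "f' i = peval Const ?E' (tri \<mu> q i)" for i
  have sd: "peval Const F (shift_diag True \<mu> i) = Const (\<mu> i) * F i + (if i = 0 then 1 else 0)" for F :: "nat \<Rightarrow> 'k mpoly" and i
    by (simp add: shift_diag_def Const.peval_add Const.peval_mult Const.peval_Const Const.peval_Var Const.peval_1)
  have f'1: "f' i = tri \<mu> q' i" if "i \<noteq> k" "i < n" for i
    using that k q0[of i] unfolding f'_def tri_def q'_def
    by (auto simp: Const.peval_add sd) (simp_all add: shift_diag_def)
  have f'2: "f' k = Const (\<mu> k) * (Var k - r) + q k"
    using k E'q[of k] unfolding f'_def tri_def by (simp add: Const.peval_add sd)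
  have "peval Const f' (?E i) = tri \<mu> q' i" if "i < n" for i
  proof (cases "i = k")
    case True
    \<comment> \<open>All coordinates occurring in \<open>r\<close> are already straightened, so
      pulling \<open>r\<close> back along the current map is the operator for which \<open>r\<close>
      was solved.\<close>
    have "peval Const f' r = peval Const (shift_diag True \<mu>) r"
    proof (rule peval_eq_on[OF r(1)])
      fix i assume "i < k"
      with k f'1[of i] show "f' i = shift_diag True \<mu> i" by (auto simp: tri_def q'_def)
    qed
    also have "\<dots> = Const (\<mu> k) * r - q k" using r(2) by (simp add: algebra_simps)
    finally have "peval Const f' (?E k) = Const (\<mu> k) * Var k"
      by (simp add: Const.peval_add Const.peval_Var f'2 algebra_simps)
    with True k show ?thesis by (simp add: tri_def q'_def shift_diag_def)
  qed (use f'1 that in \<open>simp add: Const.peval_Var\<close>)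
  moreover have "?E i \<in> polys n" if "i < n" for i
    using that polys_mono[OF _ r(1), of n] k by (auto intro: polys_add)
  ultimately have *: "rat_comp (pmap n ?E) (rat_comp (pmap n (tri \<mu> q)) (pmap n ?E')) = pmap n (tri \<mu> q')"
    by (simp add: rat_comp_pmap tri_polys f'_def[abs_def, symmetric] polys_add del: fun_upd_apply cong: pmap_cong)
  have c: "pmap n ?E \<in> carrier (Bir n)" "pmap n (tri \<mu> q) \<in> carrier (Bir n)"
    using E(1) f by (simp_all add: Aut_carrier)
  have "rat_comp (rat_comp (pmap n ?E) (pmap n (tri \<mu> q))) (inv\<^bsub>Bir n\<^esub> (pmap n ?E)) = pmap n (tri \<mu> q')"
    using monoid.m_assoc[OF group.is_monoid[OF group_Bir] c group.inv_closed[OF group_Bir c(1)]] *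
    by (simp add: E(2))
  then have "conjugate_in (Aut n) (pmap n (tri \<mu> q)) (pmap n (tri \<mu> q'))"
    using E(1) unfolding conjugate_in_Aut_iff by blast
  moreover have "\<forall>i<Suc k. q' i = 0" by (simp add: q'_def)
  ultimately show ?thesis using q' by blast
qed

lemma almost_diag_aut_pmap:
  assumes "0 < n"
  shows "almost_diag_aut (vec (n - 1) (\<lambda>i. \<mu> (Suc i))) = pmap n (shift_diag True (\<mu>(0 := 1)))"
  by (rule eq_vecI)
    (use assms in \<open>auto simp: almost_diag_aut_def shift_diag_def to_fract_Const to_fract_Var split: nat.splits\<close>)

lemma tri_conjugate:
  fixes \<mu> :: "nat \<Rightarrow> 'k::field_char_0"
  assumes n: "0 < n" and \<mu>: "\<mu> 0 = 1" "\<And>i. i < n \<Longrightarrow> \<mu> i \<noteq> 0"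
    and q: "\<And>i. i < n \<Longrightarrow> q i \<in> polys i" and f: "birational n (pmap n (tri \<mu> q))"
  shows "conjugate_in (Aut n) (pmap n (tri \<mu> q)) (almost_diag_aut (vec (n - 1) (\<lambda>i. \<mu> (Suc i))))"
proof -
  let ?f = "pmap n (tri \<mu> q)"
  have "\<exists>q'. (\<forall>i<n. q' i \<in> polys i) \<and> (\<forall>i<Suc k. q' i = 0) \<and> conjugate_in (Aut n) ?f (pmap n (tri \<mu> q'))"
    if "k < n" for k
    using that
  proof (induction k)
    case 0
    have "pmap n (tri \<mu> (q(0 := 0))) = ?f" by (rule pmap_cong) (simp add: tri_def)
    then have "conjugate_in (Aut n) ?f (pmap n (tri \<mu> (q(0 := 0))))"
      using conjugate_in_Aut_refl[OF f] by simp
    moreover have "\<forall>i<n. (q(0 := 0)) i \<in> polys i" "\<forall>i<Suc 0. (q(0 := 0)) i = 0" using q by auto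
    ultimately show ?case by blast
  next
    case (Suc k)
    then obtain q' where q': "\<forall>i<n. q' i \<in> polys i" "\<forall>i<Suc k. q' i = 0"
      "conjugate_in (Aut n) ?f (pmap n (tri \<mu> q'))" by auto
    have "birational n (pmap n (tri \<mu> q'))" by (rule conjugate_in_Aut_closed[OF f q'(3)])
    from tri_step[of "Suc k" n \<mu> q', OF _ Suc.prems \<mu> _ _ this] q'(1,2) obtain q'' where
      q'': "\<forall>i<n. q'' i \<in> polys i" "\<forall>i<Suc (Suc k). q'' i = 0"
      "conjugate_in (Aut n) (pmap n (tri \<mu> q')) (pmap n (tri \<mu> q''))" by auto
    from conjugate_in_Aut_trans[OF f q'(3) q''(3)] q''(1,2) show ?case by blast
  qed
  from this[of "n - 1"] n obtain q' where q': "\<forall>i<n. q' i = 0"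
    "conjugate_in (Aut n) ?f (pmap n (tri \<mu> q'))" by auto
  have "pmap n (tri \<mu> q') = almost_diag_aut (vec (n - 1) (\<lambda>i. \<mu> (Suc i)))"
    unfolding almost_diag_aut_pmap[OF n] by (rule pmap_cong) (use q' \<mu>(1) in \<open>simp add: tri_def fun_upd_idem\<close>)
  with q'(2) show ?thesis by simp
qed

section \<open>Jordan normal forms over algebraically closed fields\<close>

lemma exists_inverse_mat_with_col:
  fixes v :: "'a::field vec"
  assumes v: "v \<in> carrier_vec n" "v \<noteq> 0\<^sub>v n"
  shows "\<exists>P Q. P \<in> carrier_mat n n \<and> Q \<in> carrier_mat n n \<and> P * Q = 1\<^sub>m n \<and> Q * P = 1\<^sub>m n \<and> col P 0 = v \<and> 0 < n"
proof -
  obtain i0 where i0: "i0 < n" "v $ i0 \<noteq> 0"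
    using v by (metis carrier_vecD eq_vecI index_zero_vec)
  \<comment> \<open>\<open>\<sigma>\<close> sends 0 to a pivot \<open>i0\<close> where
    \<open>v\<close> is nonzero. The columns of \<open>P\<close> are \<open>v\<close> and the unit
    vectors other than the one at \<open>i0\<close>; \<open>Q\<close> eliminates with this
    pivot.\<close>
  define \<sigma> where "\<sigma> = Transposition.transpose 0 i0"
  have \<sigma>: "\<sigma> i < n" "\<sigma> i = \<sigma> j \<longleftrightarrow> i = j" "i0 = \<sigma> i \<longleftrightarrow> i = 0" if "i < n" for i j
    using that i0(1) by (auto simp: \<sigma>_def Transposition.transpose_def split: if_splits)
  define P where "P = mat n n (\<lambda>(i, j). if j = 0 then v $ i else if i = \<sigma> j then 1 else 0)"
  define Q where "Q = mat n n (\<lambda>(j, i). (if j \<noteq> 0 \<and> i = \<sigma> j then 1 else 0) +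
    (if i = i0 then if j = 0 then 1 / v $ i0 else - v $ \<sigma> j / v $ i0 else 0))"
  have c: "P \<in> carrier_mat n n" "Q \<in> carrier_mat n n" by (simp_all add: P_def Q_def)
  have QP: "Q * P = 1\<^sub>m n"
  proof (rule eq_matI)
    fix j k assume "j < dim_row (1\<^sub>m n :: 'a mat)" "k < dim_col (1\<^sub>m n :: 'a mat)"
    then have jk: "j < n" "k < n" by auto
    have "(Q * P) $$ (j, k) = (\<Sum>i<n. Q $$ (j, i) * P $$ (i, k))"
      using c jk by (simp add: scalar_prod_def atLeast0LessThan)
    also have "\<dots> = (\<Sum>i<n. if j \<noteq> 0 \<and> i = \<sigma> j then P $$ (i, k) else 0) +
      (\<Sum>i<n. if i = i0 then (if j = 0 then 1 / v $ i0 else - v $ \<sigma> j / v $ i0) * P $$ (i, k) else 0)"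
      unfolding sum.distrib[symmetric] using jk by (intro sum.cong) (auto simp: Q_def)
    also have "\<dots> = (if j \<noteq> 0 then P $$ (\<sigma> j, k) else 0) +
        (if j = 0 then 1 / v $ i0 else - v $ \<sigma> j / v $ i0) * P $$ (i0, k)"
      using \<sigma>(1)[OF jk(1)] i0 by auto
    also have "\<dots> = 1\<^sub>m n $$ (j, k)"
      using \<sigma>(1)[OF jk(1)] \<sigma>(2)[OF jk(1), of k] \<sigma>(3)[OF jk(2)] i0 jk by (auto simp: P_def)
    finally show "(Q * P) $$ (j, k) = 1\<^sub>m n $$ (j, k)" .
  qed (use c in auto)
  have "col P 0 = v" using v i0 by (intro eq_vecI) (auto simp: P_def)
  with c QP mat_mult_left_right_inverse[OF c(2,1) QP] i0 show ?thesis by auto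
qed

text \<open>Deflation: with an eigenvector as first basis vector the matrix becomes block triangular
  with a 1 by 1 corner, and the induction hypothesis treats the complementary block.\<close>

lemma similar_upper_triangular:
  fixes A :: "'a::alg_closed_field mat"
  assumes "A \<in> carrier_mat n n"
  shows "\<exists>T \<in> carrier_mat n n. upper_triangular T \<and> similar_mat A T"
  using assms
proof (induction n arbitrary: A)
  case 0
  then show ?case using similar_mat_refl[of A 0] by (intro bexI[of _ A]) (auto simp: upper_triangular_def)
next
  case (Suc n)
  from Suc.prems have A: "A \<in> carrier_mat (1 + n) (1 + n)" by simp
  have "degree (char_poly A) > 0" using degree_monic_char_poly[OF A] by simp
  then obtain k where "poly (char_poly A) k = 0" using alg_closed_imp_poly_has_root by blast
  then have "eigenvalue A k" using eigenvalue_root_char_poly[OF A] by simp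
  then obtain v where v: "v \<in> carrier_vec (1 + n)" "v \<noteq> 0\<^sub>v (1 + n)" "A *\<^sub>v v = k \<cdot>\<^sub>v v"
    using A unfolding eigenvalue_def eigenvector_def by auto
  from exists_inverse_mat_with_col[OF v(1,2)] obtain P Q where
    PQ: "P \<in> carrier_mat (1 + n) (1 + n)" "Q \<in> carrier_mat (1 + n) (1 + n)" "P * Q = 1\<^sub>m (1 + n)" "Q * P = 1\<^sub>m (1 + n)"
      "col P 0 = v" by blast
  define B where "B = Q * A * P"
  have B: "B \<in> carrier_mat (1 + n) (1 + n)" using A PQ by (auto simp: B_def)
  have AB: "similar_mat A B"
  proof (rule similar_matI)
    have "P * B * Q = (P * Q) * A * (P * Q)" unfolding B_def using A PQ(1,2)
      by (simp add: assoc_mult_mat[of _ "1+n" "1+n" _ "1+n" _ "1+n"])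
    then show "A = P * B * Q" using A PQ by simp
  qed (use A B PQ in auto)
  have colB: "B $$ (i, 0) = (if i = 0 then k else 0)" if "i < 1 + n" for i
  proof -
    have "col B 0 = Q *\<^sub>v (A *\<^sub>v v)"
    proof -
      have "B = Q * (A * P)" unfolding B_def using A PQ by (intro assoc_mult_mat) auto
      then have "col B 0 = Q *\<^sub>v col (A * P) 0" using A PQ by (simp add: col_mult2[of _ "1+n" "1+n" _ "1+n"])
      also have "col (A * P) 0 = A *\<^sub>v col P 0" by (rule col_mult2[OF A PQ(1)]) simp
      finally show ?thesis using PQ(5) by simp
    qed
    also have "\<dots> = k \<cdot>\<^sub>v (Q *\<^sub>v col P 0)" using v PQ by (simp add: mult_mat_vec)
    also have "Q *\<^sub>v col P 0 = col (1\<^sub>m (1 + n)) 0"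
      using col_mult2[OF PQ(2,1), of 0] PQ(4) by simp
    finally have "col B 0 $ i = (k \<cdot>\<^sub>v col (1\<^sub>m (1 + n)) 0) $ i" by simp
    then show ?thesis using B that by auto
  qed
  obtain A1 A2 A3 A4 where sp: "split_block B 1 1 = (A1, A2, A3, A4)" by (metis prod_cases4)
  note s = split_block[OF sp, of n n]
  have s: "A1 \<in> carrier_mat 1 1" "A2 \<in> carrier_mat 1 n" "A3 \<in> carrier_mat n 1" "A4 \<in> carrier_mat n n"
    "B = four_block_mat A1 A2 A3 A4" using s B by auto
  have A3: "A3 = 0\<^sub>m n 1"
  proof (rule eq_matI)
    fix i j assume "i < dim_row (0\<^sub>m n 1 :: 'a mat)" "j < dim_col (0\<^sub>m n 1 :: 'a mat)"
    then have ij: "i < n" "j = 0" by auto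
    have "B $$ (1 + i, 0) = A3 $$ (i, 0)" using s(1-4) ij unfolding s(5) by (subst index_mat_four_block) auto
    with colB[of "1 + i"] ij show "A3 $$ (i, j) = 0\<^sub>m n 1 $$ (i, j)" by simp
  qed (use s in auto)
  obtain T where T: "T \<in> carrier_mat n n" "upper_triangular T" "similar_mat A4 T" using Suc.IH[OF s(4)] by blast
  from similar_mat_four_block_0_ex[OF similar_mat_refl[OF s(1)] T(3) s(2) s(1) s(4)] obtain B0 where
    B0: "B0 \<in> carrier_mat 1 n" "similar_mat B (four_block_mat A1 B0 (0\<^sub>m n 1) T)"
    unfolding s(5) A3 by blast
  let ?T = "four_block_mat A1 B0 (0\<^sub>m n 1) T"
  have "?T \<in> carrier_mat (1 + n) (1 + n)" using s B0 T by auto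
  moreover have "upper_triangular ?T"
    by (rule upper_triangular_four_block[OF s(1) T(1) _ T(2)]) (use s(1) in \<open>auto simp: upper_triangular_def\<close>)
  moreover have "similar_mat A ?T" by (rule similar_mat_trans[OF AB B0(2)])
  ultimately show ?case by auto
qed

lemma jordan_nf_similar: "similar_mat A B \<Longrightarrow> jordan_nf B n_as \<Longrightarrow> jordan_nf A n_as"
  using similar_mat_trans unfolding jordan_nf_def by blast

lemma jordan_nf_exists_alg_closed:
  fixes A :: "'a::alg_closed_field mat"
  assumes "A \<in> carrier_mat n n"
  shows "\<exists>n_as. jordan_nf A n_as"
  using similar_upper_triangular[OF assms] triangular_to_jnf_vector jordan_nf_similar by blast

section \<open>Independence of the order of Jordan blocks\<close>

lemma jordan_matrix_Cons:
  "jordan_matrix ((k, a) # n_as) = four_block_mat (jordan_block k a) (0\<^sub>m k (dim_row (jordan_matrix n_as)))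
    (0\<^sub>m (dim_row (jordan_matrix n_as)) k) (jordan_matrix n_as)"
  unfolding jordan_matrix_def by (simp add: Let_def flip: jordan_matrix_def)

lemma similar_mat_four_block_swap:
  fixes A :: "'a::comm_ring_1 mat"
  assumes A: "A \<in> carrier_mat n n" and B: "B \<in> carrier_mat m m"
  shows "similar_mat (four_block_mat A (0\<^sub>m n m) (0\<^sub>m m n) B) (four_block_mat B (0\<^sub>m m n) (0\<^sub>m n m) A)"
proof -
  let ?P = "four_block_mat (0\<^sub>m n m) (1\<^sub>m n) (1\<^sub>m m) (0\<^sub>m m n) :: 'a mat"
  let ?Q = "four_block_mat (0\<^sub>m m n) (1\<^sub>m m) (1\<^sub>m n) (0\<^sub>m n m) :: 'a mat"
  let ?A = "four_block_mat A (0\<^sub>m n m) (0\<^sub>m m n) B" and ?B = "four_block_mat B (0\<^sub>m m n) (0\<^sub>m n m) A"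
  have PQ: "?P * ?Q = 1\<^sub>m (n + m)"
    by (subst mult_four_block_mat[of _ n m _ n _ m _ _ n _ m]) auto
  have QP: "?Q * ?P = 1\<^sub>m (n + m)"
    by (subst mult_four_block_mat[of _ m n _ m _ n _ _ m _ n]) (auto simp: add.commute[of n m])
  have PB: "?P * ?B = four_block_mat (0\<^sub>m n m) A B (0\<^sub>m m n)"
    using A B by (subst mult_four_block_mat[of _ n m _ n _ m _ _ m _ n]) auto
  have "?P * ?B * ?Q = ?A"
    unfolding PB using A B by (subst mult_four_block_mat[of _ n m _ n _ m _ _ n _ m]) auto
  then show ?thesis
    by (intro similar_matI[OF _ PQ QP]) (use A B in \<open>auto simp: add.commute[of n m]\<close>)
qed

lemma similar_jordan_matrix_Cons:
  assumes "similar_mat (jordan_matrix xs) (jordan_matrix ys)"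
  shows "similar_mat (jordan_matrix ((k, a :: 'a::field) # xs)) (jordan_matrix ((k, a) # ys))"
proof -
  from similar_matD[OF assms] obtain n where n: "jordan_matrix xs \<in> carrier_mat n n" "jordan_matrix ys \<in> carrier_mat n n" by blast
  have "dim_row (jordan_matrix xs) = n" "dim_row (jordan_matrix ys) = n"
    using n carrier_matD(1) by blast+
  with similar_mat_four_block_0_0[OF similar_mat_refl assms _ n(1), of "jordan_block k a" k]
  show ?thesis unfolding jordan_matrix_Cons by simp
qed

text \<open>The block \<open>x\<close> travels to the front past one block at a time; exchanging two
  leading blocks is conjugation by a block permutation matrix.\<close>

lemma similar_jordan_matrix_rotate:
  "similar_mat (jordan_matrix (ys @ x # zs)) (jordan_matrix (x # ys @ (zs :: (nat \<times> 'a::field) list)))"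
proof (induction ys)
  case Nil
  show ?case using similar_mat_refl[OF jordan_matrix_carrier] by simp
next
  case (Cons y ys)
  obtain k a where y: "y = (k, a)" by force
  obtain l b where x: "x = (l, b)" by force
  have 1: "similar_mat (jordan_matrix ((y # ys) @ x # zs)) (jordan_matrix (y # x # ys @ zs))"
    using similar_jordan_matrix_Cons[OF Cons.IH] unfolding y by simp
  let ?R = "jordan_matrix (ys @ zs)" and ?r = "dim_row (jordan_matrix (ys @ zs))"
  have R: "?R \<in> carrier_mat ?r ?r" using jordan_matrix_carrier[of "ys @ zs"] by (simp only: jordan_matrix_dim)
  have a: "jordan_matrix ((k, a) # (l, b) # ys @ zs) =
    four_block_mat (four_block_mat (jordan_block k a) (0\<^sub>m k l) (0\<^sub>m l k) (jordan_block l b)) (0\<^sub>m (k + l) ?r) (0\<^sub>m ?r (k + l)) ?R"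
    for k a l b
  proof -
    have "jordan_matrix ((k, a) # (l, b) # ys @ zs) = jordan_matrix ([(k, a), (l, b)] @ ys @ zs)" by simp
    also have "\<dots> = four_block_mat (jordan_matrix [(k, a), (l, b)]) (0\<^sub>m (k + l) ?r) (0\<^sub>m ?r (k + l)) ?R"
    proof -
      have "jordan_matrix ([(k, a), (l, b)] @ ys @ zs) = four_block_mat (jordan_matrix [(k, a), (l, b)])
        (0\<^sub>m (dim_row (jordan_matrix [(k, a), (l, b)])) (dim_col ?R))
        (0\<^sub>m ?r (dim_col (jordan_matrix [(k, a), (l, b)]))) ?R"
        unfolding jordan_matrix_def map_append[of _ "[(k, a), (l, b)]"]
          diag_block_mat_append[of "map _ [(k, a), (l, b)]"] Let_def ..
      moreover have "dim_col ?R = ?r" by simp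
      moreover have "dim_row (jordan_matrix [(k, a), (l, b)]) = k + l" "dim_col (jordan_matrix [(k, a), (l, b)]) = k + l"
        by simp_all
      ultimately show ?thesis by (simp only:)
    qed
    also have "jordan_matrix [(k, a), (l, b)] = four_block_mat (jordan_block k a) (0\<^sub>m k l) (0\<^sub>m l k) (jordan_block l b)"
      unfolding jordan_matrix_def by (simp add: Let_def del: diag_block_mat.simps add: diag_block_mat.simps(2)[of _ "[_]"])
    finally show ?thesis .
  qed
  have "similar_mat (jordan_matrix (y # x # ys @ zs)) (jordan_matrix (x # y # ys @ zs))"
    unfolding x y a add.commute[of l k]
    by (rule similar_mat_four_block_0_0[OF similar_mat_four_block_swap similar_mat_refl[OF R] _ R]) auto
  from similar_mat_trans[OF 1 this] show ?case by simp
qed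

lemma similar_jordan_matrix_mset:
  "mset xs = mset ys \<Longrightarrow> similar_mat (jordan_matrix xs) (jordan_matrix (ys :: (nat \<times> 'a::field) list))"
proof (induction xs arbitrary: ys)
  case Nil
  then show ?case using similar_mat_refl[OF jordan_matrix_carrier] by simp
next
  case (Cons x xs)
  then have "x \<in> set ys" by (metis list.set_intros(1) set_mset_mset)
  then obtain us vs where ys: "ys = us @ x # vs" by (meson split_list)
  obtain k a where x: "x = (k, a)" by force
  from Cons.prems ys have "mset xs = mset (us @ vs)" by simp
  from similar_jordan_matrix_Cons[OF Cons.IH[OF this], of k a]
  have "similar_mat (jordan_matrix (x # xs)) (jordan_matrix (x # us @ vs))" by (simp add: x)
  from similar_mat_trans[OF this similar_mat_sym[OF similar_jordan_matrix_rotate]] show ?case unfolding ys .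
qed

lemma jordan_nf_mset_similar:
  assumes "jordan_nf A xs" "jordan_nf B ys" "mset xs = mset (ys :: (nat \<times> 'a::field) list)"
  shows "similar_mat A B"
  using assms similar_jordan_matrix_mset[OF assms(3)] similar_mat_trans similar_mat_sym
  unfolding jordan_nf_def by metis

text \<open>The shape of a transposed Jordan matrix, without its block sizes. Coordinate
  \<open>i\<close> depends on \<open>i\<close> and \<open>i - 1\<close> only, which suits the
  convention of \<open>tri\<close>; a nonzero coupling joins equal diagonal entries.\<close>

definition lower_bidiagonal :: "nat \<Rightarrow> 'a::{zero,one} mat \<Rightarrow> bool" where
  "lower_bidiagonal n L \<longleftrightarrow> L \<in> carrier_mat n n \<and>
     (\<forall>i<n. \<forall>j<n. j \<noteq> i \<longrightarrow> Suc j \<noteq> i \<longrightarrow> L $$ (i, j) = 0) \<and>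
     (\<forall>j. Suc j < n \<longrightarrow> L $$ (Suc j, j) = 0 \<or> L $$ (Suc j, j) = 1 \<and> L $$ (Suc j, Suc j) = L $$ (j, j))"

lemma jordan_matrix_shape:
  fixes n_as :: "(nat \<times> 'a::semiring_1) list"
  defines "n \<equiv> sum_list (map fst n_as)"
  shows "(\<forall>i<n. \<forall>j<n. j \<noteq> i \<longrightarrow> j \<noteq> Suc i \<longrightarrow> jordan_matrix n_as $$ (i, j) = 0) \<and>
    (\<forall>j. Suc j < n \<longrightarrow> jordan_matrix n_as $$ (j, Suc j) = 0 \<or> jordan_matrix n_as $$ (j, Suc j) = 1 \<and>
      jordan_matrix n_as $$ (Suc j, Suc j) = jordan_matrix n_as $$ (j, j))"
  unfolding n_def
proof (induction n_as)
  case (Cons x n_as)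
  obtain k a where x: "x = (k, a)" by force
  let ?m = "sum_list (map fst n_as)"
  have idx: "jordan_matrix ((k, a) # n_as) $$ (i, j) = (if i < k then if j < k then jordan_block k a $$ (i, j) else 0
      else if j < k then 0 else jordan_matrix n_as $$ (i - k, j - k))" if "i < k + ?m" "j < k + ?m" for i j
    using that unfolding jordan_matrix_Cons by (subst index_mat_four_block) auto
  show ?case
  proof (intro conjI allI impI)
    fix i j assume *: "i < sum_list (map fst (x # n_as))" "j < sum_list (map fst (x # n_as))" "j \<noteq> i" "j \<noteq> Suc i"
    then show "jordan_matrix (x # n_as) $$ (i, j) = 0"
      using Cons.IH by (auto simp: idx x)
  next
    fix j assume *: "Suc j < sum_list (map fst (x # n_as))"
    consider "Suc j < k" | "Suc j = k" | "j \<ge> k" by linarith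
    then show "jordan_matrix (x # n_as) $$ (j, Suc j) = 0 \<or> jordan_matrix (x # n_as) $$ (j, Suc j) = 1 \<and>
      jordan_matrix (x # n_as) $$ (Suc j, Suc j) = jordan_matrix (x # n_as) $$ (j, j)"
    proof cases
      case 3
      then have "Suc (j - k) < ?m" "Suc j - k = Suc (j - k)" using * by (auto simp: x)
      with 3 Cons.IH * show ?thesis by (simp add: idx x)
    qed (use * in \<open>simp_all add: idx x\<close>)
  qed
qed simp

text \<open>Jordan matrices carry their ones above the diagonal, so the normal form of the transpose
  is taken and transposed back.\<close>

lemma exists_lower_bidiagonal:
  fixes M :: "'a::alg_closed_field mat"
  assumes M: "M \<in> carrier_mat n n"
  shows "\<exists>L P Q. lower_bidiagonal n L \<and> similar_mat_wit L M P Q"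
proof -
  from jordan_nf_exists_alg_closed[of "transpose_mat M" n] M obtain n_as where "jordan_nf (transpose_mat M) n_as" by auto
  then have "similar_mat (transpose_mat M) (jordan_matrix n_as)" by (simp add: jordan_nf_def)
  then obtain P Q where w: "similar_mat_wit (transpose_mat M) (jordan_matrix n_as) P Q" unfolding similar_mat_def by blast
  let ?J = "jordan_matrix n_as"
  note w = similar_mat_witD2[OF transpose_carrier_mat[THEN iffD2, OF M] w]
  have n: "sum_list (map fst n_as) = n" using w(5) jordan_matrix_dim(1)[of n_as] by auto
  have "M = transpose_mat (P * ?J * Q)" using w(3) by (metis transpose_transpose)
  also have "\<dots> = transpose_mat Q * (transpose_mat ?J * transpose_mat P)"
    using w(5-7) by (simp add: transpose_mult[of _ n n _ n])
  finally have M': "M = transpose_mat Q * transpose_mat ?J * transpose_mat P"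
    using w(5-7) by (simp add: assoc_mult_mat[of _ n n _ n _ n])
  have "transpose_mat Q * transpose_mat P = 1\<^sub>m n" "transpose_mat P * transpose_mat Q = 1\<^sub>m n"
    using w by (simp_all flip: transpose_mult[of _ n n _ n])
  then have "similar_mat_wit M (transpose_mat ?J) (transpose_mat Q) (transpose_mat P)"
    by (intro similar_mat_witI[OF _ _ M']) (use w M in auto)
  then have "similar_mat_wit (transpose_mat ?J) M (transpose_mat P) (transpose_mat Q)" by (rule similar_mat_wit_sym)
  moreover have "lower_bidiagonal n (transpose_mat ?J)"
  proof -
    have J: "transpose_mat ?J $$ (i, j) = ?J $$ (j, i)" if "i < n" "j < n" for i j
      using w(5) that by auto
    show ?thesis
      using jordan_matrix_shape[of n_as] w(5) unfolding lower_bidiagonal_def n by (auto simp: J Suc_lessD)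
  qed
  ultimately show ?thesis by blast
qed

section \<open>Triangular forms of affine automorphisms\<close>

lemma lower_bidiagonalD:
  assumes "lower_bidiagonal n L"
  shows "L \<in> carrier_mat n n"
    and "i < n \<Longrightarrow> j < n \<Longrightarrow> j \<noteq> i \<Longrightarrow> Suc j \<noteq> i \<Longrightarrow> L $$ (i, j) = 0"
    and "Suc j < n \<Longrightarrow> L $$ (Suc j, j) = 0 \<or> L $$ (Suc j, j) = 1 \<and> L $$ (Suc j, Suc j) = L $$ (j, j)"
  using assms unfolding lower_bidiagonal_def by blast+

lemma GL_det: "M \<in> GL n \<Longrightarrow> det (M :: 'a::field mat) \<noteq> 0"
  by (metis GL_carrier GL_inverse det_mult det_one mult_zero_left zero_neq_one)

lemma mult_mat_zero_vec: "A \<in> carrier_mat nr nc \<Longrightarrow> A *\<^sub>v 0\<^sub>v nc = (0\<^sub>v nr :: 'a::comm_ring_1 vec)"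
  by (intro eq_vecI) (auto simp: scalar_prod_def)

text \<open>A change of basis suffices. Fixed points are carried back, so a map without one stays
  without one, and a linear map stays linear.\<close>

lemma affine_conjugate_bidiagonal:
  fixes M :: "'k::alg_closed_field mat"
  assumes M: "M \<in> GL n" and b: "b \<in> carrier_vec n"
  shows "\<exists>L c. lower_bidiagonal n L \<and> c \<in> carrier_vec n \<and> (\<forall>i<n. L $$ (i, i) \<noteq> 0) \<and>
    conjugate_in (Aff n) (affine_map M b) (affine_map L c) \<and>
    (fixes_point L c \<longrightarrow> fixes_point M b) \<and> (b = 0\<^sub>v n \<longrightarrow> c = 0\<^sub>v n)"
proof -
  note Mc = GL_carrier[OF M]
  obtain L P Q where L: "lower_bidiagonal n L" "similar_mat_wit L M P Q"
    using exists_lower_bidiagonal[OF Mc] by blast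
  note Lc = lower_bidiagonalD(1)[OF L(1)]
  note w = similar_mat_witD2[OF Lc L(2)]
  have "P *\<^sub>v b + 0\<^sub>v n - L *\<^sub>v 0\<^sub>v n = P *\<^sub>v b"
    using w(6) b by (intro eq_vecI) (auto simp: mult_mat_zero_vec[OF Lc])
  then have c: "conjugate_in (Aff n) (affine_map M b) (affine_map L (P *\<^sub>v b))"
    using conjugate_affine_map[OF Mc b w(6,7,1,2) zero_carrier_vec] by (simp only: w(3)[symmetric])
  have "fixes_point M b" if "fixes_point L (P *\<^sub>v b)"
  proof -
    from that obtain y where y: "y \<in> carrier_vec n" "L *\<^sub>v y + P *\<^sub>v b = y"
      using Lc by (auto simp: fixes_point_def)
    have MQ: "M = Q * L * P" using similar_mat_witD2[OF Mc similar_mat_wit_sym[OF L(2)]] by blast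
    have "M *\<^sub>v (Q *\<^sub>v y) = Q *\<^sub>v (L *\<^sub>v y)"
    proof -
      have "Q * L * P * Q = Q * L * (P * Q)" using w(6,7) Lc by (intro assoc_mult_mat) auto
      also have "\<dots> = Q * L" using w(1,7) Lc by simp
      finally have *: "M * Q = Q * L" by (simp only: MQ[symmetric])
      have "M *\<^sub>v (Q *\<^sub>v y) = M * Q *\<^sub>v y" by (rule assoc_mult_mat_vec[OF Mc w(7) y(1), symmetric])
      also have "\<dots> = Q *\<^sub>v (L *\<^sub>v y)" unfolding * by (rule assoc_mult_mat_vec[OF w(7) Lc y(1)])
      finally show ?thesis .
    qed
    moreover have "b = Q *\<^sub>v (P *\<^sub>v b)"
      using assoc_mult_mat_vec[OF w(7,6) b] w(2) b by simp
    ultimately have "M *\<^sub>v (Q *\<^sub>v y) + b = Q *\<^sub>v (L *\<^sub>v y) + Q *\<^sub>v (P *\<^sub>v b)" by simp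
    also have "\<dots> = Q *\<^sub>v (L *\<^sub>v y + P *\<^sub>v b)"
      by (rule mult_add_distrib_mat_vec[OF w(7), symmetric]) (use w(6) Lc y(1) b in auto)
    finally have "M *\<^sub>v (Q *\<^sub>v y) + b = Q *\<^sub>v y" unfolding y(2) .
    then show ?thesis unfolding fixes_point_def using Mc w y by (intro bexI[of _ "Q *\<^sub>v y"]) auto
  qed
  moreover have "L $$ (i, i) \<noteq> 0" if "i < n" for i
  proof -
    have "det L \<noteq> 0" using det_similar[of L M] L(2) GL_det[OF M] by (metis similar_mat_def)
    moreover have "det L = prod_list (diag_mat L)"
      by (rule det_lower_triangular[OF _ Lc]) (use lower_bidiagonalD(2)[OF L(1)] in auto)
    ultimately have "0 \<notin> set (diag_mat L)" by (simp add: prod_list_zero_iff)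
    then show ?thesis using that Lc by (auto simp: diag_mat_def)
  qed
  moreover have "b = 0\<^sub>v n \<longrightarrow> P *\<^sub>v b = 0\<^sub>v n" using mult_mat_zero_vec[OF w(6)] by simp
  ultimately show ?thesis using L(1) w b c by (intro exI[of _ L] exI[of _ "P *\<^sub>v b"]) auto
qed

text \<open>The translation by the negative of a fixed point moves that point to the origin.\<close>

lemma conjugate_to_linear:
  assumes "M \<in> GL n" "b \<in> carrier_vec n" "fixes_point M b"
  shows "conjugate_in (Aff n) (affine_map M b) (affine_map M (0\<^sub>v n))"
proof -
  note M = GL_carrier[OF assms(1)]
  obtain x where x: "x \<in> carrier_vec n" "M *\<^sub>v x + b = x"
    using assms(3) M by (auto simp: fixes_point_def)
  have "1\<^sub>m n *\<^sub>v b + (- x) - 1\<^sub>m n * M * 1\<^sub>m n *\<^sub>v (- x) = b - (M *\<^sub>v x + b) + M *\<^sub>v x"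
    using M assms(2) x by (simp add: mult_mat_vec_uminus[of _ n n]) (intro eq_vecI, auto)
  also have "\<dots> = 0\<^sub>v n" using M assms(2) x(1) by (intro eq_vecI) auto
  finally show ?thesis
    using conjugate_affine_map[OF M assms(2) one_carrier_mat one_carrier_mat _ _, of "- x"] M x by simp
qed

lemma conjugate_scaled_permutation:
  fixes M :: "'k::field mat"
  assumes M: "M \<in> carrier_mat n n" and b: "b \<in> carrier_vec n"
    and \<sigma>: "\<sigma> permutes {..<n}" and d: "\<And>i. i < n \<Longrightarrow> d i \<noteq> 0"
  shows "conjugate_in (Aff n) (affine_map M b)
    (affine_map (mat n n (\<lambda>(i, j). d i * M $$ (\<sigma> i, \<sigma> j) / d j)) (vec n (\<lambda>i. d i * b $ \<sigma> i)))"
proof -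
  define P where "P = mat n n (\<lambda>(i, j). if j = \<sigma> i then d i else 0)"
  define Q where "Q = mat n n (\<lambda>(i, j). if i = \<sigma> j then 1 / d j else 0)"
  have c: "P \<in> carrier_mat n n" "Q \<in> carrier_mat n n" by (simp_all add: P_def Q_def)
  have \<sigma>n: "\<sigma> i < n" if "i < n" for i using permutes_in_image[OF \<sigma>, of i] that by simp
  have \<sigma>inj: "\<sigma> i = \<sigma> j \<longleftrightarrow> i = j" for i j using permutes_inj[OF \<sigma>] by (auto dest: injD)
  have PA: "(P * A) $$ (i, k) = d i * A $$ (\<sigma> i, k)" if "A \<in> carrier_mat n n" "i < n" "k < n" for A i k
  proof -
    have "(P * A) $$ (i, k) = (\<Sum>j<n. P $$ (i, j) * A $$ (j, k))"
      using that c by (simp add: scalar_prod_def atLeast0LessThan)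
    also have "\<dots> = (\<Sum>j<n. if j = \<sigma> i then d i * A $$ (j, k) else 0)"
      using that by (intro sum.cong) (auto simp: P_def)
    also have "\<dots> = d i * A $$ (\<sigma> i, k)" using \<sigma>n that by simp
    finally show ?thesis .
  qed
  have AQ: "(A * Q) $$ (i, k) = A $$ (i, \<sigma> k) / d k" if "A \<in> carrier_mat n n" "i < n" "k < n" for A i k
  proof -
    have "(A * Q) $$ (i, k) = (\<Sum>j<n. A $$ (i, j) * Q $$ (j, k))"
      using that c by (simp add: scalar_prod_def atLeast0LessThan)
    also have "\<dots> = (\<Sum>j<n. if j = \<sigma> k then A $$ (i, j) / d k else 0)"
      using that by (intro sum.cong) (auto simp: Q_def)
    also have "\<dots> = A $$ (i, \<sigma> k) / d k" using \<sigma>n that by simp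
    finally show ?thesis .
  qed
  have PQ: "P * Q = 1\<^sub>m n"
    by (rule eq_matI) (use c \<sigma>n \<sigma>inj d in \<open>auto simp del: index_mult_mat(1) simp: PA Q_def\<close>)
  have QP: "Q * P = 1\<^sub>m n" by (rule mat_mult_left_right_inverse[OF c PQ])
  have "P * M \<in> carrier_mat n n" using c M by simp
  then have PMQ: "P * M * Q = mat n n (\<lambda>(i, j). d i * M $$ (\<sigma> i, \<sigma> j) / d j)"
    by (intro eq_matI) (use c M \<sigma>n in \<open>auto simp del: index_mult_mat(1) simp: PA AQ\<close>)
  have Pb: "(P *\<^sub>v b) $ i = d i * b $ \<sigma> i" if "i < n" for i
  proof -
    have "(P *\<^sub>v b) $ i = (\<Sum>j<n. P $$ (i, j) * b $ j)"
      using that c b by (simp add: scalar_prod_def atLeast0LessThan)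
    also have "\<dots> = (\<Sum>j<n. if j = \<sigma> i then d i * b $ j else 0)"
      using that by (intro sum.cong) (auto simp: P_def)
    also have "\<dots> = d i * b $ \<sigma> i" using \<sigma>n that by simp
    finally show ?thesis .
  qed
  have "P *\<^sub>v b + 0\<^sub>v n - P * M * Q *\<^sub>v 0\<^sub>v n = vec n (\<lambda>i. d i * b $ \<sigma> i)"
    by (intro eq_vecI) (use c b in \<open>auto simp del: index_mult_mat_vec simp: Pb\<close>, simp add: PMQ)
  with conjugate_affine_map[OF M b c PQ QP zero_carrier_vec] PMQ show ?thesis by simp
qed

text \<open>The fixed point equation is solved coordinate by coordinate. A row with diagonal entry
  different from 1 determines its own unknown. A row with diagonal entry 1 constrains only the
  preceding unknown, and fails to be solvable exactly when it is uncoupled and has a nonzero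
  constant.\<close>

lemma bidiagonal_fixed_point:
  fixes L :: "'k::field mat"
  assumes L: "lower_bidiagonal n L" and c: "c \<in> carrier_vec n" and nofix: "\<not> fixes_point L c"
  shows "\<exists>i<n. L $$ (i, i) = 1 \<and> c $ i \<noteq> 0 \<and> (\<forall>j<n. j \<noteq> i \<longrightarrow> L $$ (i, j) = 0)"
proof (rule ccontr)
  assume neg: "\<not> ?thesis"
  note Lc = lower_bidiagonalD(1)[OF L]
  define \<epsilon> where "\<epsilon> i = (if i = 0 then 0 else L $$ (i, i - 1))" for i
  have \<epsilon>: "\<epsilon> (Suc i) = 0 \<or> \<epsilon> (Suc i) = 1 \<and> L $$ (Suc i, Suc i) = L $$ (i, i)" if "Suc i < n" for i
    using lower_bidiagonalD(3)[OF L that] by (simp add: \<epsilon>_def)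
  \<comment> \<open>If the diagonal entry at \<open>i\<close> is 1, then \<open>y i\<close> cancels
    from row \<open>i\<close> and is spent on satisfying row \<open>i + 1\<close>. A coupled row
    with diagonal entry 1 follows another such row, so its unknown was chosen for it. At the last
    index the out-of-range entry of \<open>c\<close> is an arbitrary value that no row constrains.
    The dummy argument only makes the recursion function-valued.\<close>
  define x where "x = rec_nat (\<lambda>_. if L $$ (0, 0) = 1 then - c $ 1 else - c $ 0 / (L $$ (0, 0) - 1))
    (\<lambda>i r _. if L $$ (Suc i, Suc i) = 1 then - c $ (Suc (Suc i))
      else - (c $ Suc i + \<epsilon> (Suc i) * r ()) / (L $$ (Suc i, Suc i) - 1))"
  define y where "y i = x i ()" for i
  have y0: "y 0 = (if L $$ (0, 0) = 1 then - c $ 1 else - c $ 0 / (L $$ (0, 0) - 1))"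
    and yS: "y (Suc i) = (if L $$ (Suc i, Suc i) = 1 then - c $ (Suc (Suc i))
      else - (c $ Suc i + \<epsilon> (Suc i) * y i) / (L $$ (Suc i, Suc i) - 1))" for i
    by (simp_all add: y_def x_def)
  have row: "(L *\<^sub>v vec n y) $ i = L $$ (i, i) * y i + \<epsilon> i * (if i = 0 then 0 else y (i - 1))" if i: "i < n" for i
  proof -
    have "(L *\<^sub>v vec n y) $ i = (\<Sum>j<n. L $$ (i, j) * y j)"
      using i Lc by (simp add: scalar_prod_def atLeast0LessThan)
    also have "\<dots> = (\<Sum>j<n. (if j = i then L $$ (i, i) * y i else 0) + (if i \<noteq> 0 \<and> j = i - 1 then \<epsilon> i * y j else 0))"
      by (rule sum.cong) (use lower_bidiagonalD(2)[OF L i] in \<open>auto simp: \<epsilon>_def\<close>)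
    also have "\<dots> = L $$ (i, i) * y i + \<epsilon> i * (if i = 0 then 0 else y (i - 1))"
      unfolding sum.distrib using i by auto
    finally show ?thesis .
  qed
  have "L *\<^sub>v vec n y + c = vec n y"
  proof (rule eq_vecI)
    fix i assume "i < dim_vec (vec n y)"
    then have i: "i < n" by simp
    have "L $$ (i, i) * y i + \<epsilon> i * (if i = 0 then 0 else y (i - 1)) + c $ i = y i"
    proof (cases "L $$ (i, i) = 1")
      case True
      have "\<epsilon> i * (if i = 0 then 0 else y (i - 1)) + c $ i = 0"
      proof (cases "\<epsilon> i = 0")
        case e0: True
        have "L $$ (i, j) = 0" if "j < n" "j \<noteq> i" for j
          using lower_bidiagonalD(2)[OF L i that] e0 that by (cases i) (auto simp: \<epsilon>_def)
        with neg True i have "c $ i = 0" by blast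
        with e0 show ?thesis by simp
      next
        case False
        then obtain k where k: "i = Suc k" by (cases i) (auto simp: \<epsilon>_def)
        with \<epsilon>[of k] False i True have "\<epsilon> i = 1" "L $$ (k, k) = 1" by auto
        then show ?thesis using k y0 yS[of "k - 1"] by (cases k) auto
      qed
      with True show ?thesis by simp
    next
      case False
      then have *: "L $$ (i, i) - 1 \<noteq> 0" by simp
      have "y i * (L $$ (i, i) - 1) = - (c $ i + \<epsilon> i * (if i = 0 then 0 else y (i - 1)))"
        using False by (cases i) (simp_all add: y0 yS \<epsilon>_def)
      then show ?thesis by (simp add: algebra_simps)
    qed
    then show "(L *\<^sub>v vec n y + c) $ i = vec n y $ i" using i Lc c by (simp add: row del: index_mult_mat_vec)
  qed (use Lc c in auto)
  moreover have "vec n y \<in> carrier_vec (dim_row L)" using Lc by auto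
  ultimately show False using nofix unfolding fixes_point_def by blast
qed

section \<open>Moving distinguished coordinates to the front\<close>

lemma move_to_front_permutes:
  fixes i n :: nat
  assumes "i < n"
  shows "(\<lambda>j. if j = 0 then i else if j \<le> i then j - 1 else j) permutes {..<n}"
proof -
  let ?s = "\<lambda>j::nat. if j = 0 then i else if j \<le> i then j - 1 else j"
  have "bij_betw ?s {..<n} {..<n}"
    by (rule bij_betw_byWitness[where f' = "\<lambda>j. if j = i then 0 else if j < i then Suc j else j"])
      (use assms in auto)
  moreover have "?s x = x" if "x \<notin> {..<n}" for x
  proof -
    have "i < x" using that assms by simp
    then show ?thesis by auto
  qed
  ultimately show ?thesis by (rule bij_imp_permutes)
qed

lemma move_two_to_front_permutes:
  assumes "Suc i < n"
  shows "(\<lambda>j. if j = 0 then i else if j = 1 then Suc i else if j \<le> Suc i then j - 2 else j) permutes {..<n}"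
proof -
  let ?s = "\<lambda>j::nat. if j = 0 then i else if j = 1 then Suc i else if j \<le> Suc i then j - 2 else j"
  have "bij_betw ?s {..<n} {..<n}"
    by (rule bij_betw_byWitness[where f' = "\<lambda>j. if j = i then 0 else if j = Suc i then 1 else if j < i then j + 2 else j"])
      (use assms in auto)
  moreover have "?s x = x" if "x \<notin> {..<n}" for x
  proof -
    have "Suc i < x" using that assms by simp
    then show ?thesis by auto
  qed
  ultimately show ?thesis by (rule bij_imp_permutes)
qed

lemma affine_poly_lower_triangular:
  assumes "i < n" "\<And>j. j < n \<Longrightarrow> i < j \<Longrightarrow> M $$ (i, j) = 0"
  shows "affine_poly n M b i = Const (M $$ (i, i)) * Var i + ((\<Sum>j<i. Const (M $$ (i, j)) * Var j) + Const (b $ i))"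
proof -
  have "(\<Sum>j<n. Const (M $$ (i, j)) * Var j) = (\<Sum>j<Suc i. Const (M $$ (i, j)) * Var j :: 'a mpoly)"
    by (rule sum.mono_neutral_right) (use assms in auto)
  then show ?thesis by (simp add: affine_poly_def)
qed

lemma conjugate_in_Aff_closed:
  assumes "(M, b) \<in> affine_data n" "conjugate_in (Aff n) (affine_map M b) g"
  shows "birational n g"
  by (rule conjugate_in_Aut_closed[OF affine_data_Aut(2)[OF assms(1)] conjugate_in_Aff_Aut[OF assms(2)]])

theorem affine_no_fixed_point:
  fixes M :: "'k::{alg_closed_field, field_char_0} mat"
  assumes M: "(M, b) \<in> affine_data n" and nofix: "\<not> fixes_point M b"
  shows "\<exists>\<nu>\<in>torus (n - 1). conjugate_in (Aut n) (affine_map M b) (almost_diag_aut \<nu>)"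
proof -
  have Mb: "M \<in> GL n" "b \<in> carrier_vec n" using M by (auto simp: affine_data_def)
  obtain L c where L: "lower_bidiagonal n L" "c \<in> carrier_vec n" "\<forall>i<n. L $$ (i, i) \<noteq> 0"
    "conjugate_in (Aff n) (affine_map M b) (affine_map L c)" "fixes_point L c \<longrightarrow> fixes_point M b"
    using affine_conjugate_bidiagonal[OF Mb] by blast
  note Lc = lower_bidiagonalD(1)[OF L(1)]
  from bidiagonal_fixed_point[OF L(1,2)] L(5) nofix obtain i where
    i: "i < n" "L $$ (i, i) = 1" "c $ i \<noteq> 0" "\<And>j. j < n \<Longrightarrow> j \<noteq> i \<Longrightarrow> L $$ (i, j) = 0" by blast
  \<comment> \<open>Row \<open>i\<close> is uncoupled, so its coordinate can be moved to the front
    while the others keep their order and the matrix stays lower triangular. Rescaling that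
    coordinate by the inverse of \<open>c $ i\<close> makes the translation equal to 1.\<close>
  define \<sigma> where "\<sigma> j = (if j = 0 then i else if j \<le> i then j - 1 else j)" for j
  have \<sigma>: "\<sigma> permutes {..<n}" unfolding \<sigma>_def[abs_def] by (rule move_to_front_permutes[OF i(1)])
  define d where "d j = (if j = 0 then 1 / c $ i else 1)" for j :: nat
  define N where "N = mat n n (\<lambda>(i, j). d i * L $$ (\<sigma> i, \<sigma> j) / d j)"
  define e where "e = vec n (\<lambda>i. d i * c $ \<sigma> i)"
  have conj: "conjugate_in (Aff n) (affine_map L c) (affine_map N e)"
    unfolding N_def e_def by (rule conjugate_scaled_permutation[OF Lc L(2) \<sigma>]) (use i in \<open>auto simp: d_def\<close>)
  have N: "N $$ (0, j) = (if j = 0 then 1 else 0)" if "j < n" for j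
    using that i \<sigma>_def permutes_in_image[OF \<sigma>, of j] by (auto simp: N_def d_def)
  have N0: "N $$ (j, k) = 0" if "j < n" "k < n" "j < k" for j k
  proof (cases "j = 0")
    case False
    then have "\<sigma> k \<noteq> \<sigma> j" "Suc (\<sigma> k) \<noteq> \<sigma> j" "\<sigma> j < n" "\<sigma> k < n" using that i(1) by (auto simp: \<sigma>_def)
    then show ?thesis using lower_bidiagonalD(2)[OF L(1), of "\<sigma> j" "\<sigma> k"] that by (simp add: N_def)
  qed (use N[OF that(2)] that in simp)
  have e0: "e $ 0 = 1" using i by (simp add: e_def d_def \<sigma>_def)
  define \<mu> where "\<mu> j = (if j < n then N $$ (j, j) else 1)" for j
  have \<mu>0: "\<mu> 0 = 1" using N[of 0] i by (simp add: \<mu>_def)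
  have \<mu>n: "\<mu> j \<noteq> 0" if "j < n" for j
    using that L(3) permutes_in_image[OF \<sigma>, of j] i by (auto simp: \<mu>_def N_def d_def)
  define q where "q j = (\<Sum>k<j. Const (N $$ (j, k)) * Var k) + Const (e $ j)" for j
  have q: "q j \<in> polys j" for j unfolding q_def by (intro polys_add polys_sum polys_mult) auto
  have Nc: "N \<in> carrier_mat n n" by (simp add: N_def)
  have tri: "affine_map N e = pmap n (tri \<mu> q)"
    unfolding affine_map_pmap[OF Nc]
  proof (rule pmap_cong)
    fix j assume j: "j < n"
    have "affine_poly n N e j = Const (\<mu> j) * Var j + q j"
      unfolding q_def \<mu>_def using affine_poly_lower_triangular[OF j N0[OF j]] j by simp
    then show "affine_poly n N e j = tri \<mu> q j"
      using \<mu>0 e0 by (auto simp: tri_def shift_diag_def q_def)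
  qed
  have 1: "conjugate_in (Aff n) (affine_map M b) (affine_map N e)"
    using conjugate_in_subgroup_trans[OF group_Bir subgroup_Aff, of "affine_map M b" n] affine_data_Aut(2)[OF M] L(4) conj
    by (simp flip: Aff_alt)
  have f: "birational n (pmap n (tri \<mu> q))" using conjugate_in_Aff_closed[OF M 1] unfolding tri .
  have "conjugate_in (Aut n) (affine_map M b) (almost_diag_aut (vec (n - 1) (\<lambda>i. \<mu> (Suc i))))"
    by (rule conjugate_in_Aut_trans[OF affine_data_Aut(2)[OF M] conjugate_in_Aff_Aut[OF 1]], unfold tri,
        rule tri_conjugate[OF _ \<mu>0 \<mu>n q f]) (use i in auto)
  moreover have "vec (n - 1) (\<lambda>i. \<mu> (Suc i)) \<in> torus (n - 1)" using \<mu>n by (auto simp: torus_def)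
  ultimately show ?thesis by blast
qed

text \<open>On the quotient \<open>x\<^sub>0 = a y\<^sub>1 / y\<^sub>0\<close> of the coordinates of a Jordan block of size at least two, the
  map acts as a translation.\<close>

lemma jordan_block_conjugate:
  fixes N :: "'k::field_char_0 mat"
  assumes n: "1 < n" and N: "N \<in> carrier_mat n n" and f: "birational n (affine_map N (0\<^sub>v n))"
    and N0: "\<And>j k. j < n \<Longrightarrow> k < n \<Longrightarrow> j < k \<Longrightarrow> N $$ (j, k) = 0"
    and Nd: "\<And>j. j < n \<Longrightarrow> N $$ (j, j) \<noteq> 0" and N1: "N $$ (1, 1) = N $$ (0, 0)" "N $$ (1, 0) = 1"
  shows "\<exists>\<nu>\<in>torus (n - 1). conjugate_in (Bir n) (affine_map N (0\<^sub>v n)) (almost_diag_aut \<nu>)"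
proof -
  define a where "a = N $$ (0, 0)"
  have a: "a \<noteq> 0" using Nd[of 0] n by (simp add: a_def)
  \<comment> \<open>\<open>G\<close> is the inverse of \<open>h\<close>: the old coordinates are
    \<open>y\<^sub>0 = x\<^sub>1\<close> and \<open>y\<^sub>1 = x\<^sub>0 x\<^sub>1 / a\<close>.
    Unlike \<open>h\<close> it is polynomial.\<close>
  define G :: "nat \<Rightarrow> 'k mpoly" where
    "G j = (if j = 0 then Var 1 else if j = 1 then Const (1 / a) * Var 0 * Var 1 else Var j)" for j
  define h where "h = vec n (\<lambda>j. if j = 0 then scalar a * coord 1 / coord 0 else if j = 1 then coord 0 else coord j)"
  have G: "G j \<in> polys n" if "j < n" for j using that n by (auto simp: G_def intro!: polys_mult)
  have h: "h \<in> ratmaps n"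
    by (rule ratmapsI) (use n in \<open>auto simp: h_def intro!: ratfuns_mult ratfuns_divide\<close>)
  have pc: "rat_subst (pmap n F) (coord j) = to_fract (F j)" "coord j \<in> reg (pmap n F)" if "j < n" for j and F :: "nat \<Rightarrow> 'k mpoly"
    using that by simp_all
  have hreg: "h $ j \<in> reg (pmap n F)" "rat_subst (pmap n F) (h $ j) =
    (if j = 0 then scalar a * to_fract (F 1) / to_fract (F 0) else if j = 1 then to_fract (F 0) else to_fract (F j))"
    if "j < n" "F 0 \<noteq> 0" for j and F :: "nat \<Rightarrow> 'k mpoly"
    using that n pc[of _ F] by (auto simp: h_def reg_divide reg_add_mult)
  have hsub: "to_fract (G j) \<in> reg h \<and> rat_subst h (to_fract (G j)) = coord j" if "j < n" for j
  proof -
    consider "j = 0" | "j = 1" | "1 < j" by linarith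
    then show ?thesis
    proof cases
      case 2
      have "scalar (1 / a) * (scalar a * coord 1 / coord 0) * coord 0 = (coord 1 :: 'k ratfun)"
        using a by (simp add: scalar_divide)
      moreover have "coord 0 \<in> reg h" "coord 1 \<in> reg h" "rat_subst h (coord 0) = scalar a * coord 1 / coord 0"
        "rat_subst h (coord 1) = coord 0"
        using n by (simp_all add: h_def)
      ultimately show ?thesis using 2 by (simp add: G_def to_fract_Const to_fract_Var reg_add_mult)
    qed (use that n in \<open>auto simp: G_def to_fract_Var h_def\<close>)
  qed
  have V0: "Var j \<noteq> (0 :: 'k mpoly)" for j using to_fract_Var[of j, where 'a = 'k] coord_nonzero[of j, where 'a = 'k] by (metis to_fract_0)
  have hG: "h $ j \<in> reg (pmap n G) \<and> rat_subst (pmap n G) (h $ j) = coord j" if "j < n" for j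
    using hreg[OF that, of G] V0 a by (auto simp: G_def to_fract_Const to_fract_Var scalar_divide)
  have hG': "pmap n G $ j \<in> reg h \<and> rat_subst h (pmap n G $ j) = coord j" if "j < n" for j
    using hsub[OF that] that by simp
  note bir = birationalI(1,3)[OF h pmap_ratmaps[OF G], OF _ hG' hG]
  define F where "F j = peval Const G (affine_poly n N (0\<^sub>v n) j)" for j
  have FG: "rat_comp (affine_map N (0\<^sub>v n)) (pmap n G) = pmap n F"
    unfolding affine_map_pmap[OF N] F_def by (rule rat_comp_pmap) simp
  define \<mu> where "\<mu> j = (if j = 0 then 1 else if j < n then N $$ (j, j) else 1)" for j
  \<comment> \<open>The new coordinate 1 is the old coordinate 0, which is only scaled; hence
    \<open>q 1 = 0\<close>. For \<open>j > 1\<close> both of the first two new variables are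
    available, so the product in \<open>G 1\<close> is allowed in \<open>q j\<close>.\<close>
  define q where "q j = (if j = 1 then 0 else \<Sum>k<j. Const (N $$ (j, k)) * G k)" for j
  have G': "G k \<in> polys j" if "k < j" "1 < j" for j k
    using that by (auto simp: G_def intro!: polys_mult)
  have q: "q j \<in> polys j" if "j < n" for j
    unfolding q_def by (auto intro!: polys_sum polys_mult G')
  have Fj: "F j = Const (N $$ (j, j)) * G j + (\<Sum>k<j. Const (N $$ (j, k)) * G k)" if "j < n" for j
  proof -
    have "F j = peval Const G (Const (N $$ (j, j)) * Var j + ((\<Sum>k<j. Const (N $$ (j, k)) * Var k) + Const (0\<^sub>v n $ j)))"
      unfolding F_def by (rule arg_cong[where f = "peval Const G"], rule affine_poly_lower_triangular[OF that N0[OF that]])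
    then show ?thesis using that
      by (simp add: Const.peval_add Const.peval_mult Const.peval_Const Const.peval_Var peval_sum)
  qed
  have F0: "F 0 = Const a * Var 1" and F1: "F 1 = Var 0 * Var 1 + Var 1"
    using Fj[of 0] Fj[of 1] n N1 a
    by (simp_all add: a_def[symmetric] G_def mult.assoc[symmetric] mult_single)
  have F0n: "F 0 \<noteq> 0"
    using F0 a V0 by (metis mult_eq_0_iff scalar_eq_0_iff to_fract_Const to_fract_eq_0_iff)
  have comp: "rat_comp h (pmap n F) = pmap n (tri \<mu> q)"
  proof (rule eq_vecI)
    fix j assume "j < dim_vec (pmap n (tri \<mu> q))"
    then have j: "j < n" by simp
    consider "j = 0" | "j = 1" | "1 < j" by linarith
    then have "rat_subst (pmap n F) (h $ j) = to_fract (tri \<mu> q j)"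
    proof cases
      case 1
      have "scalar a * (coord 0 * coord 1 + coord 1) / (scalar a * coord 1) = coord 0 + (1 :: 'k ratfun)"
        using a by (simp add: field_simps)
      with 1 show ?thesis using hreg(2)[of j F, OF j F0n]
        by (simp add: a F0 F1[unfolded One_nat_def] tri_def shift_diag_def \<mu>_def to_fract_Const to_fract_Var)
    next
      case 2
      then show ?thesis using hreg(2)[of j F, OF j F0n] j N1
        by (simp add: F0 tri_def shift_diag_def \<mu>_def q_def a_def)
    next
      case 3
      then show ?thesis using hreg(2)[of j F, OF j F0n] j Fj[OF j]
        by (simp add: tri_def shift_diag_def \<mu>_def q_def G_def[of j])
    qed
    then show "rat_comp h (pmap n F) $ j = pmap n (tri \<mu> q) $ j" using j by (simp add: h_def)
  qed (simp add: h_def)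
  have c: "h \<in> carrier (Bir n)" "affine_map N (0\<^sub>v n) \<in> carrier (Bir n)" using bir f by simp_all
  have "rat_comp (rat_comp h (affine_map N (0\<^sub>v n))) (inv\<^bsub>Bir n\<^esub> h) = pmap n (tri \<mu> q)"
    using monoid.m_assoc[OF group.is_monoid[OF group_Bir] c group.inv_closed[OF group_Bir c(1)]] FG comp
    by (simp add: bir(2))
  then have 1: "conjugate_in (Bir n) (affine_map N (0\<^sub>v n)) (pmap n (tri \<mu> q))"
    unfolding conjugate_in_def using c(1) by auto
  have "birational n (pmap n (tri \<mu> q))" using conjugate_in_closed[OF group_Bir c(2) 1] by simp
  then have "conjugate_in (Aut n) (pmap n (tri \<mu> q)) (almost_diag_aut (vec (n - 1) (\<lambda>i. \<mu> (Suc i))))"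
    by (intro tri_conjugate q) (use n Nd in \<open>auto simp: \<mu>_def\<close>)
  from conjugate_in_trans[OF group_Bir c(2) 1 conjugate_in_Aut_Bir[OF this]]
  have "conjugate_in (Bir n) (affine_map N (0\<^sub>v n)) (almost_diag_aut (vec (n - 1) (\<lambda>i. \<mu> (Suc i))))" .
  moreover have "vec (n - 1) (\<lambda>i. \<mu> (Suc i)) \<in> torus (n - 1)" using Nd by (auto simp: torus_def \<mu>_def)
  ultimately show ?thesis by blast
qed

lemma pmap_shift_diag_False: "diag_aut (vec n \<mu>) = pmap n (shift_diag False \<mu>)"
  by (rule eq_vecI) (simp_all add: diag_aut_def shift_diag_def to_fract_Const to_fract_Var)

theorem affine_conjugate_diag_or_almost_diag:
  fixes M :: "'k::{alg_closed_field, field_char_0} mat"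
  assumes n: "0 < n" and M: "(M, b) \<in> affine_data n"
  shows "(\<exists>\<mu>\<in>torus n. conjugate_in (Bir n) (affine_map M b) (diag_aut \<mu>)) \<or>
    (\<exists>\<nu>\<in>torus (n - 1). conjugate_in (Bir n) (affine_map M b) (almost_diag_aut \<nu>))"
proof (cases "fixes_point M b")
  case False
  from affine_no_fixed_point[OF M this] show ?thesis using conjugate_in_Aut_Bir by blast
next
  case True
  note f = affine_data_Aut(2)[OF M]
  have Mb: "M \<in> GL n" "b \<in> carrier_vec n" using M by (auto simp: affine_data_def)
  have M0: "(M, 0\<^sub>v n) \<in> affine_data n" using Mb by (simp add: affine_data_def)
  have Afft: "conjugate_in (Aff n) f g \<Longrightarrow> conjugate_in (Aff n) g k \<Longrightarrow> birational n f \<Longrightarrow> conjugate_in (Aff n) f k"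
    for f g k :: "'k ratfun vec"
    using conjugate_in_subgroup_trans[OF group_Bir subgroup_Aff, of f n g k] by (simp flip: Aff_alt)
  have Bt: "conjugate_in (Aff n) f g \<Longrightarrow> conjugate_in (Bir n) g k \<Longrightarrow> birational n f \<Longrightarrow> conjugate_in (Bir n) f k"
    for f g k :: "'k ratfun vec"
    using conjugate_in_trans[OF group_Bir, of f n g k, OF _ conjugate_in_Aut_Bir[OF conjugate_in_Aff_Aut]] by simp
  obtain L c where L: "lower_bidiagonal n L" "\<forall>i<n. L $$ (i, i) \<noteq> 0"
    "conjugate_in (Aff n) (affine_map M (0\<^sub>v n)) (affine_map L (0\<^sub>v n))"
    using affine_conjugate_bidiagonal[OF Mb(1) zero_carrier_vec] by metis
  from Afft[OF conjugate_to_linear[OF Mb True] L(3) f]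
  have 1: "conjugate_in (Aff n) (affine_map M b) (affine_map L (0\<^sub>v n))" .
  note Lc = lower_bidiagonalD(1)[OF L(1)]
  show ?thesis
  proof (cases "\<exists>i. Suc i < n \<and> L $$ (Suc i, i) \<noteq> 0")
    case False
    have off: "L $$ (i, j) = 0" if "i < n" "j < n" "j \<noteq> i" for i j
      using lower_bidiagonalD(2)[OF L(1) that] False that by (cases "Suc j = i") auto
    have "affine_poly n L (0\<^sub>v n) i = shift_diag False (\<lambda>i. L $$ (i, i)) i" if "i < n" for i
    proof -
      have "(\<Sum>j<n. Const (L $$ (i, j)) * Var j) = (\<Sum>j<n. if j = i then Const (L $$ (i, i)) * Var i else (0 :: 'k mpoly))"
        by (rule sum.cong) (use off that in auto)
      then show ?thesis using that by (simp add: affine_poly_def shift_diag_def)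
    qed
    then have "affine_map L (0\<^sub>v n) = diag_aut (vec n (\<lambda>i. L $$ (i, i)))"
      unfolding affine_map_pmap[OF Lc] pmap_shift_diag_False by (rule pmap_cong)
    moreover have "vec n (\<lambda>i. L $$ (i, i)) \<in> torus n" using L(2) by (auto simp: torus_def)
    ultimately show ?thesis using 1 conjugate_in_Aff_Aut conjugate_in_Aut_Bir by metis
  next
    case True
    \<comment> \<open>The first coupling is chosen so that the coordinates before \<open>i\<close>
      are uncoupled from each other and from \<open>i\<close>. Moving the pair \<open>i\<close>,
      \<open>Suc i\<close> in front of them then creates no entry above the diagonal.\<close>
    define i where "i = (LEAST i. Suc i < n \<and> L $$ (Suc i, i) \<noteq> 0)"
    have i: "Suc i < n" "L $$ (Suc i, i) \<noteq> 0" using LeastI_ex[OF True] by (auto simp: i_def)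
    have least: "L $$ (Suc j, j) = 0" if "j < i" for j
      using not_less_Least[of j "\<lambda>i. Suc i < n \<and> L $$ (Suc i, i) \<noteq> 0"] that i(1) by (auto simp: i_def)
    have i1: "L $$ (Suc i, i) = 1" "L $$ (Suc i, Suc i) = L $$ (i, i)"
      using lower_bidiagonalD(3)[OF L(1) i(1)] i(2) by auto
    define \<sigma> where "\<sigma> j = (if j = 0 then i else if j = 1 then Suc i else if j \<le> Suc i then j - 2 else j)" for j :: nat
    have \<sigma>: "\<sigma> permutes {..<n}" unfolding \<sigma>_def[abs_def] by (rule move_two_to_front_permutes[OF i(1)])
    define N where "N = mat n n (\<lambda>(j, k). L $$ (\<sigma> j, \<sigma> k))"
    have Nc: "N \<in> carrier_mat n n" by (simp add: N_def)
    have "vec n (\<lambda>i. 1 * 0\<^sub>v n $ \<sigma> i) = (0\<^sub>v n :: 'k vec)"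
      using permutes_in_image[OF \<sigma>] by (intro eq_vecI) auto
    then have 2: "conjugate_in (Aff n) (affine_map L (0\<^sub>v n)) (affine_map N (0\<^sub>v n))"
      using conjugate_scaled_permutation[OF Lc zero_carrier_vec \<sigma>, of "\<lambda>_. 1"] by (simp add: N_def)
    note 3 = Afft[OF 1 2 f]
    have \<sigma>n: "\<sigma> j < n" if "j < n" for j using permutes_in_image[OF \<sigma>, of j] that by simp
    have N0: "N $$ (j, k) = 0" if "j < n" "k < n" "j < k" for j k
    proof (cases "Suc (\<sigma> k) = \<sigma> j")
      case True
      with that have "\<sigma> k < i" "\<sigma> j = Suc (\<sigma> k)" by (auto simp: \<sigma>_def split: if_splits)
      then show ?thesis using least[of "\<sigma> k"] that by (simp add: N_def)
    next
      case False
      moreover have "\<sigma> k \<noteq> \<sigma> j" using that permutes_inj[OF \<sigma>] by (auto dest: injD)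
      ultimately show ?thesis using lower_bidiagonalD(2)[OF L(1) \<sigma>n[OF that(1)] \<sigma>n[OF that(2)]] that by (simp add: N_def)
    qed
    have "\<exists>\<nu>\<in>torus (n - 1). conjugate_in (Bir n) (affine_map N (0\<^sub>v n)) (almost_diag_aut \<nu>)"
    proof (rule jordan_block_conjugate[OF _ Nc conjugate_in_Aff_closed[OF M 3] N0])
      show "1 < n" using i by simp
      show "N $$ (j, j) \<noteq> 0" if "j < n" for j using L(2) \<sigma>n[OF that] that by (simp add: N_def)
      show "N $$ (1, 1) = N $$ (0, 0)" "N $$ (1, 0) = 1" using i i1 by (simp_all add: N_def \<sigma>_def)
    qed
    with Bt[OF 3 _ f] show ?thesis by blast
  qed
qed

section \<open>Semi-invariants of diagonal and almost-diagonal automorphisms\<close>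

lemma peval_shift_diag_False: "lookup (peval Const (shift_diag False \<mu>) p) m = monom_eval \<mu> m * lookup p m"
proof (induction p rule: mpoly_induct_keys[where K = UNIV])
  case (single m' a)
  have "monom_eval (shift_diag False \<mu>) m' = single m' (monom_eval \<mu> m')"
    unfolding monom_eval_scale[symmetric] by (rule monom_eval_cong) (simp add: shift_diag_def)
  then have "peval Const (shift_diag False \<mu>) (single m' a) = single m' (a * monom_eval \<mu> m')"
    by (simp add: Const.peval_single mult_single)
  then show ?case by (simp add: lookup_single when_def)
qed (simp_all add: Const.peval_add lookup_add distrib_left)

lemma split0_eq_iff:
  fixes m m' :: "nat \<Rightarrow>\<^sub>0 nat"
  assumes "lookup m 0 = 0" "lookup m' 0 = 0"
  shows "single 0 k + m = single 0 j + m' \<longleftrightarrow> k = j \<and> m = m'"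
proof
  assume eq: "single 0 k + m = single 0 j + m'"
  have "lookup (single 0 k + m) 0 = lookup (single 0 j + m') 0" by (simp only: eq)
  then have "k = j" using assms by (simp add: lookup_add)
  with eq show "k = j \<and> m = m'" by simp
qed simp

text \<open>The binomial theorem for the coefficients of \<open>f(x\<^sub>0 + 1)\<close>, with the
  exponents \<open>m\<close> of the other variables held fixed. \<open>D\<close> is any bound for
  the relevant degrees and truncates the sum.\<close>

lemma peval_shift_diag_True:
  fixes \<mu> :: "nat \<Rightarrow> 'k::field"
  assumes m: "lookup m 0 = 0" and \<mu>: "\<mu> 0 = 1" and D: "\<And>d. single 0 d + m \<in> keys p \<Longrightarrow> d \<le> D"
  shows "lookup (peval Const (shift_diag True \<mu>) p) (single 0 k + m) =
    (\<Sum>d\<le>D. of_nat (d choose k) * lookup p (single 0 d + m)) * monom_eval \<mu> m"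
proof -
  define g where "g M = lookup (peval Const (shift_diag True \<mu>) (single M (lookup p M))) (single 0 k + m)" for M
  have g: "g (single 0 d + m') = (if m' = m then of_nat (d choose k) * lookup p (single 0 d + m) * monom_eval \<mu> m else 0)"
    if "lookup m' 0 = 0" for d m'
  proof -
    let ?a = "lookup p (single 0 d + m')"
    have "peval Const (shift_diag True \<mu>) (single (single 0 d + m') ?a) =
      (\<Sum>j\<le>d. single (single 0 j + m') (of_nat (d choose j) * (?a * monom_eval \<mu> m')))"
      using that \<mu> by (simp add: peval_shift_diag_single binomial_expansion_Var sum_distrib_right mult_single)
    then have "g (single 0 d + m') = (\<Sum>j\<le>d. if j = k \<and> m' = m then of_nat (d choose j) * (?a * monom_eval \<mu> m') else 0)"
      unfolding g_def using that m by (simp add: lookup_sum lookup_single when_def split0_eq_iff)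
    also have "\<dots> = (if m' = m then of_nat (d choose k) * (?a * monom_eval \<mu> m') else 0)"
      by (cases "m' = m"; cases "k \<le> d") (simp_all add: binomial_eq_0)
    finally show ?thesis by (simp add: mult.assoc)
  qed
  let ?\<iota> = "\<lambda>d. single 0 d + m"
  have inj: "inj_on ?\<iota> A" for A by (rule inj_onI) (use split0_eq_iff[OF m m] in blast)
  have "p = (\<Sum>M\<in>keys p. single M (lookup p M))" by (simp add: mpoly_sum_singles)
  then have "peval Const (shift_diag True \<mu>) p = (\<Sum>M\<in>keys p. peval Const (shift_diag True \<mu>) (single M (lookup p M)))"
    by (metis (no_types, lifting) peval_sum sum.cong)
  then have "lookup (peval Const (shift_diag True \<mu>) p) (single 0 k + m) = sum g (keys p)"
    by (simp add: lookup_sum g_def)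
  also have "\<dots> = sum g (?\<iota> ` {..D} \<inter> keys p)"
  proof (rule sum.mono_neutral_right)
    show "\<forall>M\<in>keys p - ?\<iota> ` {..D} \<inter> keys p. g M = 0"
    proof
      fix M assume M: "M \<in> keys p - ?\<iota> ` {..D} \<inter> keys p"
      obtain d m' where dm: "M = single 0 d + m'" "lookup m' 0 = 0" by (rule monomial_split0[of M])
      with M D[of d] have "m' \<noteq> m" by auto
      with g[OF dm(2)] dm(1) show "g M = 0" by simp
    qed
  qed auto
  also have "\<dots> = sum g (?\<iota> ` {..D})"
  proof (rule sum.mono_neutral_left)
    show "\<forall>M\<in>?\<iota> ` {..D} - ?\<iota> ` {..D} \<inter> keys p. g M = 0"
    proof
      fix M assume "M \<in> ?\<iota> ` {..D} - ?\<iota> ` {..D} \<inter> keys p"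
      then obtain d where "M = single 0 d + m" "lookup p M = 0" by (auto simp: in_keys_iff)
      with g[OF m, of d] show "g M = 0" by simp
    qed
  qed auto
  also have "\<dots> = (\<Sum>d\<le>D. g (single 0 d + m))" by (rule sum.reindex_cong[OF inj]) auto
  finally show ?thesis by (simp add: g[OF m] sum_distrib_right)
qed

lemma monom_eval_split0: "\<mu> 0 = 1 \<Longrightarrow> monom_eval \<mu> (single 0 k + m) = monom_eval \<mu> m"
  by (simp add: monom_eval_add monom_eval_single)

lemma lookup_Const_mult: "lookup (Const l * p) m = l * lookup p (m :: nat \<Rightarrow>\<^sub>0 nat)" for l :: "'k::comm_ring_1"
proof (induction p rule: mpoly_induct_keys[where K = UNIV])
  case (single m' a)
  show ?case by (simp add: mult_single lookup_single when_def)
qed (simp_all add: lookup_add distrib_left)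

text \<open>The degree in the translated variable of an eigenvector is zero: the coefficients of
  \<open>f(x + 1) = f(x)\<close> in the two highest degrees already force \<open>f\<close> to be constant.\<close>

lemma shift_diag_eigenvector:
  fixes \<mu> :: "nat \<Rightarrow> 'k::field_char_0"
  assumes eig: "peval Const (shift_diag c \<mu>) p = Const l * p" and c: "c \<Longrightarrow> \<mu> 0 = 1"
    and \<mu>: "\<And>i. i < n \<Longrightarrow> \<mu> i \<noteq> 0" and p: "p \<in> polys n" and M: "M \<in> keys p"
  shows "monom_eval \<mu> M = l" "c \<Longrightarrow> lookup M 0 = 0"
proof -
  have "monom_eval \<mu> M = l \<and> (c \<longrightarrow> lookup M 0 = 0)"
  proof (cases c)
    case False
    with M arg_cong[OF eig, of "\<lambda>p. lookup p M"] show ?thesis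
      by (simp add: peval_shift_diag_False lookup_Const_mult in_keys_iff)
  next
    case True
    obtain k m where km: "M = single 0 k + m" "lookup m 0 = 0" "keys m \<subseteq> keys M" by (rule monomial_split0[of M])
    define S where "S = {d. single 0 d + m \<in> keys p}"
    have "S \<subseteq> (\<lambda>M. lookup M 0) ` keys p"
      using km(2) by (auto simp: S_def lookup_add intro!: image_eqI)
    then have S: "finite S" "k \<in> S" using M km(1) finite_surj[OF finite_keys] by (auto simp: S_def)
    define D where "D = Max S"
    have "S \<noteq> {}" using S(2) by blast
    then have D: "D \<in> S" "\<And>d. d \<in> S \<Longrightarrow> d \<le> D" using S Max_in[of S] by (auto simp: D_def simp del: Max_in)
    define f where "f d = lookup p (single 0 d + m)" for d
    have fD: "f D \<noteq> 0" using D(1) by (simp add: f_def S_def in_keys_iff)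
    have form: "(\<Sum>d\<le>D. of_nat (d choose j) * f d) * monom_eval \<mu> m = l * f j" for j
      using peval_shift_diag_True[OF km(2), of \<mu> p D j] c[OF True] D(2) True
        arg_cong[OF eig, of "\<lambda>p. lookup p (single 0 j + m)"]
      by (simp add: S_def f_def lookup_Const_mult)
    have top: "(\<Sum>d\<le>E. of_nat (d choose E) * f d) = f E" for E
      unfolding lessThan_Suc_atMost[symmetric] sum.lessThan_Suc
      by (subst sum.neutral) (simp_all add: binomial_eq_0)
    from form[of D] fD have l: "monom_eval \<mu> m = l" by (simp add: top)
    have "monom_eval \<mu> m \<noteq> 0"
      unfolding monom_eval_def using km(3) polysD[OF p M] \<mu> by auto
    with l have l0: "l \<noteq> 0" by simp
    have "D = 0"
    proof (cases D)
      case (Suc E)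
      with form[of E] have "(f E + of_nat (Suc E) * f (Suc E)) * monom_eval \<mu> m = l * f E"
        by (simp add: top binomial_Suc_n del: of_nat_Suc)
      then have "of_nat (Suc E) * f (Suc E) = 0" using l l0 by (simp add: algebra_simps del: of_nat_Suc)
      with fD Suc show ?thesis by (simp del: of_nat_Suc)
    qed
    then have "k = 0" using D(2)[OF S(2)] by simp
    then show ?thesis using km l by simp
  qed
  then show "monom_eval \<mu> M = l" "c \<Longrightarrow> lookup M 0 = 0" by simp_all
qed

text \<open>A translation creates monomials of lower degree in the first variable, so the support
  alone is no measure for a descent. Its downward closure in the first exponent is finite and
  contains the support of the translate.\<close>

definition lower_closure :: "(nat \<Rightarrow>\<^sub>0 nat, 'k::zero) poly_mapping \<Rightarrow> (nat \<Rightarrow>\<^sub>0 nat) set" where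
  "lower_closure q = {M. \<exists>j. single 0 j + M \<in> keys q}"

lemma finite_lower_closure: "finite (lower_closure q)"
proof (rule finite_subset)
  show "lower_closure q \<subseteq> (\<Union>M\<in>keys q. (\<lambda>j. M - single 0 j) ` {..lookup M 0})"
  proof
    fix M assume "M \<in> lower_closure q"
    then obtain j where j: "single 0 j + M \<in> keys q" by (auto simp: lower_closure_def)
    have "M = (single 0 j + M) - single 0 j" by simp
    moreover have "j \<le> lookup (single 0 j + M) 0" by (simp add: lookup_add)
    ultimately show "M \<in> (\<Union>M\<in>keys q. (\<lambda>j. M - single 0 j) ` {..lookup M 0})" using j by blast
  qed
qed auto

lemma keys_lower_closure: "keys q \<subseteq> lower_closure q"
  unfolding lower_closure_def by (auto intro: exI[of _ 0])

lemma lower_closure_lower: "single 0 j + M \<in> lower_closure q \<Longrightarrow> M \<in> lower_closure q"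
proof -
  assume "single 0 j + M \<in> lower_closure q"
  then obtain j' where "single 0 j' + (single 0 j + M) \<in> keys q" unfolding lower_closure_def by blast
  then have "single 0 (j' + j) + M \<in> keys q" by (simp add: single_add add.assoc)
  then show ?thesis unfolding lower_closure_def by blast
qed

lemma keys_shift_diag_True:
  fixes \<mu> :: "nat \<Rightarrow> 'k::field"
  assumes "\<mu> 0 = 1"
  shows "keys (peval Const (shift_diag True \<mu>) q) \<subseteq> lower_closure q"
proof
  fix M assume M: "M \<in> keys (peval Const (shift_diag True \<mu>) q)"
  obtain k m where km: "M = single 0 k + m" "lookup m 0 = 0" by (rule monomial_split0[of M])
  define D where "D = Max ((\<lambda>M. lookup M 0) ` keys q)"
  have "d \<le> D" if "single 0 d + m \<in> keys q" for d
    unfolding D_def using that km(2) by (intro Max_ge) (auto simp: lookup_add intro!: image_eqI[of _ _ "single 0 d + m"])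
  from peval_shift_diag_True[where D = D and p = q and k = k and m = m and \<mu> = \<mu>, OF km(2) assms this] M
  have "(\<Sum>d\<le>D. of_nat (d choose k) * lookup q (single 0 d + m)) \<noteq> 0"
    by (auto simp: in_keys_iff km(1))
  then obtain d where d: "of_nat (d choose k) * lookup q (single 0 d + m) \<noteq> 0"
    by (meson sum.not_neutral_contains_not_neutral)
  then have "k \<le> d" by (metis binomial_eq_0 mult_zero_left not_le of_nat_0)
  then have "single 0 d + m = single 0 (d - k) + M" by (simp add: km(1) add.assoc[symmetric] flip: single_add)
  with d show "M \<in> lower_closure q" unfolding lower_closure_def by (auto simp: in_keys_iff)
qed

text \<open>Stands in for triangularization of an operator on a finite-dimensional space. The
  measure is the support, or its downward closure if there is a translation; a suitable
  \<open>\<sigma> - l\<close> strictly decreases it until \<open>q\<close> is an eigenvector. The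
  eigenvalues met are weights of monomials.\<close>

lemma shift_diag_exists_eigenvector:
  fixes \<mu> :: "nat \<Rightarrow> 'k::field"
  assumes c: "c \<Longrightarrow> \<mu> 0 = 1"
    and V: "\<And>q l. q \<in> V \<Longrightarrow> peval Const (shift_diag c \<mu>) q - Const l * q \<in> V"
    and q: "q \<in> V" "q \<noteq> 0"
  shows "\<exists>q\<in>V. q \<noteq> 0 \<and> (\<exists>l. peval Const (shift_diag c \<mu>) q = Const l * q)"
proof -
  define R :: "'k mpoly \<Rightarrow> (nat \<Rightarrow>\<^sub>0 nat) set" where "R q = (if c then lower_closure q else keys q)" for q
  have fin: "finite (R q)" for q by (simp add: R_def finite_lower_closure)
  have dec: "\<exists>l. R (peval Const (shift_diag c \<mu>) q - Const l * q) \<subset> R q" if q0: "q \<noteq> 0" for q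
  proof -
    have ne: "keys q \<noteq> {}" using q0 by simp
    have "Max ((\<lambda>M. lookup M 0) ` keys q) \<in> (\<lambda>M. lookup M 0) ` keys q"
      by (rule Max_in) (use ne in auto)
    then obtain M where M: "M \<in> keys q" "Max ((\<lambda>M. lookup M 0) ` keys q) = lookup M 0" by blast
    have M2: "lookup M' 0 \<le> lookup M 0" if "M' \<in> keys q" for M'
      unfolding M(2)[symmetric] by (rule Max_ge) (use that in auto)
    \<comment> \<open>\<open>M\<close> has maximal degree in the first variable, so only
      \<open>M\<close> itself contributes to its coefficient in \<open>\<sigma> q\<close>.
      Subtracting its weight times \<open>q\<close> therefore removes \<open>M\<close>, and no
      higher multiple by the first variable remains that could bring \<open>M\<close> into the
      closure.\<close>
    let ?q = "peval Const (shift_diag c \<mu>) q - Const (monom_eval \<mu> M) * q"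
    have "R ?q \<subset> R q"
    proof (cases c)
      case False
      have "lookup ?q m = (monom_eval \<mu> m - monom_eval \<mu> M) * lookup q m" for m
        using False by (simp add: lookup_minus peval_shift_diag_False lookup_Const_mult left_diff_distrib)
      then have "keys ?q \<subseteq> keys q - {M}" by (auto simp: in_keys_iff)
      with M(1) False show ?thesis by (auto simp: R_def)
    next
      case True
      have kq: "keys ?q \<subseteq> lower_closure q"
      proof
        fix m assume "m \<in> keys ?q"
        then have "m \<in> keys (peval Const (shift_diag c \<mu>) q) \<or> m \<in> keys q"
          by (auto simp: in_keys_iff lookup_minus lookup_Const_mult)
        with keys_shift_diag_True[of \<mu> q] c[OF True] keys_lower_closure[of q] True show "m \<in> lower_closure q" by auto
      qed
      have sub: "lower_closure ?q \<subseteq> lower_closure q"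
      proof
        fix m assume "m \<in> lower_closure ?q"
        then obtain j where "single 0 j + m \<in> keys ?q" by (auto simp: lower_closure_def)
        with kq have "single 0 j + m \<in> lower_closure q" by blast
        then show "m \<in> lower_closure q" by (rule lower_closure_lower)
      qed
      have "M \<notin> lower_closure ?q"
      proof
        assume "M \<in> lower_closure ?q"
        then obtain j where j: "single 0 j + M \<in> keys ?q" by (auto simp: lower_closure_def)
        with kq obtain j' where "single 0 j' + (single 0 j + M) \<in> keys q" unfolding lower_closure_def by blast
        from M2[OF this] have "j = 0" by (simp add: lookup_add)
        with j have Mk: "M \<in> keys ?q" by simp
        obtain k m where km: "M = single 0 k + m" "lookup m 0 = 0" "k = lookup M 0" by (rule monomial_split0[of M])
        have bound: "d \<le> k" if "single 0 d + m \<in> keys q" for d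
          using M2[OF that] km(2,3) by (simp add: lookup_add)
        from peval_shift_diag_True[where D = k and p = q and k = k and m = m and \<mu> = \<mu>, OF km(2) c[OF True] bound]
        have "lookup (peval Const (shift_diag True \<mu>) q) M =
          (\<Sum>d\<le>k. of_nat (d choose k) * lookup q (single 0 d + m)) * monom_eval \<mu> m" by (simp add: km(1))
        also have "(\<Sum>d\<le>k. of_nat (d choose k) * lookup q (single 0 d + m)) = lookup q M"
          unfolding lessThan_Suc_atMost[symmetric] sum.lessThan_Suc
          by (subst sum.neutral) (simp_all add: binomial_eq_0 km(1))
        finally have "lookup ?q M = 0"
          using True c by (simp add: lookup_minus lookup_Const_mult km(1) monom_eval_split0)
        with Mk show False by (simp add: in_keys_iff)
      qed
      moreover have "M \<in> lower_closure q" using M(1) keys_lower_closure by blast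
      ultimately show ?thesis using sub True by (auto simp: R_def)
    qed
    then show ?thesis by blast
  qed
  show ?thesis using q
  proof (induction "card (R q)" arbitrary: q rule: less_induct)
    case less
    from dec[OF less.prems(2)] obtain l where l: "R (peval Const (shift_diag c \<mu>) q - Const l * q) \<subset> R q" by blast
    let ?q = "peval Const (shift_diag c \<mu>) q - Const l * q"
    show ?case
    proof (cases "?q = 0")
      case True
      then have "peval Const (shift_diag c \<mu>) q = Const l * q" by simp
      with less.prems show ?thesis by blast
    next
      case False
      from less.hyps[OF psubset_card_mono[OF fin l] V[OF less.prems(1)] False] show ?thesis .
    qed
  qed
qed

lemma shift_diag_Aut:
  fixes \<mu> :: "nat \<Rightarrow> 'k::field"
  assumes c: "c \<Longrightarrow> \<mu> 0 = 1" and \<mu>: "\<And>i. i < n \<Longrightarrow> \<mu> i \<noteq> 0"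
  shows "pmap n (shift_diag c \<mu>) \<in> carrier (Aut n)" "birational n (pmap n (shift_diag c \<mu>))"
proof -
  define G :: "nat \<Rightarrow> 'k mpoly" where "G i = Const (1 / \<mu> i) * Var i + (if c \<and> i = 0 then Const (-1) else 0)" for i
  have *: "Const a * (Const b * p) = Const (a * b) * p" for a b and p :: "'k mpoly"
    by (simp add: mult.assoc[symmetric] mult_single)
  have m1: "Const (-1) + 1 = (0 :: 'k mpoly)" "1 + Const (-1) = (0 :: 'k mpoly)"
    by (simp_all add: single_uminus)
  show "pmap n (shift_diag c \<mu>) \<in> carrier (Aut n)"
  proof (rule pmap_Aut)
    fix i assume i: "i < n"
    show "shift_diag c \<mu> i \<in> polys n" using i by simp
    show "G i \<in> polys n" using i by (auto simp: G_def intro!: polys_add polys_mult)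
    show "peval Const (shift_diag c \<mu>) (G i) = Var i" "peval Const G (shift_diag c \<mu> i) = Var i"
      using \<mu>[OF i] c
      by (auto simp: G_def shift_diag_def Const.peval_add Const.peval_mult Const.peval_Const Const.peval_Var Const.peval_1
          distrib_left * add.assoc m1)
  qed
  then show "birational n (pmap n (shift_diag c \<mu>))" by (simp add: Aut_carrier)
qed

text \<open>Applying \<open>\<sigma>\<close> to \<open>q r = p\<close> gives
  \<open>\<sigma> q (a r + b) = \<sigma> p\<close>, so \<open>\<sigma> q\<close> is again a
  denominator of \<open>r\<close>; an eigenvector among the denominators gives the fraction sought.
  The value \<open>b = 0\<close> serves for eigenfunctions, \<open>a = b = 1\<close> for translated
  functions.\<close>

lemma shift_diag_semi_invariant:
  fixes \<mu> :: "nat \<Rightarrow> 'k::field_char_0"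
  assumes c: "c \<Longrightarrow> \<mu> 0 = 1" and \<mu>: "\<And>i. i < n \<Longrightarrow> \<mu> i \<noteq> 0"
    and r: "r \<in> ratfuns n" and eq: "rat_subst (pmap n (shift_diag c \<mu>)) r = scalar a * r + scalar b" and a: "a \<noteq> 0"
  shows "\<exists>p q l. p \<in> polys n \<and> q \<in> polys n \<and> q \<noteq> 0 \<and> l \<noteq> 0 \<and> to_fract q * r = to_fract p \<and>
    peval Const (shift_diag c \<mu>) q = Const l * q \<and>
    peval Const (shift_diag c \<mu>) p = Const l * (Const a * p + Const b * q)"
proof -
  let ?\<tau> = "pmap n (shift_diag c \<mu>)" and ?\<sigma> = "peval Const (shift_diag c \<mu>)"
  note bir = shift_diag_Aut(2)[where c = c and \<mu> = \<mu> and n = n, OF c \<mu>]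
  have reg: "reg ?\<tau> = ratfuns n" using reg_dominant[OF birationalD(2)[OF bir]] by simp
  have \<sigma>: "?\<sigma> p \<in> polys n" if "p \<in> polys n" for p by (rule polys_peval[OF that]) simp
  have key: "to_fract (?\<sigma> q) * (scalar a * r + scalar b) = to_fract (?\<sigma> p)"
    if "p \<in> polys n" "q \<in> polys n" "to_fract q * r = to_fract p" for p q
  proof -
    have "rat_subst ?\<tau> (to_fract q * r) = to_fract (?\<sigma> q) * (scalar a * r + scalar b)"
    proof -
      have "to_fract q \<in> reg ?\<tau>" "r \<in> reg ?\<tau>" using that(2) r by (simp_all add: reg ratfuns_to_fract)
      from reg_add_mult(4)[OF this] show ?thesis unfolding eq rat_subst_pmap(1)[OF that(2)] .
    qed
    then have "to_fract (?\<sigma> q) * (scalar a * r + scalar b) = rat_subst ?\<tau> (to_fract p)" by (simp only: that(3))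
    also have "\<dots> = to_fract (?\<sigma> p)" by (rule rat_subst_pmap(1)[OF that(1)])
    finally show ?thesis .
  qed
  define V where "V = {q \<in> polys n. \<exists>p\<in>polys n. to_fract q * r = to_fract p}"
  have V: "?\<sigma> q - Const l * q \<in> V" if q: "q \<in> V" for q l
  proof -
    from q obtain p where p: "p \<in> polys n" "q \<in> polys n" "to_fract q * r = to_fract p" by (auto simp: V_def)
    \<comment> \<open>The numerator belonging to the denominator \<open>\<sigma> q - l q\<close>,
      found by solving the transformed equation for \<open>\<sigma> q r\<close>.\<close>
    let ?p = "Const (1 / a) * (?\<sigma> p - Const b * ?\<sigma> q) - Const l * p"
    have s: "to_fract (?\<sigma> q) * r = scalar (1 / a) * (to_fract (?\<sigma> p) - scalar b * to_fract (?\<sigma> q))"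
    proof -
      have "X * r = 1 / A * (X * (A * r + B) - B * X)" if "A \<noteq> 0" for A B X :: "'k ratfun"
        using that by (simp add: field_simps)
      from this[of "scalar a"] a show ?thesis unfolding key[OF p, symmetric] by (simp add: scalar_divide)
    qed
    have "to_fract (?\<sigma> q - Const l * q) * r = to_fract (?\<sigma> q) * r - scalar l * (to_fract q * r)"
      by (simp add: left_diff_distrib to_fract_Const mult.assoc)
    also have "\<dots> = to_fract ?p" unfolding s p(3) by (simp add: to_fract_Const)
    finally have "to_fract (?\<sigma> q - Const l * q) * r = to_fract ?p" .
    moreover have "?p \<in> polys n" "?\<sigma> q - Const l * q \<in> polys n"
      using p(1,2) \<sigma>[OF p(1)] \<sigma>[OF p(2)] by (simp_all add: polys_diff polys_mult)
    ultimately show ?thesis unfolding V_def by blast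
  qed
  from r obtain p0 q0 where "p0 \<in> polys n" "q0 \<in> polys n" "q0 \<noteq> 0" "r = Fract p0 q0" by (rule ratfunsE)
  then have "to_fract q0 * r = to_fract p0" "q0 \<noteq> 0" by (simp_all add: Fract_conv_to_fract)
  then have q0: "q0 \<in> V" "q0 \<noteq> 0" unfolding V_def using \<open>p0 \<in> polys n\<close> \<open>q0 \<in> polys n\<close> by blast+
  from shift_diag_exists_eigenvector[where c = c and \<mu> = \<mu>, OF c V q0] obtain q l where
    q: "q \<in> V" "q \<noteq> 0" "?\<sigma> q = Const l * q" by blast
  from q(1) obtain p where p: "p \<in> polys n" "q \<in> polys n" "to_fract q * r = to_fract p" by (auto simp: V_def)
  obtain m where m: "m \<in> keys q" using q(2) by fastforce
  have "l \<noteq> 0"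
  proof -
    have "monom_eval \<mu> m = l" by (rule shift_diag_eigenvector(1)[OF q(3) c \<mu> p(2) m])
    moreover have "monom_eval \<mu> m \<noteq> 0" unfolding monom_eval_def using polysD[OF p(2) m] \<mu> by auto
    ultimately show ?thesis by simp
  qed
  moreover have "?\<sigma> p = Const l * (Const a * p + Const b * q)"
  proof -
    have "to_fract (?\<sigma> p) = scalar l * (scalar a * (to_fract q * r) + scalar b * to_fract q)"
      unfolding key[OF p, symmetric] q(3) by (simp add: to_fract_Const algebra_simps)
    also have "\<dots> = to_fract (Const l * (Const a * p + Const b * q))" by (simp add: p(3) to_fract_Const)
    finally show ?thesis by (simp only: to_fract_eq_iff)
  qed
  ultimately show ?thesis using p q by blast
qed

text \<open>For \<open>r = p/q\<close> with \<open>\<sigma> q = l q\<close> one would have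
  \<open>\<sigma> p = l (p + q)\<close>. At a monomial of \<open>q\<close> the weight is
  \<open>l\<close>, so the coefficients of \<open>p\<close> cancel and that of \<open>q\<close> must
  vanish.\<close>

lemma diag_no_translation:
  fixes \<mu> :: "nat \<Rightarrow> 'k::field_char_0"
  assumes \<mu>: "\<And>i. i < n \<Longrightarrow> \<mu> i \<noteq> 0" and r: "r \<in> ratfuns n"
  shows "rat_subst (pmap n (shift_diag False \<mu>)) r \<noteq> r + 1"
proof
  assume "rat_subst (pmap n (shift_diag False \<mu>)) r = r + 1"
  then have "rat_subst (pmap n (shift_diag False \<mu>)) r = scalar 1 * r + scalar 1" by simp
  from shift_diag_semi_invariant[OF _ \<mu> r this] obtain p q l where
    *: "q \<in> polys n" "q \<noteq> 0" "l \<noteq> 0" "peval Const (shift_diag False \<mu>) q = Const l * q"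
      "peval Const (shift_diag False \<mu>) p = Const l * (Const 1 * p + Const 1 * q)" by auto
  obtain m where m: "m \<in> keys q" using *(2) by fastforce
  have "monom_eval \<mu> m = l" by (rule shift_diag_eigenvector(1)[OF *(4) _ \<mu> *(1) m]) simp
  with arg_cong[OF *(5), of "\<lambda>p. lookup p m"] have "l * lookup q m = 0"
    by (simp add: peval_shift_diag_False lookup_Const_mult lookup_add distrib_left)
  with *(3) m show False by (simp add: in_keys_iff)
qed

text \<open>The character of the torus with exponent vector \<open>e\<close>. The value field is
  left open because it is evaluated at eigenvalues and also at \<open>coord\<close>, where it gives
  the components of monomial maps.\<close>

definition laurent :: "nat \<Rightarrow> (nat \<Rightarrow> 'a::field) \<Rightarrow> (nat \<Rightarrow> int) \<Rightarrow> 'a" where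
  "laurent n \<mu> e = (\<Prod>i<n. \<mu> i powi e i)"

lemma monom_eval_laurent:
  fixes \<mu> :: "nat \<Rightarrow> 'a::field"
  assumes "keys m \<subseteq> {..<n}"
  shows "monom_eval \<mu> m = laurent n \<mu> (\<lambda>i. int (lookup m i))"
  by (simp add: monom_eval_superset[OF _ assms] laurent_def)

lemma laurent_diff:
  assumes "\<And>i. i < n \<Longrightarrow> \<mu> i \<noteq> 0"
  shows "laurent n \<mu> (\<lambda>i. e i - f i) = laurent n \<mu> e / laurent n \<mu> f"
  unfolding laurent_def prod_dividef[symmetric] using assms by (intro prod.cong) (auto simp: power_int_diff)

text \<open>Numerator and denominator are eigenvectors whose eigenvalues differ by the factor
  \<open>a\<close>, and all monomials of an eigenvector have the same weight.\<close>

lemma shift_diag_eigenfunction: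
  fixes \<mu> :: "nat \<Rightarrow> 'k::field_char_0"
  assumes c: "c \<Longrightarrow> \<mu> 0 = 1" and \<mu>: "\<And>i. i < n \<Longrightarrow> \<mu> i \<noteq> 0"
    and r: "r \<in> ratfuns n" "r \<noteq> 0" and eq: "rat_subst (pmap n (shift_diag c \<mu>)) r = scalar a * r" and a: "a \<noteq> 0"
  obtains p q where "p \<in> polys n" "q \<in> polys n" "p \<noteq> 0" "q \<noteq> 0" "to_fract q * r = to_fract p"
    "\<And>m. m \<in> keys p \<union> keys q \<Longrightarrow> c \<Longrightarrow> lookup m 0 = 0"
    "\<And>m m'. m \<in> keys p \<Longrightarrow> m' \<in> keys q \<Longrightarrow> monom_eval \<mu> m = a * monom_eval \<mu> m'"
proof -
  have eq': "rat_subst (pmap n (shift_diag c \<mu>)) r = scalar a * r + scalar 0" using eq by simp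
  from shift_diag_semi_invariant[where c = c and \<mu> = \<mu>, OF c \<mu> r(1) eq' a] obtain p q l where
    *: "p \<in> polys n" "q \<in> polys n" "q \<noteq> 0" "to_fract q * r = to_fract p"
    "peval Const (shift_diag c \<mu>) q = Const l * q" "peval Const (shift_diag c \<mu>) p = Const (l * a) * p"
    by (auto simp: mult.assoc[symmetric] mult_single)
  have "p \<noteq> 0" using *(3,4) r(2) by auto
  moreover have "lookup m 0 = 0" if "m \<in> keys p \<union> keys q" c for m
    using shift_diag_eigenvector(2)[OF *(5) c \<mu> *(2)] shift_diag_eigenvector(2)[OF *(6) c \<mu> *(1)] that by blast
  moreover have "monom_eval \<mu> m = a * monom_eval \<mu> m'" if "m \<in> keys p" "m' \<in> keys q" for m m'
    using shift_diag_eigenvector(1)[OF *(5) c \<mu> *(2) that(2)] shift_diag_eigenvector(1)[OF *(6) c \<mu> *(1) that(1)] by simp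
  ultimately show thesis using that * by blast
qed

section \<open>Linear parts\<close>

lemma add_eq_single:
  "m + m' = single i (1::nat) \<longleftrightarrow> m = 0 \<and> m' = single i 1 \<or> m = single i 1 \<and> m' = 0"
proof
  assume eq: "m + m' = single i 1"
  have s: "lookup m j + lookup m' j = (if j = i then 1 else 0)" for j
    using arg_cong[OF eq, of "\<lambda>m. lookup m j"] by (simp add: lookup_add lookup_single when_def)
  have o: "lookup m j = 0" "lookup m' j = 0" if "j \<noteq> i" for j using s[of j] that by auto
  consider "lookup m i = 0" "lookup m' i = 1" | "lookup m i = 1" "lookup m' i = 0" using s[of i] by fastforce
  then show "m = 0 \<and> m' = single i 1 \<or> m = single i 1 \<and> m' = 0"
  proof cases
    case 1
    have "m = 0" by (rule poly_mapping_eqI) (use o(1) 1 in \<open>auto, metis\<close>)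
    with eq show ?thesis by simp
  next
    case 2
    have "m' = 0" by (rule poly_mapping_eqI) (use o(2) 2 in \<open>auto, metis\<close>)
    with eq show ?thesis by simp
  qed
qed auto

lemma single1_neq_0: "single (i::nat) (1::nat) \<noteq> 0"
  by (metis keys_single keys_zero insert_not_empty one_neq_zero)

lemma single1_eq_iff: "single (i::nat) (1::nat) = single j 1 \<longleftrightarrow> i = j"
  by (metis keys_single one_neq_zero singleton_inject)

lemma lookup_mult_0: "lookup (p * q) 0 = lookup p 0 * lookup q (0 :: nat \<Rightarrow>\<^sub>0 nat)" for p :: "(nat \<Rightarrow>\<^sub>0 nat) \<Rightarrow>\<^sub>0 'k::comm_ring_1"
proof (induction p rule: mpoly_induct_keys[where K = UNIV])
  case (single m a)
  show ?case
  proof (induction q rule: mpoly_induct_keys[where K = UNIV])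
    case (single m' b)
    have "m + m' = 0 \<longleftrightarrow> m = 0 \<and> m' = 0"
      by (metis add_eq_0_iff_both_eq_0 add_0 lookup_add lookup_zero poly_mapping_eqI)
    then show ?case by (auto simp: mult_single lookup_single when_def)
  qed (simp_all add: lookup_add distrib_left)
qed (simp_all add: lookup_add distrib_right)

text \<open>The Leibniz rule at the origin: a variable is a product of two monomials only if one of
  them is 1.\<close>

lemma lookup_mult_single:
  "lookup (p * q) (single i 1) = lookup p 0 * lookup q (single i 1) + lookup p (single i 1) * lookup q (0 :: nat \<Rightarrow>\<^sub>0 nat)"
  for p :: "(nat \<Rightarrow>\<^sub>0 nat) \<Rightarrow>\<^sub>0 'k::comm_ring_1"
proof (induction p rule: mpoly_induct_keys[where K = UNIV])
  case (single m a)
  show ?case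
  proof (induction q rule: mpoly_induct_keys[where K = UNIV])
    case (single m' b)
    have "single i (1::nat) \<noteq> 0" by (rule single1_neq_0)
    then show ?case
      using add_eq_single[of m m' i] by (auto simp: mult_single lookup_single when_def simp del: One_nat_def)
  qed (simp_all add: lookup_add distrib_left)
qed (simp_all add: lookup_add distrib_right)

text \<open>The Jacobian matrix at the origin, read off from coefficients.\<close>

definition linear_part :: "nat \<Rightarrow> (nat \<Rightarrow> 'k::field mpoly) \<Rightarrow> 'k mat" where
  "linear_part n F = mat n n (\<lambda>(i, j). lookup (F i) (single j 1))"

lemma lookup_Const: "lookup (Const c) (m :: nat \<Rightarrow>\<^sub>0 nat) = (if m = 0 then c else 0)"
  by (auto simp: lookup_single when_def)

lemma lookup_Var_single: "lookup (Var j) (single i 1) = (if i = j then 1 else 0)"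
  unfolding Var_def lookup_single single1_eq_iff by (auto simp: when_def)

lemma lookup_Var_0: "lookup (Var j) 0 = 0"
  using single1_neq_0[of j] by (auto simp: Var_def lookup_single when_def)

text \<open>The chain rule at the origin. Vanishing constant terms of the inserted polynomials keep
  the terms of \<open>p\<close> of degree at least two out of the linear part.\<close>

lemma peval_linear_part:
  fixes p :: "'k::field mpoly"
  assumes p: "p \<in> polys n" and F: "\<And>j. j < n \<Longrightarrow> lookup (F j) 0 = 0"
  shows "lookup (peval Const F p) 0 = lookup p 0 \<and>
    lookup (peval Const F p) (single i 1) = (\<Sum>j<n. lookup p (single j 1) * lookup (F j) (single i 1))"
  using p
proof (induction p rule: polys_induct)
  case (Const c)
  show ?case using single1_neq_0 by (simp add: Const.peval_Const lookup_Const del: One_nat_def)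
next
  case (Var k)
  then have "(\<Sum>j<n. (if j = k then 1 else 0) * lookup (F j) (single i 1)) = lookup (F k) (single i 1)"
    by (simp add: if_distrib[of "\<lambda>x. x * _"] cong: if_cong)
  with Var show ?case using F by (simp add: Const.peval_Var lookup_Var_0 lookup_Var_single del: One_nat_def)
next
  case (add p q)
  then show ?case by (simp add: Const.peval_add lookup_add distrib_right sum.distrib)
next
  case (mult p q)
  have "lookup p 0 * (\<Sum>j<n. lookup q (single j 1) * lookup (F j) (single i 1)) +
      (\<Sum>j<n. lookup p (single j 1) * lookup (F j) (single i 1)) * lookup q 0 =
     (\<Sum>j<n. lookup (p * q) (single j 1) * lookup (F j) (single i 1))"
    unfolding lookup_mult_single sum_distrib_left sum_distrib_right sum.distrib[symmetric]
    by (intro sum.cong refl) (simp add: algebra_simps)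
  with mult show ?case by (simp add: Const.peval_mult lookup_mult_0 lookup_mult_single del: One_nat_def)
qed

lemma linear_part_comp:
  assumes "\<And>i. i < n \<Longrightarrow> G i \<in> polys n" "\<And>j. j < n \<Longrightarrow> lookup (F j) 0 = 0"
  shows "linear_part n (\<lambda>i. peval Const F (G i)) = linear_part n G * linear_part n F"
  using peval_linear_part[of _ n F] assms
  by (intro eq_matI) (simp_all add: linear_part_def scalar_prod_def atLeast0LessThan del: One_nat_def)

lemma linear_part_Var: "linear_part n Var = 1\<^sub>m n"
  by (rule eq_matI) (auto simp: linear_part_def lookup_Var_single simp del: One_nat_def)

lemma linear_part_cong: "(\<And>i. i < n \<Longrightarrow> F i = G i) \<Longrightarrow> linear_part n F = linear_part n G"
  by (auto simp: linear_part_def)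

lemma linear_part_carrier [simp]: "linear_part n F \<in> carrier_mat n n"
  by (simp add: linear_part_def)

text \<open>Translations do not change linear parts, so the value of \<open>H\<close> at the origin may be assumed to be
  the origin.\<close>

lemma linear_part_Aut:
  fixes H G :: "nat \<Rightarrow> 'k::field mpoly"
  assumes "\<And>i. i < n \<Longrightarrow> H i \<in> polys n" "\<And>i. i < n \<Longrightarrow> G i \<in> polys n"
    and "\<And>i. i < n \<Longrightarrow> peval Const H (G i) = Var i"
  shows "\<exists>Q\<in>carrier_mat n n. Q * linear_part n H = 1\<^sub>m n \<and> linear_part n H * Q = 1\<^sub>m n"
proof -
  define c where "c i = lookup (H i) 0" for i
  define K where "K i = H i + Const (- c i)" for i
  define T :: "nat \<Rightarrow> 'k mpoly" where "T i = Var i + Const (c i)" for i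
  have K0: "lookup (K i) 0 = 0" for i by (simp add: K_def lookup_add c_def lookup_Const)
  have LK: "linear_part n K = linear_part n H"
    using single1_neq_0 by (auto simp: linear_part_def K_def lookup_add lookup_Const simp del: One_nat_def)
  have KT: "peval Const K (T i) = H i" for i
    by (simp add: T_def K_def Const.peval_add Const.peval_Var Const.peval_Const add.assoc flip: single_add)
  have "peval Const K (peval Const T (G i)) = Var i" if "i < n" for i
  proof -
    have "peval Const K (peval Const T (G i)) = peval Const (\<lambda>i. peval Const K (T i)) (G i)"
      using peval_hom_comp[OF Const.peval_comm_ring_hom[of K], of Const T "G i"] by (simp add: Const.peval_Const)
    then show ?thesis using assms(3)[OF that] by (simp add: KT)
  qed
  moreover have "peval Const T (G i) \<in> polys n" if "i < n" for i
    by (rule polys_peval[OF assms(2)[OF that]]) (auto simp: T_def intro: polys_add)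
  ultimately have "linear_part n (\<lambda>i. peval Const T (G i)) * linear_part n H = 1\<^sub>m n"
    using linear_part_comp[of n "\<lambda>i. peval Const T (G i)" K] K0
    by (simp add: LK linear_part_Var cong: linear_part_cong)
  from this mat_mult_left_right_inverse[OF linear_part_carrier linear_part_carrier this]
  show ?thesis using linear_part_carrier by blast
qed

text \<open>Compare linear parts in \<open>h M = M' h\<close>. On the left the inner map fixes the
  origin and the chain rule applies; on the right the outer map is linear, so its matrix factors out
  even if \<open>h\<close> moves the origin.\<close>

lemma conjugate_linear_similar:
  fixes M M' :: "'k::field mat"
  assumes M: "M \<in> carrier_mat n n" "M' \<in> carrier_mat n n"
    and conj: "conjugate_in (Aut n) (affine_map M (0\<^sub>v n)) (affine_map M' (0\<^sub>v n))"
    and bir: "birational n (affine_map M (0\<^sub>v n))"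
  shows "similar_mat M M'"
proof -
  obtain h where h: "h \<in> carrier (Aut n)"
    "rat_comp (rat_comp h (affine_map M (0\<^sub>v n))) (inv\<^bsub>Bir n\<^esub> h) = affine_map M' (0\<^sub>v n)"
    using conj unfolding conjugate_in_Aut_iff by blast
  from AutE[OF h(1)] obtain H G where H: "\<And>i. i < n \<Longrightarrow> H i \<in> polys n" "\<And>i. i < n \<Longrightarrow> G i \<in> polys n"
    "h = pmap n H" "\<And>i. i < n \<Longrightarrow> peval Const H (G i) = Var i" by metis
  have hc: "h \<in> carrier (Bir n)" using h(1) by (simp add: Aut_carrier)
  interpret group "Bir n :: 'k ratfun vec monoid" by (rule group_Bir)
  have "rat_comp h (affine_map M (0\<^sub>v n)) = rat_comp (affine_map M' (0\<^sub>v n)) h"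
  proof -
    have "h \<otimes>\<^bsub>Bir n\<^esub> affine_map M (0\<^sub>v n) \<in> carrier (Bir n)" using hc bir m_closed[of h] by simp
    then have "(h \<otimes>\<^bsub>Bir n\<^esub> affine_map M (0\<^sub>v n)) \<otimes>\<^bsub>Bir n\<^esub> inv\<^bsub>Bir n\<^esub> h \<otimes>\<^bsub>Bir n\<^esub> h = h \<otimes>\<^bsub>Bir n\<^esub> affine_map M (0\<^sub>v n)"
      using hc by (simp only: m_assoc inv_closed l_inv r_one)
    with h(2) show ?thesis by simp
  qed
  then have "pmap n (\<lambda>i. peval Const (affine_poly n M (0\<^sub>v n)) (H i)) = pmap n (\<lambda>i. peval Const H (affine_poly n M' (0\<^sub>v n) i))"
    unfolding H(3) affine_map_pmap[OF M(1)] affine_map_pmap[OF M(2)] using H(1) by (simp add: rat_comp_pmap)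
  then have eq: "peval Const (affine_poly n M (0\<^sub>v n)) (H i) = peval Const H (affine_poly n M' (0\<^sub>v n) i)" if "i < n" for i
    using that by (metis pmap_index(2) to_fract_eq_iff)
  have A0: "lookup (affine_poly n N (0\<^sub>v n) i) 0 = 0" if "i < n" for N i
    using that by (simp add: affine_poly_def lookup_add lookup_sum lookup_Const_mult lookup_Var_0 lookup_Const)
  have A1: "linear_part n (affine_poly n N (0\<^sub>v n)) = N" if "N \<in> carrier_mat n n" for N
    using that single1_neq_0 by (intro eq_matI)
      (auto simp: linear_part_def affine_poly_def lookup_add lookup_sum lookup_Const_mult lookup_Var_single lookup_Const
        if_distrib[of "\<lambda>x. _ * x"] simp del: One_nat_def cong: if_cong)
  have "linear_part n H * M = linear_part n (\<lambda>i. peval Const (affine_poly n M (0\<^sub>v n)) (H i))"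
    using linear_part_comp[of n H "affine_poly n M (0\<^sub>v n)", OF H(1) A0] by (simp add: A1[OF M(1)])
  also have "\<dots> = linear_part n (\<lambda>i. peval Const H (affine_poly n M' (0\<^sub>v n) i))"
    by (rule linear_part_cong) (rule eq)
  also have "\<dots> = M' * linear_part n H"
    using M by (intro eq_matI) (auto simp: linear_part_def peval_affine_poly lookup_add lookup_sum lookup_Const_mult
        lookup_Const single1_neq_0 scalar_prod_def atLeast0LessThan simp del: One_nat_def)
  finally have PM: "linear_part n H * M = M' * linear_part n H" .
  from linear_part_Aut[OF H(1,2,4)] obtain Q where Q: "Q \<in> carrier_mat n n"
    "Q * linear_part n H = 1\<^sub>m n" "linear_part n H * Q = 1\<^sub>m n" by blast
  let ?P = "linear_part n H"
  have "Q * M' * ?P = Q * (M' * ?P)" by (rule assoc_mult_mat[OF Q(1) M(2) linear_part_carrier])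
  also have "\<dots> = Q * (?P * M)" by (simp only: PM)
  also have "\<dots> = (Q * ?P) * M" by (rule assoc_mult_mat[OF Q(1) linear_part_carrier M(1), symmetric])
  also have "\<dots> = M" using Q M by simp
  finally show ?thesis by (intro similar_matI[OF _ Q(2,3)]) (use Q M in auto)
qed

section \<open>Conjugacy in the affine Cremona group\<close>

lemma conjugate_in_Bir_def:
  "conjugate_in (Bir n) f g \<longleftrightarrow> (\<exists>h. birational n h \<and> rat_comp (rat_comp h f) (inv\<^bsub>Bir n\<^esub> h) = g)"
  by (simp add: conjugate_in_def Bex_def)

lemma conjugate_in_commute:
  assumes "birational n h" "birational n f" "rat_comp (rat_comp h f) (inv\<^bsub>Bir n\<^esub> h) = (g :: 'k::field ratfun vec)"
  shows "rat_comp h f = rat_comp g h"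
proof -
  interpret group "Bir n :: 'k ratfun vec monoid" by (rule group_Bir)
  have hc: "h \<in> carrier (Bir n)" and fc: "f \<in> carrier (Bir n)" using assms by simp_all
  have "(h \<otimes>\<^bsub>Bir n\<^esub> f) \<otimes>\<^bsub>Bir n\<^esub> inv\<^bsub>Bir n\<^esub> h \<otimes>\<^bsub>Bir n\<^esub> h = h \<otimes>\<^bsub>Bir n\<^esub> f"
    using hc m_closed[OF hc fc] by (simp only: m_assoc inv_closed l_inv r_one)
  with assms(3) show ?thesis by simp
qed

text \<open>With the fixed points moved to the origin, conjugacy yields similar matrices.
  Conversely, equal multisets of blocks yield similarity, which is conjugation by a linear
  map.\<close>

theorem conjugate_affine_fixed_point_iff:
  fixes M M' :: "'k::alg_closed_field mat"
  assumes M: "(M, b) \<in> affine_data n" "fixes_point M b" and M': "(M', b') \<in> affine_data n" "fixes_point M' b'"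
  shows "conjugate_in (Aut n) (affine_map M b) (affine_map M' b') \<longleftrightarrow>
    (\<exists>J. has_affine_jnf n (affine_map M b) J \<and> has_affine_jnf n (affine_map M' b') J)"
proof
  have GL: "M \<in> GL n" "b \<in> carrier_vec n" "M' \<in> GL n" "b' \<in> carrier_vec n"
    using M(1) M'(1) by (auto simp: affine_data_def)
  note c = GL_carrier[OF GL(1)] GL_carrier[OF GL(3)]
  note lin = conjugate_to_linear[OF GL(1,2) M(2)] conjugate_to_linear[OF GL(3,4) M'(2)]
  note bir = affine_data_Aut(2)[OF M(1)] affine_data_Aut(2)[OF M'(1)]
  note birl = conjugate_in_Aff_closed[OF M(1) lin(1)] conjugate_in_Aff_closed[OF M'(1) lin(2)]
  have sym: "conjugate_in (Aut n) f g \<Longrightarrow> conjugate_in (Aut n) g f" if "f \<in> carrier (Aut n)" for f g :: "'k ratfun vec"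
    using conjugate_in_sym[OF group_Aut that] .
  {
    assume conj: "conjugate_in (Aut n) (affine_map M b) (affine_map M' b')"
    have "conjugate_in (Aut n) (affine_map M (0\<^sub>v n)) (affine_map M b)"
      by (rule sym[OF affine_data_Aut(1)[OF M(1)] conjugate_in_Aff_Aut[OF lin(1)]])
    from conjugate_in_Aut_trans[OF birl(1) conjugate_in_Aut_trans[OF birl(1) this conj] conjugate_in_Aff_Aut[OF lin(2)]]
    have "conjugate_in (Aut n) (affine_map M (0\<^sub>v n)) (affine_map M' (0\<^sub>v n))" .
    from conjugate_linear_similar[OF c this birl(1)] have sim: "similar_mat M M'" .
    obtain xs where xs: "jordan_nf M' xs" using jordan_nf_exists_alg_closed[OF c(2)] by blast
    have "jordan_nf M xs" by (rule jordan_nf_similar[OF sim xs])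
    with xs lin GL show "\<exists>J. has_affine_jnf n (affine_map M b) J \<and> has_affine_jnf n (affine_map M' b') J"
      unfolding has_affine_jnf_def by blast
  }
  assume "\<exists>J. has_affine_jnf n (affine_map M b) J \<and> has_affine_jnf n (affine_map M' b') J"
  then obtain L L' xs ys where L: "L \<in> GL n" "conjugate_in (Aff n) (affine_map M b) (affine_map L (0\<^sub>v n))"
    "L' \<in> GL n" "conjugate_in (Aff n) (affine_map M' b') (affine_map L' (0\<^sub>v n))" "jordan_nf L xs" "jordan_nf L' ys"
    "mset xs = mset ys" unfolding has_affine_jnf_def by metis
  note Lc = GL_carrier[OF L(1)] GL_carrier[OF L(3)]
  have "similar_mat L' L" using jordan_nf_mset_similar[OF L(6,5)] L(7) by simp
  then obtain P Q where w: "similar_mat_wit L' L P Q" unfolding similar_mat_def by blast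
  note w = similar_mat_witD2[OF Lc(2) w]
  have "P *\<^sub>v 0\<^sub>v n + 0\<^sub>v n - L' *\<^sub>v 0\<^sub>v n = 0\<^sub>v n"
    by (simp add: mult_mat_zero_vec[OF w(6)] mult_mat_zero_vec[OF Lc(2)])
  with conjugate_affine_map[OF Lc(1) zero_carrier_vec w(6,7,1,2) zero_carrier_vec]
  have LL: "conjugate_in (Aff n) (affine_map L (0\<^sub>v n)) (affine_map L' (0\<^sub>v n))"
    by (simp only: w(3)[symmetric])
  have "conjugate_in (Aut n) (affine_map L' (0\<^sub>v n)) (affine_map M' b')"
    by (rule sym[OF affine_data_Aut(1)[OF M'(1)] conjugate_in_Aff_Aut[OF L(4)]])
  then show "conjugate_in (Aut n) (affine_map M b) (affine_map M' b')"
    using conjugate_in_Aut_trans[OF bir(1) conjugate_in_Aff_Aut[OF L(2)]] conjugate_in_Aff_Aut[OF LL]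
      conjugate_in_Aut_trans[OF bir(1)] by blast
qed

text \<open>Puts the weight 1 of the translated coordinate in front, as
  \<open>shift_diag True\<close> expects.\<close>

definition almost_eigs :: "'k::field vec \<Rightarrow> nat \<Rightarrow> 'k" where
  "almost_eigs \<nu> i = (if i = 0 then 1 else \<nu> $ (i - 1))"

lemma almost_diag_aut_eigs:
  assumes "\<nu> \<in> carrier_vec (n - 1)" "0 < n"
  shows "almost_diag_aut \<nu> = pmap n (shift_diag True (almost_eigs \<nu>))"
proof -
  have "almost_diag_aut \<nu> = almost_diag_aut (vec (n - 1) (\<lambda>i. almost_eigs \<nu> (Suc i)))"
    using assms(1) by (intro arg_cong[of _ _ almost_diag_aut] eq_vecI) (auto simp: almost_eigs_def)
  also have "\<dots> = pmap n (shift_diag True ((almost_eigs \<nu>)(0 := 1)))" by (rule almost_diag_aut_pmap[OF assms(2)])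
  also have "(almost_eigs \<nu>)(0 := 1) = almost_eigs \<nu>" by (auto simp: almost_eigs_def)
  finally show ?thesis .
qed

lemma almost_eigs_nonzero: "\<nu> \<in> torus (n - 1) \<Longrightarrow> i < n \<Longrightarrow> almost_eigs \<nu> i \<noteq> 0"
  by (auto simp: almost_eigs_def torus_def)

lemma almost_eigs_0 [simp]: "almost_eigs \<nu> 0 = 1"
  by (simp add: almost_eigs_def)

text \<open>For \<open>i > 0\<close> the component \<open>H i\<close> is an eigenvector with
  eigenvalue \<open>\<nu>' $ (i - 1)\<close>. A variable occurring linearly in it has that weight
  and is not the translated one, so a permutation with nonzero product in the determinant matches
  the eigenvalues.\<close>

theorem almost_diag_conjugate_Aut_permutation:
  fixes \<nu> \<nu>' :: "'k::field_char_0 vec"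
  assumes n: "0 < n" and \<nu>: "\<nu> \<in> torus (n - 1)" "\<nu>' \<in> torus (n - 1)"
    and conj: "conjugate_in (Aut n) (almost_diag_aut \<nu>) (almost_diag_aut \<nu>')"
  shows "\<exists>\<sigma>. \<sigma> permutes {..<n - 1} \<and> \<nu>' = vec (n - 1) (\<lambda>i. \<nu> $ \<sigma> i)"
proof -
  let ?\<mu> = "almost_eigs \<nu>" and ?\<mu>' = "almost_eigs \<nu>'"
  have c: "\<nu> \<in> carrier_vec (n - 1)" "\<nu>' \<in> carrier_vec (n - 1)" using \<nu> by (auto simp: torus_def)
  note th = almost_diag_aut_eigs[OF c(1) n] almost_diag_aut_eigs[OF c(2) n]
  note nz = almost_eigs_nonzero[OF \<nu>(1)]
  have bir: "birational n (pmap n (shift_diag True ?\<mu>))" by (rule shift_diag_Aut(2)) (use nz in auto)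
  obtain h where h: "h \<in> carrier (Aut n)"
    "rat_comp (rat_comp h (pmap n (shift_diag True ?\<mu>))) (inv\<^bsub>Bir n\<^esub> h) = pmap n (shift_diag True ?\<mu>')"
    using conj unfolding th conjugate_in_Aut_iff by blast
  from AutE[OF h(1)] obtain H G where H: "\<And>i. i < n \<Longrightarrow> H i \<in> polys n" "\<And>i. i < n \<Longrightarrow> G i \<in> polys n"
    "h = pmap n H" "\<And>i. i < n \<Longrightarrow> peval Const H (G i) = Var i" by metis
  have "birational n h" using h(1) by (simp add: Aut_carrier)
  from conjugate_in_commute[OF this bir h(2)]
  have "pmap n (\<lambda>i. peval Const (shift_diag True ?\<mu>) (H i)) = pmap n (\<lambda>i. peval Const H (shift_diag True ?\<mu>' i))"
    unfolding H(3) using H(1) by (simp add: rat_comp_pmap)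
  then have eq: "peval Const (shift_diag True ?\<mu>) (H i) = peval Const H (shift_diag True ?\<mu>' i)" if "i < n" for i
    using that by (metis pmap_index(2) to_fract_eq_iff)
  have eig: "?\<mu> j = ?\<mu>' i \<and> j \<noteq> 0" if "0 < i" "i < n" "j < n" "linear_part n H $$ (i, j) \<noteq> 0" for i j
  proof -
    have "peval Const (shift_diag True ?\<mu>) (H i) = Const (?\<mu>' i) * H i"
      using eq[OF that(2)] that(1)
      by (simp add: shift_diag_def Const.peval_add Const.peval_mult Const.peval_Const Const.peval_Var)
    note ev = shift_diag_eigenvector[OF this _ nz H(1)[OF that(2)]]
    have "single j 1 \<in> keys (H i)" using that by (simp add: linear_part_def in_keys_iff)
    from ev(1)[OF _ _ this] ev(2)[OF _ _ this] show ?thesis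
      by (auto simp: monom_eval_single lookup_single when_def split: if_splits)
  qed
  from linear_part_Aut[OF H(1,2,4)] obtain Q where Q: "Q \<in> carrier_mat n n" "Q * linear_part n H = 1\<^sub>m n" by blast
  have "det (linear_part n H) \<noteq> 0"
    using det_mult[OF Q(1) linear_part_carrier[of n H]] Q(2) by auto
  then obtain \<sigma> where \<sigma>: "\<sigma> permutes {0..<n}" "(\<Prod>i = 0..<n. linear_part n H $$ (i, \<sigma> i)) \<noteq> 0"
    unfolding det_def'[OF linear_part_carrier]
    by (metis (no_types, lifting) mem_Collect_eq mult_zero_right sum.neutral)
  have \<sigma>n: "\<sigma> i < n" if "i < n" for i using permutes_in_image[OF \<sigma>(1), of i] that by simp
  have nzP: "linear_part n H $$ (i, \<sigma> i) \<noteq> 0" if "i < n" for i using \<sigma>(2) that by auto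
  have e: "?\<mu> (\<sigma> i) = ?\<mu>' i" "\<sigma> i \<noteq> 0" if "0 < i" "i < n" for i
    using eig[OF that \<sigma>n[OF that(2)] nzP[OF that(2)]] by simp_all
  \<comment> \<open>\<open>\<sigma>\<close> maps the positive indices into themselves;
    \<open>\<tau>\<close> is its restriction with all indices lowered by one.\<close>
  define \<tau> where "\<tau> i = (if i < n - 1 then \<sigma> (Suc i) - 1 else i)" for i
  have "\<tau> permutes {..<n - 1}"
  proof (rule bij_imp_permutes)
    have "inj_on \<tau> {..<n - 1}"
    proof (rule inj_onI)
      fix i j assume ij: "i \<in> {..<n - 1}" "j \<in> {..<n - 1}" "\<tau> i = \<tau> j"
      then have "Suc i < n" "Suc j < n" by auto
      with ij e(2)[of "Suc i"] e(2)[of "Suc j"] have "\<sigma> (Suc i) = \<sigma> (Suc j)" by (auto simp: \<tau>_def)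
      then show "i = j" using permutes_inj[OF \<sigma>(1)] by (auto dest: injD)
    qed
    moreover have "\<tau> ` {..<n - 1} \<subseteq> {..<n - 1}"
    proof
      fix k assume "k \<in> \<tau> ` {..<n - 1}"
      then obtain i where "i < n - 1" "k = \<tau> i" by blast
      then have i: "Suc i < n" "k = \<sigma> (Suc i) - 1" by (simp_all add: \<tau>_def)
      with \<sigma>n[OF i(1)] e(2)[of "Suc i"] show "k \<in> {..<n - 1}" by simp
    qed
    ultimately show "bij_betw \<tau> {..<n - 1} {..<n - 1}"
      by (simp add: bij_betw_def endo_inj_surj)
  qed (simp add: \<tau>_def)
  moreover have "\<nu>' = vec (n - 1) (\<lambda>i. \<nu> $ \<tau> i)"
  proof (rule eq_vecI)
    fix i assume "i < dim_vec (vec (n - 1) (\<lambda>i. \<nu> $ \<tau> i))"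
    then have i: "i < n - 1" by simp
    with e[of "Suc i"] show "\<nu>' $ i = vec (n - 1) (\<lambda>i. \<nu> $ \<tau> i) $ i"
      by (simp add: almost_eigs_def \<tau>_def)
  qed (use c in auto)
  ultimately show ?thesis by blast
qed

text \<open>The conjugation equation \<open>h f = f' h\<close> read in one component: components of
  a conjugating map are semi-invariants of \<open>f\<close>.\<close>

lemma conjugate_shift_diag_eigen:
  fixes \<mu> \<mu>' :: "nat \<Rightarrow> 'k::field"
  assumes h: "birational n h" and f: "birational n (pmap n (shift_diag c \<mu>))"
    and conj: "rat_comp (rat_comp h (pmap n (shift_diag c \<mu>))) (inv\<^bsub>Bir n\<^esub> h) = pmap n (shift_diag c' \<mu>')" and i: "i < n"
  shows "rat_subst (pmap n (shift_diag c \<mu>)) (h $ i) = scalar (\<mu>' i) * h $ i + (if c' \<and> i = 0 then 1 else 0)"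
proof -
  have dim: "dim_vec h = n" using ratmapsD(1)[OF birationalD(1)[OF h]] .
  have "rat_comp h (pmap n (shift_diag c \<mu>)) $ i = rat_comp (pmap n (shift_diag c' \<mu>')) h $ i"
    by (simp only: conjugate_in_commute[OF h f conj])
  then have "rat_subst (pmap n (shift_diag c \<mu>)) (h $ i) = rat_subst h (to_fract (shift_diag c' \<mu>' i))"
    using i dim by simp
  also have "\<dots> = poly_subst h (shift_diag c' \<mu>' i)" by (rule rat_subst_poly) (use i dim in simp)
  finally show ?thesis
    by (simp add: poly_subst_peval shift_diag_def scalar.peval_add scalar.peval_mult scalar.peval_Const scalar.peval_Var scalar.peval_1)
qed

text \<open>The first component of a conjugating map would be a rational function translated by 1
  under a diagonal map.\<close>

theorem diag_not_conjugate_almost_diag: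
  fixes \<mu> \<mu>' :: "nat \<Rightarrow> 'k::field_char_0"
  assumes n: "0 < n" and \<mu>: "\<And>i. i < n \<Longrightarrow> \<mu> i \<noteq> 0" "\<mu>' 0 = 1"
  shows "\<not> conjugate_in (Bir n) (pmap n (shift_diag False \<mu>)) (pmap n (shift_diag True \<mu>'))"
proof
  have bir: "birational n (pmap n (shift_diag False \<mu>))" by (rule shift_diag_Aut(2)) (use \<mu> in auto)
  assume "conjugate_in (Bir n) (pmap n (shift_diag False \<mu>)) (pmap n (shift_diag True \<mu>'))"
  then obtain h where h: "birational n h"
    "rat_comp (rat_comp h (pmap n (shift_diag False \<mu>))) (inv\<^bsub>Bir n\<^esub> h) = pmap n (shift_diag True \<mu>')"
    unfolding conjugate_in_Bir_def by blast
  from conjugate_shift_diag_eigen[OF h(1) bir h(2) n]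
  have "rat_subst (pmap n (shift_diag False \<mu>)) (h $ 0) = h $ 0 + 1" using \<mu>(2) by simp
  moreover have "rat_subst (pmap n (shift_diag False \<mu>)) (h $ 0) \<noteq> h $ 0 + 1"
    by (rule diag_no_translation[OF _ ratmapsD(2)[OF birationalD(1)[OF h(1)] n]]) (rule \<mu>(1))
  ultimately show False by simp
qed

section \<open>Roots of unity\<close>

text \<open>For positive \<open>d\<close> a primitive root of unity of order \<open>d\<close>; the
  value \<open>d = 0\<close> encodes infinite order.\<close>

definition exact_order :: "'a::monoid_mult \<Rightarrow> nat \<Rightarrow> bool" where
  "exact_order x d \<longleftrightarrow> (\<forall>k. x ^ k = 1 \<longleftrightarrow> d dvd k)"

text \<open>Induction over prime factors. If \<open>p\<close> already divides \<open>d\<close>, a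
  \<open>p\<close>-th root of an element of order \<open>d\<close> works; otherwise the element is
  multiplied by a root of \<open>1 + z + ... + z^(p-1)\<close>, which differs from 1 in
  characteristic 0.\<close>

lemma exists_exact_order:
  assumes "d > 0"
  shows "\<exists>x :: 'k::{alg_closed_field, field_char_0}. exact_order x d"
  using assms
proof (induction d rule: prime_divisors_induct)
  case (unit d)
  then show ?case by (intro exI[of _ 1]) (simp add: exact_order_def)
next
  case (factor p d)
  then have p: "prime p" "d > 0" by auto
  with factor.IH obtain x :: 'k where x: "x ^ k = 1 \<longleftrightarrow> d dvd k" for k by (auto simp: exact_order_def)
  show ?case
  proof (cases "p dvd d")
    case True
    obtain y where y: "y ^ p = x" using nth_root_exists[of p x] prime_gt_0_nat[OF p(1)] by auto
    have "y ^ k = 1 \<longleftrightarrow> p * d dvd k" for k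
    proof
      assume k: "y ^ k = 1"
      have "x ^ k = (y ^ k) ^ p" by (simp add: y[symmetric] power_mult[symmetric] mult.commute)
      with k x have "d dvd k" by simp
      with True obtain j where j: "k = p * j" by (meson dvd_trans dvdE)
      with k have "x ^ j = 1" by (simp add: power_mult y)
      with x j show "p * d dvd k" by simp
    next
      assume "p * d dvd k"
      then obtain j where "k = p * (d * j)" by (metis dvdE mult.assoc)
      then show "y ^ k = 1" using x[of "d * j"] by (simp add: power_mult[of y p] y)
    qed
    then show ?thesis unfolding exact_order_def by blast
  next
    case False
    have "\<exists>z :: 'k. (\<Sum>i\<le>p - 1. 1 * z ^ i) = 0"
      by (rule alg_closed) (use prime_gt_1_nat[OF p(1)] in auto)
    then obtain z :: 'k where z: "(\<Sum>i\<le>p - 1. z ^ i) = 0" by auto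
    have "z \<noteq> 1"
    proof
      assume "z = 1"
      with z have "of_nat p = (0 :: 'k)" using prime_gt_0_nat[OF p(1)] by (simp flip: of_nat_Suc)
      then show False using prime_gt_0_nat[OF p(1)] by simp
    qed
    have zp: "z ^ p = 1"
      using z power_diff_1_eq[of z p] prime_gt_0_nat[OF p(1)]
      by (cases p) (simp_all add: lessThan_Suc_atMost)
    have zk: "p dvd k" if "z ^ k = 1" for k
    proof (rule ccontr)
      assume "\<not> p dvd k"
      then have "coprime k p" using prime_imp_coprime[OF p(1), of k] by (simp add: coprime_commute)
      moreover have "k \<noteq> 0" using \<open>\<not> p dvd k\<close> by (metis dvd_0_right)
      ultimately obtain a b where "k * a = p * b + 1" using bezout_nat[of k p] by auto
      then have "z ^ (k * a) = z ^ (p * b + 1)" by simp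
      then have "z = 1" using that zp by (simp add: power_mult power_add)
      with \<open>z \<noteq> 1\<close> show False by simp
    qed
    have "(z * x) ^ k = 1 \<longleftrightarrow> p * d dvd k" for k
    proof
      assume k: "(z * x) ^ k = 1"
      have "x ^ (k * p) = (z ^ p) ^ k * x ^ (k * p)" by (simp add: zp)
      also have "\<dots> = ((z * x) ^ k) ^ p"
        by (simp add: power_mult_distrib power_mult[symmetric] mult.commute)
      also have "\<dots> = 1" by (simp add: k)
      finally have "d dvd k * p" by (simp add: x)
      moreover have "coprime d p" using prime_imp_coprime[OF p(1) False] by (simp add: coprime_commute)
      ultimately have dk: "d dvd k" by (simp add: coprime_dvd_mult_left_iff)
      then have "x ^ k = 1" using x by simp
      with k have "z ^ k = 1" by (simp add: power_mult_distrib)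
      from zk[OF this] dk \<open>coprime d p\<close> show "p * d dvd k" using divides_mult[of p k d] by (simp add: coprime_commute)
    next
      assume "p * d dvd k"
      then have "p dvd k" "d dvd k" using dvd_mult_left dvd_mult_right by blast+
      then obtain j where "k = p * j" by blast
      with zp have "z ^ k = 1" by (simp add: power_mult)
      moreover have "x ^ k = 1" using x \<open>d dvd k\<close> by simp
      ultimately show "(z * x) ^ k = 1" by (simp add: power_mult_distrib)
    qed
    then show ?thesis unfolding exact_order_def by blast
  qed
qed simp

text \<open>The \<open>d\<close> distinct powers of \<open>x\<close> already exhaust the at most
  \<open>d\<close> roots of \<open>X^d - 1\<close>.\<close>

lemma exact_order_generates:
  fixes x y :: "'k::field_char_0"
  assumes d: "d > 0" and x: "exact_order x d" and y: "y ^ d = 1"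
  shows "\<exists>a<d. y = x ^ a"
proof -
  have x0: "x \<noteq> 0" using x d unfolding exact_order_def by (metis dvd_refl power_0_left zero_neq_one not_gr0)
  have inj: "inj_on (\<lambda>a. x ^ a) {..<d}"
  proof (rule linorder_inj_onI)
    fix a b assume ab: "a < b" "a \<in> {..<d}" "b \<in> {..<d}"
    show "x ^ a \<noteq> x ^ b"
    proof
      assume eq: "x ^ a = x ^ b"
      have "x ^ b = x ^ a * x ^ (b - a)" using ab by (simp flip: power_add)
      with eq x0 have "x ^ (b - a) = 1" by simp
      then have "d dvd b - a" using x by (simp add: exact_order_def)
      with ab show False using dvd_imp_le[of d "b - a"] by auto
    qed
  qed auto
  let ?p = "monom 1 d - 1 :: 'k poly"
  have p0: "?p \<noteq> 0"
  proof
    assume "?p = 0"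
    then have "coeff ?p d = 0" by simp
    with d show False by (simp add: coeff_diff)
  qed
  have deg: "degree ?p \<le> d" by (intro degree_diff_le degree_monom_le) simp
  have roots: "{z. poly ?p z = 0} = {z. z ^ d = 1}" by (auto simp: poly_monom)
  have fin: "finite {z :: 'k. z ^ d = 1}" using poly_roots_finite[OF p0] unfolding roots .
  have "card {z :: 'k. z ^ d = 1} \<le> d" using card_poly_roots_bound[OF p0] deg unfolding roots by simp
  moreover have "(\<lambda>a. x ^ a) ` {..<d} \<subseteq> {z. z ^ d = 1}"
  proof
    fix z assume "z \<in> (\<lambda>a. x ^ a) ` {..<d}"
    then obtain a where "z = x ^ a" by blast
    then have "z ^ d = (x ^ d) ^ a" by (simp add: power_mult[symmetric] mult.commute)
    also have "x ^ d = 1" using x by (simp add: exact_order_def)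
    finally show "z \<in> {z. z ^ d = 1}" by simp
  qed
  moreover have "card ((\<lambda>a. x ^ a) ` {..<d}) = d" using card_image[OF inj] by simp
  ultimately have "(\<lambda>a. x ^ a) ` {..<d} = {z. z ^ d = 1}" using card_subset_eq[OF fin] card_mono[OF fin] by (metis le_antisym)
  with y show ?thesis by blast
qed

section \<open>Torsion elements of the multiplicative group\<close>

definition torsion :: "'a::monoid_mult \<Rightarrow> bool" where
  "torsion x \<longleftrightarrow> (\<exists>k>0. x ^ k = 1)"

lemma torsion_1 [simp]: "torsion 1" by (auto simp: torsion_def)

lemma torsion_mult: "torsion x \<Longrightarrow> torsion y \<Longrightarrow> torsion (x * y)" for x y :: "'a::comm_monoid_mult"
proof -
  assume "torsion x" "torsion y"
  then obtain k l where *: "k > 0" "x ^ k = 1" "l > 0" "y ^ l = 1" by (auto simp: torsion_def)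
  have "(x * y) ^ (k * l) = (x ^ k) ^ l * (y ^ l) ^ k"
    by (simp add: power_mult_distrib power_mult[symmetric] mult.commute)
  with * show ?thesis unfolding torsion_def by (intro exI[of _ "k * l"]) simp
qed

lemma torsion_inverse: "torsion x \<Longrightarrow> torsion (inverse x)" for x :: "'a::field"
  unfolding torsion_def by (metis inverse_1 power_inverse)

lemma torsion_power: "torsion x \<Longrightarrow> torsion (x ^ k)" for x :: "'a::comm_monoid_mult"
  by (induction k) (simp_all add: torsion_mult)

lemma torsion_powi: "torsion x \<Longrightarrow> torsion (x powi k)" for x :: "'a::field"
  by (auto simp: power_int_def torsion_power torsion_inverse)

lemma torsion_prod: "(\<And>i. i \<in> A \<Longrightarrow> torsion (f i)) \<Longrightarrow> torsion (prod f A)" for f :: "'b \<Rightarrow> 'a::comm_monoid_mult"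
  by (induction A rule: infinite_finite_induct) (simp_all add: torsion_mult)

text \<open>A root of unity whose order is a common multiple of exponents killing the given elements
  generates all of them.\<close>

lemma finitely_many_torsion_cyclic:
  fixes f :: "nat \<Rightarrow> 'k::{alg_closed_field, field_char_0}"
  assumes "finite A" "\<And>i. i \<in> A \<Longrightarrow> torsion (f i)"
  shows "\<exists>\<omega> a. \<omega> \<noteq> 0 \<and> torsion \<omega> \<and> (\<forall>i\<in>A. f i = \<omega> ^ a i)"
proof -
  have "\<forall>i\<in>A. \<exists>k>0. f i ^ k = 1" using assms(2) by (simp add: torsion_def)
  then obtain k where k: "\<And>i. i \<in> A \<Longrightarrow> k i > 0 \<and> f i ^ k i = 1" by metis
  define d where "d = prod k A"
  have d: "d > 0" using k by (auto simp: d_def intro: prod_pos)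
  obtain \<omega> :: 'k where \<omega>: "exact_order \<omega> d" using exists_exact_order[OF d] by blast
  have "\<exists>a. f i = \<omega> ^ a" if i: "i \<in> A" for i
  proof -
    have "k i dvd d" unfolding d_def using assms(1) i by (rule dvd_prodI)
    then have "f i ^ d = 1" using k[OF i] by (auto simp: power_mult elim!: dvdE)
    with exact_order_generates[OF d \<omega>] show ?thesis by blast
  qed
  then obtain a where "\<forall>i\<in>A. f i = \<omega> ^ a i" by metis
  moreover have "\<omega> \<noteq> 0" using \<omega> d unfolding exact_order_def by (metis dvd_refl power_0_left zero_neq_one not_gr0)
  moreover have "\<omega> ^ d = 1" using \<omega> by (simp add: exact_order_def)
  then have "torsion \<omega>" using d unfolding torsion_def by blast
  ultimately show ?thesis by blast
qed

section \<open>Orbits of monomial substitutions\<close>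

abbreviation nonzero :: "nat \<Rightarrow> (nat \<Rightarrow> 'a::zero) \<Rightarrow> bool" where
  "nonzero m \<mu> \<equiv> \<forall>i<m. \<mu> i \<noteq> 0"

text \<open>The orbit relation of \<open>torus_act\<close>, with tuples as functions so that
  elementary row operations are function updates.\<close>

definition mono_equiv :: "nat \<Rightarrow> (nat \<Rightarrow> 'a::field) \<Rightarrow> (nat \<Rightarrow> 'a) \<Rightarrow> bool" where
  "mono_equiv m \<mu> \<mu>' \<longleftrightarrow> (\<exists>A\<in>GL m. \<forall>i<m. \<mu>' i = laurent m \<mu> (\<lambda>j. A $$ (i, j)))"

section \<open>Laurent monomials and integer row operations\<close>

lemma laurent_nonzero: "nonzero m \<mu> \<Longrightarrow> laurent m \<mu> e \<noteq> 0"
  by (simp add: laurent_def)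

lemma laurent_cong: "(\<And>i. i < m \<Longrightarrow> \<mu> i = \<mu>' i) \<Longrightarrow> (\<And>i. i < m \<Longrightarrow> e i = e' i) \<Longrightarrow> laurent m \<mu> e = laurent m \<mu>' e'"
  by (simp add: laurent_def)

lemma laurent_unit: "i < m \<Longrightarrow> laurent m \<mu> (\<lambda>j. if j = i then k else 0) = \<mu> i powi k"
  by (simp add: laurent_def if_distrib[of "\<lambda>x. _ powi x"] cong: if_cong)

lemma laurent_add: "nonzero m \<mu> \<Longrightarrow> laurent m \<mu> (\<lambda>i. e i + f i) = laurent m \<mu> e * laurent m \<mu> f"
  unfolding laurent_def prod.distrib[symmetric] by (intro prod.cong) (auto simp: power_int_add)

lemma laurent_scale: "laurent m \<mu> (\<lambda>i. k * e i) = laurent m \<mu> e powi k"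
proof -
  have "prod f A powi k = (\<Prod>i\<in>A. f i powi k)" for f :: "nat \<Rightarrow> 'a" and A
    by (induction A rule: infinite_finite_induct) (simp_all add: power_int_mult_distrib)
  moreover have "\<mu> i powi (k * e i) = (\<mu> i powi e i) powi k" for i by (simp add: power_int_mult[symmetric] mult.commute)
  ultimately show ?thesis by (simp add: laurent_def)
qed

lemma laurent_sum: "nonzero m \<mu> \<Longrightarrow> finite S \<Longrightarrow> laurent m \<mu> (\<lambda>i. \<Sum>j\<in>S. e j i) = (\<Prod>j\<in>S. laurent m \<mu> (e j))"
proof -
  assume \<mu>: "nonzero m \<mu>" and "finite S"
  from this(2) show ?thesis
    by (induction S rule: finite_induct) (simp_all add: laurent_add[OF \<mu>], simp add: laurent_def)
qed

lemma laurent_mult: "laurent m (\<lambda>i. \<mu> i * \<nu> i) e = laurent m \<mu> e * laurent m \<nu> e"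
  by (simp add: laurent_def power_int_mult_distrib prod.distrib)

lemma laurent_laurent:
  assumes "nonzero m \<mu>"
  shows "laurent k (\<lambda>j. laurent m \<mu> (A j)) e = laurent m \<mu> (\<lambda>l. \<Sum>j<k. e j * A j l)"
  using assms by (simp add: laurent_sum laurent_scale) (simp add: laurent_def)

lemma laurent_torsion: "(\<And>i. i < m \<Longrightarrow> torsion (\<mu> i)) \<Longrightarrow> torsion (laurent m \<mu> e)"
  unfolding laurent_def by (intro torsion_prod torsion_powi) auto

lemma mono_equivI:
  assumes "\<And>i k. i < m \<Longrightarrow> k < m \<Longrightarrow> (\<Sum>j<m. A i j * B j k) = (if i = k then 1 else 0)"
    and "\<And>i k. i < m \<Longrightarrow> k < m \<Longrightarrow> (\<Sum>j<m. B i j * A j k) = (if i = k then 1 else 0)"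
    and "\<And>i. i < m \<Longrightarrow> \<mu>' i = laurent m \<mu> (A i)"
  shows "mono_equiv m \<mu> \<mu>'"
proof -
  let ?A = "mat m m (\<lambda>(i, j). A i j)" and ?B = "mat m m (\<lambda>(i, j). B i j)"
  have "?A * ?B = 1\<^sub>m m" "?B * ?A = 1\<^sub>m m"
    by (intro eq_matI; simp add: scalar_prod_def atLeast0LessThan assms(1,2))+
  then have "?A \<in> GL m" by (intro GLI[of _ _ ?B]) auto
  moreover have "\<forall>i<m. \<mu>' i = laurent m \<mu> (\<lambda>j. ?A $$ (i, j))"
    using assms(3) by (auto intro: laurent_cong)
  ultimately show ?thesis unfolding mono_equiv_def by blast
qed

lemma mono_equivE:
  assumes "mono_equiv m \<mu> \<mu>'"
  obtains A B where
    "\<And>i k. i < m \<Longrightarrow> k < m \<Longrightarrow> (\<Sum>j<m. A i j * B j k) = (if i = k then 1 else (0::int))"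
    "\<And>i k. i < m \<Longrightarrow> k < m \<Longrightarrow> (\<Sum>j<m. B i j * A j k) = (if i = k then 1 else (0::int))"
    "\<And>i. i < m \<Longrightarrow> \<mu>' i = laurent m \<mu> (A i)"
proof -
  obtain A where A: "A \<in> GL m" "\<forall>i<m. \<mu>' i = laurent m \<mu> (\<lambda>j. A $$ (i, j))"
    using assms unfolding mono_equiv_def by blast
  obtain B where B: "B \<in> GL m" "A * B = 1\<^sub>m m" "B * A = 1\<^sub>m m" using GL_inverse[OF A(1)] .
  note c = GL_carrier[OF A(1)] GL_carrier[OF B(1)]
  have "(\<Sum>j<m. A $$ (i, j) * B $$ (j, k)) = (if i = k then 1 else 0)"
    "(\<Sum>j<m. B $$ (i, j) * A $$ (j, k)) = (if i = k then 1 else 0)" if "i < m" "k < m" for i k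
    using arg_cong[OF B(2), of "\<lambda>M. M $$ (i, k)"] arg_cong[OF B(3), of "\<lambda>M. M $$ (i, k)"] that c
    by (simp_all add: scalar_prod_def atLeast0LessThan)
  with A(2) show thesis by (intro that[of "\<lambda>i j. A $$ (i, j)" "\<lambda>i j. B $$ (i, j)"]) auto
qed

lemma mono_equiv_nonzero: "mono_equiv m \<mu> \<mu>' \<Longrightarrow> nonzero m \<mu> \<Longrightarrow> nonzero m \<mu>'"
  unfolding mono_equiv_def by (metis laurent_nonzero)

lemma mono_equiv_cong:
  assumes "\<And>i. i < m \<Longrightarrow> \<mu> i = \<mu>' i"
  shows "mono_equiv m \<mu> \<mu>'"
proof (rule mono_equivI[where A = "\<lambda>i j. if j = i then 1 else 0" and B = "\<lambda>i j. if j = i then 1 else 0"])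
  fix i assume "i < m"
  then show "\<mu>' i = laurent m \<mu> (\<lambda>j. if j = i then 1 else 0)" using assms by (simp add: laurent_unit)
qed (auto simp: if_distrib[of "\<lambda>x. x * _"] cong: if_cong)

lemma mono_equiv_sym:
  assumes "nonzero m \<mu>" "mono_equiv m \<mu> \<mu>'"
  shows "mono_equiv m \<mu>' \<mu>"
proof -
  from assms(2) obtain A B where AB:
    "\<And>i k. i < m \<Longrightarrow> k < m \<Longrightarrow> (\<Sum>j<m. A i j * B j k) = (if i = k then 1 else (0::int))"
    "\<And>i k. i < m \<Longrightarrow> k < m \<Longrightarrow> (\<Sum>j<m. B i j * A j k) = (if i = k then 1 else (0::int))"
    "\<And>i. i < m \<Longrightarrow> \<mu>' i = laurent m \<mu> (A i)" by (rule mono_equivE) blast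
  show ?thesis
  proof (rule mono_equivI[OF AB(2,1)])
    fix i assume i: "i < m"
    have "laurent m \<mu>' (B i) = laurent m (\<lambda>j. laurent m \<mu> (A j)) (B i)"
      by (rule laurent_cong) (use AB(3) in auto)
    also have "\<dots> = laurent m \<mu> (\<lambda>k. if k = i then 1 else 0)"
      unfolding laurent_laurent[OF assms(1)] by (rule laurent_cong) (use AB(2) i in auto)
    finally show "\<mu> i = laurent m \<mu>' (B i)" using i by (simp add: laurent_unit)
  qed
qed

lemma mono_equiv_trans:
  assumes \<mu>: "nonzero m \<mu>" and "mono_equiv m \<mu> \<mu>'" "mono_equiv m \<mu>' \<mu>''"
  shows "mono_equiv m \<mu> \<mu>''"
proof -
  obtain A where A: "A \<in> GL m" "\<forall>i<m. \<mu>' i = laurent m \<mu> (\<lambda>j. A $$ (i, j))"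
    using assms(2) unfolding mono_equiv_def by blast
  obtain B where B: "B \<in> GL m" "\<forall>i<m. \<mu>'' i = laurent m \<mu>' (\<lambda>j. B $$ (i, j))"
    using assms(3) unfolding mono_equiv_def by blast
  have "\<mu>'' i = laurent m \<mu> (\<lambda>j. (B * A) $$ (i, j))" if i: "i < m" for i
  proof -
    have "\<mu>'' i = laurent m (\<lambda>j. laurent m \<mu> (\<lambda>k. A $$ (j, k))) (\<lambda>j. B $$ (i, j))"
      using B(2) i A(2) by (auto intro: laurent_cong)
    also have "\<dots> = laurent m \<mu> (\<lambda>j. (B * A) $$ (i, j))"
      unfolding laurent_laurent[OF \<mu>]
      by (rule laurent_cong) (use i GL_carrier[OF A(1)] GL_carrier[OF B(1)] in \<open>auto simp: scalar_prod_def atLeast0LessThan\<close>)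
    finally show ?thesis .
  qed
  with GL_mult[OF B(1) A(1)] show ?thesis unfolding mono_equiv_def by blast
qed

text \<open>The unipotent matrix with an arbitrary last nontrivial column \<open>r\<close>.\<close>

lemma mono_equiv_shear:
  assumes \<mu>: "nonzero m \<mu>" and r: "r < m" "k r = 0"
  shows "mono_equiv m \<mu> (\<lambda>i. \<mu> i * \<mu> r powi k i)"
proof -
  let ?A = "\<lambda>k i j. (if j = i then 1 else 0) + (if j = r then k i else (0::int))"
  have inv: "(\<Sum>j<m. ?A k i j * ?A l j n) = (if i = n then 1 else 0)"
    if "i < m" "n < m" "k r = 0" "l r = 0" "\<And>i. l i = - k i" for i n k l
  proof -
    have "(\<Sum>j<m. ?A k i j * ?A l j n) = (\<Sum>j<m. if j = i then ?A l j n else 0) + (\<Sum>j<m. if j = r then k i * ?A l j n else 0)"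
      unfolding sum.distrib[symmetric] by (intro sum.cong) (auto simp: algebra_simps)
    also have "\<dots> = ?A l i n + k i * ?A l r n" using that r by simp
    finally show ?thesis using that by auto
  qed
  show ?thesis
  proof (rule mono_equivI[of m "?A k" "?A (\<lambda>i. - k i)"])
    fix i assume i: "i < m"
    show "\<mu> i * \<mu> r powi k i = laurent m \<mu> (?A k i)"
      using i r by (simp add: laurent_add[OF \<mu>] laurent_unit)
  qed (rule inv; use r in simp)+
qed

lemma mono_equiv_elementary:
  assumes \<mu>: "nonzero m \<mu>" and ij: "i < m" "j < m" "i \<noteq> j"
  shows "mono_equiv m \<mu> (\<mu>(i := \<mu> i * \<mu> j powi k))"
  using mono_equiv_shear[OF \<mu> ij(2), of "\<lambda>l. if l = i then k else 0"] ij(3)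
  by (auto simp: fun_upd_def if_distrib[of "\<lambda>x. _ powi x"] if_distrib[of "\<lambda>x. _ * x"] cong: if_cong)

lemma mono_equiv_swap:
  assumes \<mu>: "nonzero m \<mu>" and ij: "i < m" "j < m"
  shows "mono_equiv m \<mu> (\<lambda>l. \<mu> (Transposition.transpose i j l))"
proof -
  let ?t = "Transposition.transpose i j"
  have t: "?t l < m" if "l < m" for l using that ij by (auto simp: Transposition.transpose_def)
  have s: "(\<Sum>l<m. (if l = ?t a then 1 else 0) * (if b = ?t l then 1 else 0)) = (if a = b then 1 else (0::int))"
    if "a < m" "b < m" for a b
  proof -
    have "(\<Sum>l<m. (if l = ?t a then 1 else 0) * (if b = ?t l then 1 else 0)) = (\<Sum>l<m. if l = ?t a then if b = ?t l then 1 else 0 else (0::int))"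
      by (rule sum.cong) auto
    also have "\<dots> = (if a = b then 1 else 0)" using t[OF that(1)] by simp
    finally show ?thesis .
  qed
  show ?thesis
  proof (rule mono_equivI[OF s s])
    fix l assume "l < m"
    then show "\<mu> (?t l) = laurent m \<mu> (\<lambda>a. if a = ?t l then 1 else 0)" using t by (simp add: laurent_unit)
  qed
qed

lemma mono_equiv_invert:
  assumes \<mu>: "nonzero m \<mu>" and i: "i < m"
  shows "mono_equiv m \<mu> (\<mu>(i := inverse (\<mu> i)))"
proof (rule mono_equivI[where A = "\<lambda>a b. if b = a then if a = i then -1 else 1 else 0" and B = "\<lambda>a b. if b = a then if a = i then -1 else 1 else 0"])
  fix a b :: nat assume "a < m" "b < m"
  have "(\<Sum>j<m. (if j = a then if a = i then -1 else 1 else 0) * (if b = j then if j = i then -1 else 1 else 0)) =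
    (\<Sum>j<m. if j = a then if a = b then 1 else 0 else (0::int))" by (rule sum.cong) auto
  then show "(\<Sum>j<m. (if j = a then if a = i then -1 else 1 else 0) * (if b = j then if j = i then -1 else 1 else 0)) = (if a = b then 1 else (0::int))"
    using \<open>a < m\<close> by simp
  then show "(\<Sum>j<m. (if j = a then if a = i then -1 else 1 else 0) * (if b = j then if j = i then -1 else 1 else 0)) = (if a = b then 1 else (0::int))" .
next
  fix a assume "a < m"
  then show "(\<mu>(i := inverse (\<mu> i))) a = laurent m \<mu> (\<lambda>b. if b = a then if a = i then -1 else 1 else 0)"
    by (auto simp: laurent_unit power_int_minus)
qed

lemma mono_equiv_block:
  assumes \<mu>: "nonzero m \<mu>" and r: "r \<le> m"
    and AB: "\<And>i k. i < r \<Longrightarrow> k < r \<Longrightarrow> (\<Sum>j<r. A i j * B j k) = (if i = k then 1 else 0)"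
    and BA: "\<And>i k. i < r \<Longrightarrow> k < r \<Longrightarrow> (\<Sum>j<r. B i j * A j k) = (if i = k then 1 else 0)"
  shows "mono_equiv m \<mu> (\<lambda>i. if i < r then laurent r \<mu> (A i) else \<mu> i)"
proof -
  let ?E = "\<lambda>A i j. if i < r then if j < r then A i j else 0 else if j = i then 1 else (0::int)"
  have E: "(\<Sum>j<m. ?E A i j * ?E B j k) = (if i = k then 1 else 0)"
    if ik: "i < m" "k < m" and AB: "\<And>i k. i < r \<Longrightarrow> k < r \<Longrightarrow> (\<Sum>j<r. A i j * B j k) = (if i = k then 1 else 0)" for A B i k
  proof (cases "i < r")
    case True
    have "(\<Sum>j<m. ?E A i j * ?E B j k) = (\<Sum>j<r. ?E A i j * ?E B j k)"
      by (rule sum.mono_neutral_right) (use r True in auto)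
    also have "\<dots> = (if k < r then \<Sum>j<r. A i j * B j k else 0)" using True by (auto intro: sum.cong)
    finally show ?thesis using AB[OF True, of k] True by auto
  next
    case False
    then have "(\<Sum>j<m. ?E A i j * ?E B j k) = (\<Sum>j<m. if j = i then ?E B j k else 0)" by (intro sum.cong) auto
    then show ?thesis using False ik by auto
  qed
  show ?thesis
  proof (rule mono_equivI[of m "?E A" "?E B"])
    fix i assume i: "i < m"
    show "(if i < r then laurent r \<mu> (A i) else \<mu> i) = laurent m \<mu> (?E A i)"
    proof (cases "i < r")
      case True
      have "laurent m \<mu> (?E A i) = (\<Prod>j<r. \<mu> j powi ?E A i j)"
        unfolding laurent_def by (rule prod.mono_neutral_right) (use r True in auto)
      with True show ?thesis by (simp add: laurent_def)
    next
      case False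
      then have "laurent m \<mu> (?E A i) = laurent m \<mu> (\<lambda>j. if j = i then 1 else 0)" by simp
      with False i show ?thesis by (simp add: laurent_unit)
    qed
  qed (rule E; use AB BA in blast)+
qed

text \<open>Independence modulo torsion. In this form relations that hold only up to a root of unity
  can be used directly; \<open>mult_indepI\<close> derives it from ordinary multiplicative
  independence.\<close>

definition mult_indep :: "nat \<Rightarrow> (nat \<Rightarrow> 'a::field) \<Rightarrow> bool" where
  "mult_indep r \<mu> \<longleftrightarrow> (\<forall>e. torsion (laurent r \<mu> e) \<longrightarrow> (\<forall>i<r. e i = 0))"

text \<open>If the \<open>k\<close>-th power of a monomial is 1, multiplying its exponents by
  \<open>k\<close> gives an exact relation.\<close>

lemma mult_indepI:
  assumes "\<And>e. laurent r \<mu> e = 1 \<Longrightarrow> \<forall>i<r. e i = 0"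
  shows "mult_indep r \<mu>"
  unfolding mult_indep_def
proof (intro allI impI)
  fix e i assume "torsion (laurent r \<mu> e)" "i < r"
  then obtain k where k: "k > 0" "laurent r \<mu> e ^ k = 1" by (auto simp: torsion_def)
  then have "laurent r \<mu> (\<lambda>i. int k * e i) = 1" by (simp add: laurent_scale)
  from assms[OF this] k(1) \<open>i < r\<close> show "e i = 0" by simp
qed

text \<open>Euclid's algorithm on a multiplicative relation: as long as two exponents are nonzero, a
  transvection shortens the relation.\<close>

lemma relation_gives_torsion:
  fixes \<mu> :: "nat \<Rightarrow> 'k::field"
  assumes \<mu>: "nonzero m \<mu>" and r: "r \<le> m" and t: "\<And>i. r \<le> i \<Longrightarrow> i < m \<Longrightarrow> torsion (\<mu> i)"
    and e: "laurent r \<mu> e = 1" "\<exists>i<r. e i \<noteq> 0"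
  shows "\<exists>\<beta>. mono_equiv m \<mu> \<beta> \<and> (\<exists>i<r. torsion (\<beta> i)) \<and> (\<forall>i. r \<le> i \<longrightarrow> i < m \<longrightarrow> torsion (\<beta> i))"
  using assms
proof (induction "\<Sum>i<r. nat \<bar>e i\<bar>" arbitrary: \<mu> e rule: less_induct)
  case less
  obtain i where i: "i < r" "e i \<noteq> 0" using less.prems(5) by blast
  show ?case
  proof (cases "\<exists>j<r. j \<noteq> i \<and> e j \<noteq> 0")
    case False
    then have "laurent r \<mu> e = laurent r \<mu> (\<lambda>j. if j = i then e i else 0)" by (intro laurent_cong) auto
    then have eq: "\<mu> i powi e i = 1" using less.prems(4) i by (simp add: laurent_unit)
    have "torsion (\<mu> i)"
    proof -
      have "\<mu> i ^ nat \<bar>e i\<bar> = 1"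
        using eq by (cases "e i \<ge> 0") (auto simp: power_int_def power_inverse inverse_eq_1_iff)
      then show ?thesis using i(2) unfolding torsion_def by (intro exI[of _ "nat \<bar>e i\<bar>"]) simp
    qed
    then show ?thesis using mono_equiv_cong[of m \<mu> \<mu>] i(1) less.prems(3) by (intro exI[of _ \<mu>]) auto
  next
    case True
    then obtain j where j: "j < r" "j \<noteq> i" "e j \<noteq> 0" by blast
    have main: ?thesis if ij: "i < r" "j < r" "i \<noteq> j" "e i \<noteq> 0" "e j \<noteq> 0" "\<bar>e j\<bar> \<le> \<bar>e i\<bar>" for i j
    proof -
      \<comment> \<open>The sign makes \<open>\<bar>e i - s * e j\<bar>\<close> equal to the
        difference of the absolute values. Replacing \<open>\<mu> j\<close> by
        \<open>\<mu> j * \<mu> i powi s\<close> compensates the changed exponent, so the relation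
        persists.\<close>
      define s where "s = sgn (e i) * sgn (e j)"
      let ?\<mu> = "\<mu>(j := \<mu> j * \<mu> i powi s)" and ?e = "e(i := e i - s * e j)"
      have ijm: "i < m" "j < m" using ij less.prems(2) by auto
      have eq: "mono_equiv m \<mu> ?\<mu>" by (rule mono_equiv_elementary[OF less.prems(1) ijm(2,1)]) (use ij in simp)
      have lt: "\<bar>e i - s * e j\<bar> < \<bar>e i\<bar>"
        using ij(4-6) by (auto simp: s_def sgn_if abs_if split: if_splits)
      have "(\<Sum>l<r. nat \<bar>?e l\<bar>) < (\<Sum>l<r. nat \<bar>e l\<bar>)"
        by (rule sum_strict_mono_ex1) (use ij lt in auto)
      moreover have "nonzero m ?\<mu>" by (rule mono_equiv_nonzero[OF eq less.prems(1)])
      moreover have "torsion (?\<mu> l)" if "r \<le> l" "l < m" for l using less.prems(3)[OF that] that ij by auto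
      moreover have "laurent r ?\<mu> ?e = 1"
      proof -
        have nz: "nonzero r \<mu>" "nonzero r ?\<mu>"
          using less.prems(1,2) mono_equiv_nonzero[OF eq less.prems(1)] by (meson less_le_trans)+
        have "laurent r ?\<mu> ?e = laurent r (\<lambda>l. \<mu> l * (if l = j then \<mu> i powi s else 1)) ?e"
          by (rule laurent_cong) auto
        also have "\<dots> = laurent r \<mu> ?e * laurent r (\<lambda>l. if l = j then \<mu> i powi s else 1) ?e" by (rule laurent_mult)
        also have "laurent r (\<lambda>l. if l = j then \<mu> i powi s else 1) ?e = (\<Prod>l<r. if l = j then (\<mu> i powi s) powi e j else 1)"
          unfolding laurent_def by (rule prod.cong) (use ij in auto)
        also have "\<dots> = \<mu> i powi (s * e j)" using ij by (simp add: power_int_mult)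
        also have "laurent r \<mu> ?e = laurent r \<mu> (\<lambda>l. e l + (if l = i then - (s * e j) else 0))"
          by (rule laurent_cong) auto
        also have "\<dots> = laurent r \<mu> e * \<mu> i powi (- (s * e j))"
          using ij by (simp add: laurent_add[OF nz(1)] laurent_unit)
        finally show ?thesis using less.prems(4) nz(1) ij by (simp add: power_int_minus del: fun_upd_apply)
      qed
      moreover have "\<exists>l<r. ?e l \<noteq> 0" using ij by (intro exI[of _ j]) auto
      ultimately obtain \<beta> where \<beta>: "mono_equiv m ?\<mu> \<beta>" "\<exists>i<r. torsion (\<beta> i)" "\<forall>i. r \<le> i \<longrightarrow> i < m \<longrightarrow> torsion (\<beta> i)"
        using less.hyps[of ?e ?\<mu>] less.prems(2) by blast
      with mono_equiv_trans[OF less.prems(1) eq \<beta>(1)] show ?thesis by blast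
    qed
    show ?thesis
    proof (cases "\<bar>e j\<bar> \<le> \<bar>e i\<bar>")
      case True
      from main[OF i(1) j(1) j(2)[symmetric] i(2) j(3) True] show ?thesis .
    next
      case False
      from main[OF j(1) i(1) j(2) j(3) i(2)] False show ?thesis by simp
    qed
  qed
qed

text \<open>The subtractive Euclidean algorithm on the exponents of a common base leaves at most one
  nontrivial coordinate, which a swap brings to position \<open>r\<close>. The coordinates below
  \<open>r\<close> are never touched.\<close>

lemma collect_powers:
  fixes \<mu> :: "nat \<Rightarrow> 'k::field"
  assumes \<mu>: "nonzero m \<mu>" and r: "r < m" and a: "\<And>i. r \<le> i \<Longrightarrow> i < m \<Longrightarrow> \<mu> i = \<omega> ^ a i" and w: "\<omega> \<noteq> 0"
  shows "\<exists>\<beta> k. mono_equiv m \<mu> \<beta> \<and> (\<forall>i<r. \<beta> i = \<mu> i) \<and> \<beta> r = \<omega> ^ k \<and> (\<forall>i. r < i \<longrightarrow> i < m \<longrightarrow> \<beta> i = 1)"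
  using \<mu> a
proof (induction "sum a {r..<m}" arbitrary: \<mu> a rule: less_induct)
  case less
  show ?case
  proof (cases "\<exists>i j. r \<le> i \<and> i < m \<and> r \<le> j \<and> j < m \<and> i \<noteq> j \<and> a i \<noteq> 0 \<and> a j \<noteq> 0")
    case True
    then obtain i j where ij: "r \<le> i" "i < m" "r \<le> j" "j < m" "i \<noteq> j" "0 < a j" "a j \<le> a i"
      by (metis linorder_le_cases neq0_conv)
    let ?\<mu> = "\<mu>(i := \<mu> i * \<mu> j powi (-1))" and ?a = "a(i := a i - a j)"
    have eq: "mono_equiv m \<mu> ?\<mu>" by (rule mono_equiv_elementary[OF less.prems(1) ij(2,4,5)])
    have "sum ?a {r..<m} < sum a {r..<m}"
      by (rule sum_strict_mono_ex1) (use ij in auto)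
    moreover have "nonzero m ?\<mu>" by (rule mono_equiv_nonzero[OF eq less.prems(1)])
    moreover have "?\<mu> l = \<omega> ^ ?a l" if "r \<le> l" "l < m" for l
      using less.prems(2) that ij w by (auto simp: power_int_minus power_diff divide_inverse)
    ultimately obtain \<beta> k where \<beta>: "mono_equiv m ?\<mu> \<beta>" "\<forall>i<r. \<beta> i = ?\<mu> i" "\<beta> r = \<omega> ^ k"
      "\<forall>i. r < i \<longrightarrow> i < m \<longrightarrow> \<beta> i = 1"
      using less.hyps[of ?a ?\<mu>] by blast
    have "\<forall>i<r. \<beta> i = \<mu> i" using \<beta>(2) ij(1) by auto
    with \<beta> mono_equiv_trans[OF less.prems(1) eq \<beta>(1)] show ?thesis by blast
  next
    case False
    then obtain i where i: "r \<le> i" "i < m" "\<And>j. r \<le> j \<Longrightarrow> j < m \<Longrightarrow> j \<noteq> i \<Longrightarrow> a j = 0"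
      using r by (metis order_refl)
    let ?\<beta> = "\<lambda>l. \<mu> (Transposition.transpose r i l)"
    have "mono_equiv m \<mu> ?\<beta>" by (rule mono_equiv_swap[OF less.prems(1) r i(2)])
    moreover have "\<forall>l<r. ?\<beta> l = \<mu> l" using i by (auto simp: Transposition.transpose_def)
    moreover have "?\<beta> r = \<omega> ^ a i" using less.prems(2) i by simp
    moreover have "\<forall>l. r < l \<longrightarrow> l < m \<longrightarrow> ?\<beta> l = 1"
    proof (intro allI impI)
      fix l assume l: "r < l" "l < m"
      then have "Transposition.transpose r i l \<noteq> i" "r \<le> Transposition.transpose r i l" "Transposition.transpose r i l < m"
        using r i by (auto simp: Transposition.transpose_def)
      then show "?\<beta> l = 1" using less.prems(2) i(3) by simp
    qed
    ultimately show ?thesis by blast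
  qed
qed

text \<open>\<open>r\<close> is the least number for which some equivalent tuple is torsion from
  position \<open>r\<close> on. A relation among the first \<open>r\<close> entries would produce
  one more torsion entry; swapped to position \<open>r - 1\<close> it contradicts minimality. The
  torsion entries lie in one cyclic group and are collected into a single one.\<close>

lemma mono_normal_form:
  fixes \<mu> :: "nat \<Rightarrow> 'k::{alg_closed_field, field_char_0}"
  assumes \<mu>: "nonzero m \<mu>"
  shows "\<exists>\<beta> r. mono_equiv m \<mu> \<beta> \<and> r \<le> m \<and> mult_indep r \<beta> \<and> (r < m \<longrightarrow> torsion (\<beta> r)) \<and> (\<forall>i. r < i \<longrightarrow> i < m \<longrightarrow> \<beta> i = 1)"
proof -
  define S where "S r \<longleftrightarrow> r \<le> m \<and> (\<exists>\<beta>. mono_equiv m \<mu> \<beta> \<and> (\<forall>i. r \<le> i \<longrightarrow> i < m \<longrightarrow> torsion (\<beta> i)))" for r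
  have "S m" unfolding S_def using mono_equiv_cong[of m \<mu> \<mu>] by auto
  define r where "r = (LEAST r. S r)"
  have r: "S r" unfolding r_def by (rule LeastI[of S, OF \<open>S m\<close>])
  have least: "\<not> S q" if "q < r" for q using not_less_Least[of q S] that by (simp add: r_def)
  from r obtain \<beta> where \<beta>: "r \<le> m" "mono_equiv m \<mu> \<beta>" "\<And>i. r \<le> i \<Longrightarrow> i < m \<Longrightarrow> torsion (\<beta> i)" unfolding S_def by blast
  have \<beta>0: "nonzero m \<beta>" by (rule mono_equiv_nonzero[OF \<beta>(2) \<mu>])
  have indep: "mult_indep r \<beta>"
  proof (rule mult_indepI, rule ccontr)
    fix e assume e: "laurent r \<beta> e = 1" "\<not> (\<forall>i<r. e i = 0)"
    then obtain \<gamma> i where \<gamma>: "mono_equiv m \<beta> \<gamma>" "i < r" "torsion (\<gamma> i)" "\<And>i. r \<le> i \<Longrightarrow> i < m \<Longrightarrow> torsion (\<gamma> i)"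
      using relation_gives_torsion[OF \<beta>0 \<beta>(1) \<beta>(3) e(1)] by blast
    have im: "i < m" "r - 1 < m" using \<gamma>(2) \<beta>(1) by auto
    have \<gamma>0: "nonzero m \<gamma>" by (rule mono_equiv_nonzero[OF \<gamma>(1) \<beta>0])
    let ?\<delta> = "\<lambda>l. \<gamma> (Transposition.transpose i (r - 1) l)"
    have "mono_equiv m \<mu> ?\<delta>"
      by (rule mono_equiv_trans[OF \<mu> mono_equiv_trans[OF \<mu> \<beta>(2) \<gamma>(1)] mono_equiv_swap[OF \<gamma>0 im]])
    moreover have "torsion (?\<delta> l)" if "r - 1 \<le> l" "l < m" for l
      using that \<gamma>(2-4) by (cases "l = r - 1") (auto simp: Transposition.transpose_def)
    ultimately have "S (r - 1)" unfolding S_def using im by auto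
    with least[of "r - 1"] \<gamma>(2) show False by simp
  qed
  show ?thesis
  proof (cases "r < m")
    case False
    with \<beta> indep show ?thesis by (intro exI[of _ \<beta>] exI[of _ r]) auto
  next
    case True
    obtain \<omega> a where w: "\<omega> \<noteq> 0" "\<forall>i\<in>{r..<m}. \<beta> i = \<omega> ^ a i" "torsion \<omega>"
      using finitely_many_torsion_cyclic[of "{r..<m}" \<beta>] \<beta>(3) by auto
    obtain \<gamma> k where \<gamma>: "mono_equiv m \<beta> \<gamma>" "\<forall>i<r. \<gamma> i = \<beta> i" "\<gamma> r = \<omega> ^ k" "\<forall>i. r < i \<longrightarrow> i < m \<longrightarrow> \<gamma> i = 1"
      using collect_powers[OF \<beta>0 True _ w(1), of a] w(2) by auto
    have "torsion (\<gamma> r)" unfolding \<gamma>(3) by (rule torsion_power[OF w(3)])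
    moreover have "mult_indep r \<gamma>"
      using indep laurent_cong[of r \<gamma> \<beta>] \<gamma>(2) unfolding mult_indep_def by metis
    ultimately show ?thesis using mono_equiv_trans[OF \<mu> \<beta>(2) \<gamma>(1)] \<gamma>(4) \<beta>(1) by blast
  qed
qed

text \<open>In the two coordinates concerned: from \<open>(b, 1)\<close> to \<open>(b, z)\<close>
  since \<open>z\<close> is a power of \<open>b\<close>, then to \<open>(1, z)\<close> since
  \<open>b\<close> is a power of \<open>z\<close>, then swapped to \<open>(z, 1)\<close>. The spare
  coordinate 1 is what makes room.\<close>

lemma mono_equiv_replace_generator:
  fixes \<beta> :: "nat \<Rightarrow> 'k::field"
  assumes \<beta>: "nonzero m \<beta>" and r: "Suc r < m" "\<beta> (Suc r) = 1" and z: "z = \<beta> r powi k" "\<beta> r = z powi l"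
  shows "mono_equiv m \<beta> (\<beta>(r := z))"
proof -
  let ?\<beta>1 = "\<beta>(Suc r := \<beta> (Suc r) * \<beta> r powi k)"
  have 1: "mono_equiv m \<beta> ?\<beta>1" by (rule mono_equiv_elementary) (use \<beta> r in auto)
  have nz1: "nonzero m ?\<beta>1" by (rule mono_equiv_nonzero[OF 1 \<beta>])
  have 2: "mono_equiv m ?\<beta>1 (?\<beta>1(r := ?\<beta>1 r * ?\<beta>1 (Suc r) powi (- l)))"
    by (rule mono_equiv_elementary[OF nz1]) (use r in auto)
  have "?\<beta>1(r := ?\<beta>1 r * ?\<beta>1 (Suc r) powi (- l)) = \<beta>(r := 1, Suc r := z)"
  proof -
    have "\<beta> r \<noteq> 0" using \<beta> r(1) by auto
    then have "\<beta> r * z powi (- l) = 1" using z(2) by (simp add: power_int_minus)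
    then show ?thesis using r(2) z(1) by (auto simp: fun_eq_iff)
  qed
  with 2 have 2: "mono_equiv m ?\<beta>1 (\<beta>(r := 1, Suc r := z))" by simp
  note 12 = mono_equiv_trans[OF \<beta> 1 2]
  have 3: "mono_equiv m (\<beta>(r := 1, Suc r := z)) (\<lambda>i. (\<beta>(r := 1, Suc r := z)) (Transposition.transpose r (Suc r) i))"
    by (rule mono_equiv_swap[OF mono_equiv_nonzero[OF 12 \<beta>]]) (use r in auto)
  have "(\<lambda>i. (\<beta>(r := 1, Suc r := z)) (Transposition.transpose r (Suc r) i)) = \<beta>(r := z)"
    using r(2) by (auto simp: fun_eq_iff Transposition.transpose_def)
  with mono_equiv_trans[OF \<beta> 12 3] show ?thesis by simp
qed

text \<open>Substituting one family of monomial expressions into the other writes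
  \<open>\<gamma>' i\<close> as a monomial in \<open>\<gamma>'\<close> times a torsion element.
  Independence modulo torsion forces the exponents to be those of \<open>\<gamma>' i\<close>
  itself.\<close>

lemma mult_indep_transition:
  fixes \<gamma> \<gamma>' :: "nat \<Rightarrow> 'k::field"
  assumes nz: "nonzero m \<gamma>'" and s: "s \<le> m" "s' \<le> m" and ind: "mult_indep s' \<gamma>'"
    and B: "\<And>i. i < m \<Longrightarrow> \<gamma>' i = laurent s \<gamma> (B i) * t i" "\<And>i. i < m \<Longrightarrow> torsion (t i)"
    and B': "\<And>i. i < m \<Longrightarrow> \<gamma> i = laurent s' \<gamma>' (B' i) * t' i" "\<And>i. i < m \<Longrightarrow> torsion (t' i)"
    and il: "i < s'" "l < s'"
  shows "(\<Sum>j<s. B i j * B' j l) = (if i = l then 1 else 0)"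
proof -
  have nz': "nonzero s' \<gamma>'" using nz s by auto
  have im: "i < m" using il s by simp
  let ?T = "laurent s t' (B i) * t i"
  have "\<gamma>' i = laurent s (\<lambda>j. laurent s' \<gamma>' (B' j) * t' j) (B i) * t i"
    unfolding B(1)[OF im] using B'(1) s(1) by (intro arg_cong2[of _ _ _ _ "(*)"] laurent_cong) auto
  also have "\<dots> = laurent s' \<gamma>' (\<lambda>l. \<Sum>j<s. B i j * B' j l) * ?T"
    by (simp add: laurent_mult laurent_laurent[OF nz'])
  finally have eq: "\<gamma>' i = laurent s' \<gamma>' (\<lambda>l. \<Sum>j<s. B i j * B' j l) * ?T" .
  have "laurent s' \<gamma>' (\<lambda>l. (\<Sum>j<s. B i j * B' j l) - (if l = i then 1 else 0)) =
    laurent s' \<gamma>' (\<lambda>l. \<Sum>j<s. B i j * B' j l) / \<gamma>' i"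
    using nz' il by (subst laurent_diff) (auto simp: laurent_unit)
  also have "\<dots> = inverse ?T"
    using eq nz im by (auto simp: field_simps)
  also have "torsion \<dots>"
    using B(2)[OF im] B'(2) s(1) by (intro torsion_inverse torsion_mult laurent_torsion) auto
  finally have "torsion (laurent s' \<gamma>' (\<lambda>l. (\<Sum>j<s. B i j * B' j l) - (if l = i then 1 else 0)))" .
  with ind il have "(\<Sum>j<s. B i j * B' j l) - (if l = i then 1 else 0) = 0"
    unfolding mult_indep_def by blast
  then show ?thesis by auto
qed

text \<open>Conjugacy is abstracted to a relation \<open>C\<close> of which four properties are
  used, so the combinatorics is carried out once for diagonal and almost-diagonal maps. The property
  \<open>last\<close> is called upon only when no spare coordinate follows the root of
  unity.\<close>

theorem mono_equiv_if_conjugate: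
  fixes \<mu> \<mu>' :: "nat \<Rightarrow> 'k::{alg_closed_field, field_char_0}"
  assumes sym: "\<And>\<mu> \<mu>'. nonzero m \<mu> \<Longrightarrow> nonzero m \<mu>' \<Longrightarrow> C \<mu> \<mu>' \<Longrightarrow> C \<mu>' \<mu>"
    and equiv: "\<And>\<mu> \<mu>' \<beta>. nonzero m \<mu> \<Longrightarrow> nonzero m \<mu>' \<Longrightarrow> C \<mu> \<mu>' \<Longrightarrow> mono_equiv m \<mu> \<beta> \<Longrightarrow> C \<beta> \<mu>'"
    and gen: "\<And>\<mu> \<mu>' i. nonzero m \<mu> \<Longrightarrow> nonzero m \<mu>' \<Longrightarrow> C \<mu> \<mu>' \<Longrightarrow> i < m \<Longrightarrow> \<exists>e. \<mu>' i = laurent m \<mu> e"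
    and last: "\<And>\<mu> \<mu>' r. nonzero m \<mu> \<Longrightarrow> nonzero m \<mu>' \<Longrightarrow> C \<mu> \<mu>' \<Longrightarrow> m = Suc r \<Longrightarrow> mult_indep r \<mu> \<Longrightarrow>
      (\<And>i. i < r \<Longrightarrow> \<mu>' i = \<mu> i) \<Longrightarrow> torsion (\<mu> r) \<Longrightarrow> torsion (\<mu>' r) \<Longrightarrow> \<mu>' r = \<mu> r \<or> \<mu>' r = inverse (\<mu> r)"
    and \<mu>: "nonzero m \<mu>" "nonzero m \<mu>'" and C: "C \<mu> \<mu>'"
  shows "mono_equiv m \<mu> \<mu>'"
proof -
  obtain \<beta> r where \<beta>: "mono_equiv m \<mu> \<beta>" "r \<le> m" "mult_indep r \<beta>" "r < m \<longrightarrow> torsion (\<beta> r)"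
    "\<And>i. r < i \<Longrightarrow> i < m \<Longrightarrow> \<beta> i = 1" using mono_normal_form[OF \<mu>(1)] by blast
  obtain \<beta>' r' where \<beta>': "mono_equiv m \<mu>' \<beta>'" "r' \<le> m" "mult_indep r' \<beta>'" "r' < m \<longrightarrow> torsion (\<beta>' r')"
    "\<And>i. r' < i \<Longrightarrow> i < m \<Longrightarrow> \<beta>' i = 1" using mono_normal_form[OF \<mu>(2)] by blast
  note nz = mono_equiv_nonzero[OF \<beta>(1) \<mu>(1)] mono_equiv_nonzero[OF \<beta>'(1) \<mu>(2)]
  have C1: "C \<beta> \<mu>'" by (rule equiv[OF \<mu> C \<beta>(1)])
  have C2: "C \<beta>' \<beta>" by (rule equiv[OF \<mu>(2) nz(1) sym[OF nz(1) \<mu>(2) C1] \<beta>'(1)])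
  have C3: "C \<beta> \<beta>'" by (rule sym[OF nz(2,1) C2])
  have tors: "torsion (\<beta> i)" if "r \<le> i" "i < m" for i using that \<beta>(4,5) by (cases "i = r") auto
  have tors': "torsion (\<beta>' i)" if "r' \<le> i" "i < m" for i using that \<beta>'(4,5) by (cases "i = r'") auto
  have split: "laurent m \<gamma> e = laurent s \<gamma> e * (\<Prod>i\<in>{s..<m}. \<gamma> i powi e i)" if "s \<le> m" for s e and \<gamma> :: "nat \<Rightarrow> 'k"
    unfolding laurent_def using that
    by (subst prod.union_disjoint[symmetric]) (auto simp: ivl_disj_un lessThan_atLeast0)
  have coords: "\<exists>e t. \<gamma>' i = laurent s \<gamma> e * t \<and> torsion t \<and> (\<exists>k. s < m \<longrightarrow> t = \<gamma> s powi k) \<and> (s = m \<longrightarrow> t = 1)"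
    if "\<gamma>' i = laurent m \<gamma> e" "s \<le> m" "\<And>i. s \<le> i \<Longrightarrow> i < m \<Longrightarrow> torsion (\<gamma> i)" "\<And>i. s < i \<Longrightarrow> i < m \<Longrightarrow> \<gamma> i = 1"
    for \<gamma> \<gamma>' :: "nat \<Rightarrow> 'k" and i e s
  proof -
    let ?t = "\<Prod>i\<in>{s..<m}. \<gamma> i powi e i"
    have "torsion ?t" by (intro torsion_prod torsion_powi that(3)) auto
    moreover have "?t = \<gamma> s powi e s" if "s < m"
    proof -
      have "?t = (\<Prod>i\<in>{s}. \<gamma> i powi e i)"
        by (rule prod.mono_neutral_right) (use \<open>s < m\<close> that(1) \<open>\<And>i. s < i \<Longrightarrow> i < m \<Longrightarrow> \<gamma> i = 1\<close> in auto)
      then show ?thesis by simp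
    qed
    moreover have "s = m \<longrightarrow> ?t = 1" by simp
    moreover have "\<gamma>' i = laurent s \<gamma> e * ?t" unfolding that(1) by (rule split[OF that(2)])
    ultimately show ?thesis by (intro exI[of _ e] exI[of _ ?t] conjI exI[of _ "e s"] impI) auto
  qed
  have "\<exists>e t. \<beta>' i = laurent r \<beta> e * t \<and> torsion t \<and> (\<exists>k. r < m \<longrightarrow> t = \<beta> r powi k) \<and> (r = m \<longrightarrow> t = 1)"
    if i: "i < m" for i
  proof -
    obtain e where "\<beta>' i = laurent m \<beta> e" using gen[OF nz C3 i] by blast
    then show ?thesis by (rule coords) (use \<beta>(2,5) tors in auto)
  qed
  then obtain B t k where B: "\<And>i. i < m \<Longrightarrow> \<beta>' i = laurent r \<beta> (B i) * t i" "\<And>i. i < m \<Longrightarrow> torsion (t i)"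
    "\<And>i. i < m \<Longrightarrow> r < m \<Longrightarrow> t i = \<beta> r powi k i" "\<And>i. i < m \<Longrightarrow> r = m \<Longrightarrow> t i = 1" by metis
  have "\<exists>e t. \<beta> i = laurent r' \<beta>' e * t \<and> torsion t \<and> (\<exists>k. r' < m \<longrightarrow> t = \<beta>' r' powi k) \<and> (r' = m \<longrightarrow> t = 1)"
    if i: "i < m" for i
  proof -
    obtain e where "\<beta> i = laurent m \<beta>' e" using gen[OF nz(2,1) C2 i] by blast
    then show ?thesis by (rule coords) (use \<beta>'(2,5) tors' in auto)
  qed
  then obtain B' t' k' where B': "\<And>i. i < m \<Longrightarrow> \<beta> i = laurent r' \<beta>' (B' i) * t' i" "\<And>i. i < m \<Longrightarrow> torsion (t' i)"
    "\<And>i. i < m \<Longrightarrow> r' < m \<Longrightarrow> t' i = \<beta>' r' powi k' i" by metis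
  have BB': "(\<Sum>j<r. B i j * B' j l) = (if i = l then 1 else 0)" if "i < r'" "l < r'" for i l
    by (rule mult_indep_transition[OF nz(2) \<beta>(2) \<beta>'(2,3) B(1,2) B'(1,2) that])
  have B'B: "(\<Sum>j<r'. B' i j * B j l) = (if i = l then 1 else 0)" if "i < r" "l < r" for i l
    by (rule mult_indep_transition[OF nz(1) \<beta>'(2) \<beta>(2,3) B'(1,2) B(1,2) that])
  \<comment> \<open>The two exponent matrices are inverse to each other as rectangular matrices; the
    traces of their products in both orders agree, so their sizes do.\<close>
  have "int r' = (\<Sum>i<r'. \<Sum>j<r. B i j * B' j i)" by (simp add: BB')
  also have "\<dots> = (\<Sum>j<r. \<Sum>i<r'. B' j i * B i j)" by (subst sum.swap) (simp add: mult.commute)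
  also have "\<dots> = int r" by (simp add: B'B)
  finally have rr: "r' = r" by simp
  \<comment> \<open>The invertible exponent matrix acts on the first \<open>r\<close> coordinates,
    which then agree with those of \<open>\<beta>'\<close> up to torsion factors.\<close>
  define \<gamma>1 where "\<gamma>1 i = (if i < r then laurent r \<beta> (B i) else \<beta> i)" for i
  have \<gamma>1: "mono_equiv m \<beta> \<gamma>1"
    unfolding \<gamma>1_def[abs_def] by (rule mono_equiv_block[OF nz(1) \<beta>(2), of B B']) (use BB' B'B rr in simp_all)
  have "mono_equiv m \<beta> \<beta>'"
  proof (cases "r < m")
    case False
    then have "r = m" using \<beta>(2) by simp
    then have "\<gamma>1 i = \<beta>' i" if "i < m" for i using B(1,4)[OF that] that by (simp add: \<gamma>1_def)
    then show ?thesis using mono_equiv_trans[OF nz(1) \<gamma>1 mono_equiv_cong] by blast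
  next
    case True
    \<comment> \<open>A torsion element involves no independent coordinate, so each of the two roots
      of unity is a power of the other alone.\<close>
    have torsion_eq: "laurent r \<gamma> e = 1" if "mult_indep r \<gamma>" "z = laurent r \<gamma> e * s" "torsion z" "torsion s" "z \<noteq> 0"
      for \<gamma> :: "nat \<Rightarrow> 'k" and e z s
    proof -
      have "laurent r \<gamma> e = z * inverse s" using that(2,5) by auto
      then have "torsion (laurent r \<gamma> e)" using that(3,4) torsion_mult torsion_inverse by metis
      with that(1) have "\<forall>i<r. e i = 0" by (simp add: mult_indep_def)
      then show ?thesis by (simp add: laurent_def)
    qed
    have "laurent r \<beta> (B r) = 1"
      by (rule torsion_eq[OF \<beta>(3) B(1)[OF True]]) (use B(2) nz tors' rr True in auto)
    then have z1: "\<beta>' r = \<beta> r powi k r" using B(1,3)[OF True] True by simp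
    have "laurent r \<beta>' (B' r) = 1"
    proof (rule torsion_eq)
      show "mult_indep r \<beta>'" "\<beta> r = laurent r \<beta>' (B' r) * t' r" using \<beta>'(3) B'(1)[OF True] rr by simp_all
      show "torsion (\<beta> r)" "torsion (t' r)" "\<beta> r \<noteq> 0" using tors[of r] B'(2)[OF True] nz True by simp_all
    qed
    then have z2: "\<beta> r = \<beta>' r powi k' r" using B'(1,3)[OF True] True rr by simp
    \<comment> \<open>The torsion factors are powers of the root of unity in position
      \<open>r\<close>, and a shear along that position removes them. Only coordinate
      \<open>r\<close> may still differ from \<open>\<beta>'\<close>.\<close>
    define \<gamma>2 where "\<gamma>2 i = \<gamma>1 i * \<gamma>1 r powi (if i < r then k i else 0)" for i
    have nz1: "nonzero m \<gamma>1" by (rule mono_equiv_nonzero[OF \<gamma>1 nz(1)])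
    have "mono_equiv m \<gamma>1 \<gamma>2"
      unfolding \<gamma>2_def[abs_def] by (rule mono_equiv_shear[OF nz1 True]) simp
    from mono_equiv_trans[OF nz(1) \<gamma>1 this] have \<gamma>2: "mono_equiv m \<beta> \<gamma>2" .
    note nz2 = mono_equiv_nonzero[OF \<gamma>2 nz(1)]
    have g1: "\<gamma>2 i = \<beta>' i" if "i < r" for i
      using B(1,3)[of i] that True by (simp add: \<gamma>2_def \<gamma>1_def)
    have g2: "\<gamma>2 r = \<beta> r" by (simp add: \<gamma>2_def \<gamma>1_def)
    have g3: "\<gamma>2 i = \<beta>' i" if "r < i" "i < m" for i
      using \<beta>(5)[OF that] \<beta>'(5)[of i] that rr by (simp add: \<gamma>2_def \<gamma>1_def)
    have fin: ?thesis if "mono_equiv m \<gamma>2 (\<gamma>2(r := \<beta>' r))"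
    proof -
      have "(\<gamma>2(r := \<beta>' r)) i = \<beta>' i" if "i < m" for i
        using g1 g3 that by (cases "i < r"; cases "r < i") auto
      then have "mono_equiv m (\<gamma>2(r := \<beta>' r)) \<beta>'" by (rule mono_equiv_cong)
      from mono_equiv_trans[OF nz(1) mono_equiv_trans[OF nz(1) \<gamma>2 that] this] show ?thesis .
    qed
    show ?thesis
    \<comment> \<open>With an entry 1 after position \<open>r\<close> the generators can be
      exchanged; otherwise \<open>last\<close> leaves only equality or inversion.\<close>
    proof (cases "Suc r < m")
      case S: True
      show ?thesis
      proof (rule fin, rule mono_equiv_replace_generator[OF nz2 S])
        show "\<gamma>2 (Suc r) = 1" using g3[of "Suc r"] \<beta>'(5)[of "Suc r"] S rr by simp
        show "\<beta>' r = \<gamma>2 r powi k r" unfolding g2 by (rule z1)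
        show "\<gamma>2 r = \<beta>' r powi k' r" unfolding g2 by (rule z2)
      qed
    next
      case False
      then have m: "m = Suc r" using True by simp
      have "mult_indep r \<gamma>2"
        using \<beta>'(3) laurent_cong[of r \<gamma>2 \<beta>'] g1 unfolding mult_indep_def rr by metis
      then have "\<beta>' r = \<gamma>2 r \<or> \<beta>' r = inverse (\<gamma>2 r)"
        by (intro last[OF nz2 nz(2) equiv[OF nz C3 \<gamma>2] m]) (use g1 g2 tors tors' True rr in auto)
      then show ?thesis
      proof
        assume "\<beta>' r = \<gamma>2 r"
        then show ?thesis using mono_equiv_cong[of m \<gamma>2 \<gamma>2] by (intro fin) simp
      next
        assume "\<beta>' r = inverse (\<gamma>2 r)"
        then show ?thesis using mono_equiv_invert[OF nz2 True] by (intro fin) simp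
      qed
    qed
  qed
  from mono_equiv_trans[OF \<mu>(1) mono_equiv_trans[OF \<mu>(1) \<beta>(1) this] mono_equiv_sym[OF \<mu>(2) \<beta>'(1)]]
  show ?thesis .
qed

lemma mono_equiv_exact_order:
  assumes "nonzero m \<mu>" "mono_equiv m \<mu> \<beta>"
  shows "(\<forall>i<m. \<mu> i ^ k = 1) \<longleftrightarrow> (\<forall>i<m. \<beta> i ^ k = 1)"
proof -
  have *: "\<forall>i<m. \<beta> i ^ k = 1" if eq: "mono_equiv m \<mu> \<beta>" and o: "\<forall>i<m. \<mu> i ^ k = 1" for \<mu> \<beta> :: "nat \<Rightarrow> 'a"
  proof (intro allI impI)
    fix i assume i: "i < m"
    obtain A where "\<forall>i<m. \<beta> i = laurent m \<mu> (\<lambda>j. A $$ (i, j))" using eq unfolding mono_equiv_def by blast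
    then have "\<beta> i = laurent m \<mu> (\<lambda>j. A $$ (i, j))" using i by blast
    then obtain e where e: "\<beta> i = laurent m \<mu> e" ..
    have "laurent m \<mu> e ^ k = (\<Prod>i<m. (\<mu> i ^ k) powi e i)"
      by (simp add: laurent_def prod_power_distrib power_int_power power_int_power' mult.commute)
    then show "\<beta> i ^ k = 1" using o e by simp
  qed
  show ?thesis using *[OF assms(2)] *[OF mono_equiv_sym[OF assms]] by blast
qed

text \<open>Finite order excludes independent coordinates, so both normal forms are a primitive root
  of unity of order \<open>d\<close> followed by ones. The two roots generate the same group, and
  \<open>m > 1\<close> provides the spare coordinate.\<close>

theorem mono_equiv_torsion:
  fixes \<mu> \<mu>' :: "nat \<Rightarrow> 'k::{alg_closed_field, field_char_0}"
  assumes m: "1 < m" and \<mu>: "nonzero m \<mu>" "nonzero m \<mu>'" and d: "d > 0"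
    and ord: "\<And>k. (\<forall>i<m. \<mu> i ^ k = 1) \<longleftrightarrow> d dvd k" "\<And>k. (\<forall>i<m. \<mu>' i ^ k = 1) \<longleftrightarrow> d dvd k"
  shows "mono_equiv m \<mu> \<mu>'"
proof -
  have nf: "\<exists>\<beta>. mono_equiv m \<mu> \<beta> \<and> exact_order (\<beta> 0) d \<and> (\<forall>i. 0 < i \<longrightarrow> i < m \<longrightarrow> \<beta> i = 1)"
    if \<mu>: "nonzero m \<mu>" and ord: "\<And>k. (\<forall>i<m. \<mu> i ^ k = 1) \<longleftrightarrow> d dvd k" for \<mu> :: "nat \<Rightarrow> 'k"
  proof -
    obtain \<beta> r where \<beta>: "mono_equiv m \<mu> \<beta>" "r \<le> m" "mult_indep r \<beta>" "\<And>i. r < i \<Longrightarrow> i < m \<Longrightarrow> \<beta> i = 1"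
      using mono_normal_form[OF \<mu>] by blast
    have ord\<beta>: "(\<forall>i<m. \<beta> i ^ k = 1) \<longleftrightarrow> d dvd k" for k
      using ord[of k] mono_equiv_exact_order[OF \<mu> \<beta>(1)] by simp
    have "r = 0"
    proof (rule ccontr)
      assume r: "r \<noteq> 0"
      have "\<beta> i ^ d = 1" if "i < m" for i using ord\<beta>[of d] that by simp
      then have "torsion (laurent r \<beta> (\<lambda>_. 1))"
        using d \<beta>(2) by (intro laurent_torsion) (auto simp: torsion_def)
      with \<beta>(3) r show False by (auto simp: mult_indep_def)
    qed
    moreover have "exact_order (\<beta> 0) d"
      unfolding exact_order_def
    proof
      fix k
      have "\<beta> 0 ^ k = 1 \<longleftrightarrow> (\<forall>i<m. \<beta> i ^ k = 1)"
      proof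
        assume k: "\<beta> 0 ^ k = 1"
        show "\<forall>i<m. \<beta> i ^ k = 1"
        proof (intro allI impI)
          fix i assume "i < m"
          then show "\<beta> i ^ k = 1" using k \<beta>(4)[of i] \<open>r = 0\<close> by (cases "i = 0") auto
        qed
      qed (use m in auto)
      then show "\<beta> 0 ^ k = 1 \<longleftrightarrow> d dvd k" using ord\<beta> by simp
    qed
    ultimately show ?thesis using \<beta> by blast
  qed
  obtain \<beta> where \<beta>: "mono_equiv m \<mu> \<beta>" "exact_order (\<beta> 0) d" "\<forall>i. 0 < i \<longrightarrow> i < m \<longrightarrow> \<beta> i = 1"
    using nf[OF \<mu>(1) ord(1)] by blast
  obtain \<beta>' where \<beta>': "mono_equiv m \<mu>' \<beta>'" "exact_order (\<beta>' 0) d" "\<forall>i. 0 < i \<longrightarrow> i < m \<longrightarrow> \<beta>' i = 1"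
    using nf[OF \<mu>(2) ord(2)] by blast
  have "\<beta> 0 ^ d = 1" "\<beta>' 0 ^ d = 1" using \<beta>(2) \<beta>'(2) by (simp_all add: exact_order_def)
  then obtain k l where "\<beta>' 0 = \<beta> 0 ^ k" "\<beta> 0 = \<beta>' 0 ^ l"
    using exact_order_generates[OF d \<beta>(2)] exact_order_generates[OF d \<beta>'(2)] by blast
  then have "mono_equiv m \<beta> (\<beta>(0 := \<beta>' 0))"
    by (intro mono_equiv_replace_generator[of _ _ _ _ "int k" "int l"] mono_equiv_nonzero[OF \<beta>(1) \<mu>(1)]) (use m \<beta>(3) in auto)
  moreover have "mono_equiv m (\<beta>(0 := \<beta>' 0)) \<beta>'" by (rule mono_equiv_cong) (use \<beta>(3) \<beta>'(3) in auto)
  ultimately have "mono_equiv m \<mu> \<beta>'"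
    using mono_equiv_trans[OF \<mu>(1)] \<beta>(1) by blast
  from mono_equiv_trans[OF \<mu>(1) this mono_equiv_sym[OF \<mu>(2) \<beta>'(1)]] show ?thesis .
qed

section \<open>Leading monomials\<close>

text \<open>The leading monomial for the linear order on exponent vectors, which is compatible with
  addition.\<close>

definition lead :: "'k::zero mpoly \<Rightarrow> nat \<Rightarrow>\<^sub>0 nat" where
  "lead p = Max (keys p)"

lemma lead_in_keys: "p \<noteq> 0 \<Longrightarrow> lead p \<in> keys p"
  unfolding lead_def by (rule Max_in) auto

lemma lead_le: "m \<in> keys p \<Longrightarrow> m \<le> lead p"
  unfolding lead_def by (rule Max_ge) auto

lemma leadI: "m \<in> keys p \<Longrightarrow> (\<And>m'. m' \<in> keys p \<Longrightarrow> m' \<le> m) \<Longrightarrow> lead p = m"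
  unfolding lead_def by (rule Max_eqI) auto

text \<open>Strict monotonicity of addition makes the pair of leading monomials the only one with
  the top sum, so its coefficient cannot cancel.\<close>

lemma lead_mult:
  fixes p q :: "'k::idom mpoly"
  assumes "p \<noteq> 0" "q \<noteq> 0"
  shows "lead (p * q) = lead p + lead q"
proof (rule leadI)
  have low: "m + m' \<le> lead p + lead q" "m + m' = lead p + lead q \<Longrightarrow> m = lead p \<and> m' = lead q"
    if "m \<in> keys p" "m' \<in> keys q" for m m'
  proof -
    have "m \<le> lead p" "m' \<le> lead q" using that lead_le by auto
    then show "m + m' \<le> lead p + lead q" by (rule add_mono)
    show "m = lead p \<and> m' = lead q" if "m + m' = lead p + lead q"
    proof -
      have "m = lead p"
      proof (rule ccontr)
        assume "m \<noteq> lead p"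
        with \<open>m \<le> lead p\<close> have "m < lead p" by simp
        then have "m + m' < lead p + lead q" using \<open>m' \<le> lead q\<close> by (rule add_less_le_mono)
        with that show False by simp
      qed
      with that show ?thesis by simp
    qed
  qed
  have "lookup (p * q) (lead p + lead q) = lookup p (lead p) * lookup q (lead q)"
  proof -
    have "p * q = (\<Sum>m\<in>keys p. single m (lookup p m)) * (\<Sum>m'\<in>keys q. single m' (lookup q m'))"
      by (simp add: mpoly_sum_singles)
    also have "\<dots> = (\<Sum>m\<in>keys p. \<Sum>m'\<in>keys q. single (m + m') (lookup p m * lookup q m'))"
      by (simp add: sum_product mult_single)
    finally have "lookup (p * q) (lead p + lead q) =
      (\<Sum>m\<in>keys p. \<Sum>m'\<in>keys q. if m + m' = lead p + lead q then lookup p m * lookup q m' else 0)"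
      by (simp add: lookup_sum lookup_single when_def)
    also have "\<dots> = (\<Sum>m\<in>keys p. \<Sum>m'\<in>keys q. if m' = lead q then if m = lead p then lookup p m * lookup q m' else 0 else 0)"
      by (intro sum.cong refl) (use low(2) in auto)
    also have "\<dots> = lookup p (lead p) * lookup q (lead q)"
      using lead_in_keys[OF assms(1)] lead_in_keys[OF assms(2)] by simp
    finally show ?thesis .
  qed
  also have "\<dots> \<noteq> 0" using lead_in_keys[OF assms(1)] lead_in_keys[OF assms(2)] by (simp add: in_keys_iff)
  finally show "lead p + lead q \<in> keys (p * q)" by (simp add: in_keys_iff)
  fix m assume "m \<in> keys (p * q)"
  then obtain a b where "m = a + b" "a \<in> keys p" "b \<in> keys q" using keys_mult[of p q] by blast
  with low(1) show "m \<le> lead p + lead q" by simp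
qed

lemma lead_power: "p \<noteq> 0 \<Longrightarrow> lookup (lead (p ^ k)) i = k * lookup (lead p) i" for p :: "'k::idom mpoly"
proof (induction k)
  case 0
  have "lead (1 :: 'k mpoly) = 0" by (rule leadI) auto
  then show ?case by simp
qed (simp add: lead_mult lookup_add)

lemma lead_Const_mult: "a \<noteq> 0 \<Longrightarrow> lead (Const a * p) = lead p" for p :: "'k::field mpoly"
proof -
  assume "a \<noteq> 0"
  then have "keys (Const a * p) = keys p" by (auto simp: in_keys_iff lookup_Const_mult)
  then show ?thesis by (simp add: lead_def)
qed

lemma lead_Var_mult: "p \<noteq> 0 \<Longrightarrow> lead (Var i * p) = single i 1 + lead (p :: 'k::field mpoly)"
proof -
  assume "p \<noteq> 0"
  moreover have "Var i \<noteq> (0 :: 'k mpoly)" using lookup_Var_single[of i i] by (metis lookup_zero zero_neq_one)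
  moreover have "lead (Var i :: 'k mpoly) = single i 1" by (rule leadI) (auto simp: Var_def)
  ultimately show ?thesis by (simp add: lead_mult)
qed

text \<open>The largest of pairwise distinct leading monomials occurs in a single summand and cannot
  cancel.\<close>

lemma lead_sum_distinct:
  fixes F :: "'b \<Rightarrow> 'k::field mpoly"
  assumes "finite S" "S \<noteq> {}" "\<And>s. s \<in> S \<Longrightarrow> F s \<noteq> 0" "inj_on (\<lambda>s. lead (F s)) S"
  shows "sum F S \<noteq> 0 \<and> (\<exists>s\<in>S. lead (sum F S) = lead (F s))"
proof -
  let ?M = "Max ((\<lambda>s. lead (F s)) ` S)"
  have "?M \<in> (\<lambda>s. lead (F s)) ` S" using assms(1,2) by (intro Max_in) auto
  then obtain s where s: "s \<in> S" "?M = lead (F s)" by blast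
  have le: "lead (F t) \<le> lead (F s)" if "t \<in> S" for t
    unfolding s(2)[symmetric] using assms(1) that by (intro Max_ge) auto
  have z: "lookup (F t) (lead (F s)) = 0" if "t \<in> S - {s}" for t
  proof (rule ccontr)
    assume "lookup (F t) (lead (F s)) \<noteq> 0"
    then have "lead (F s) \<le> lead (F t)" by (intro lead_le) (simp add: in_keys_iff)
    with le[of t] that have "lead (F t) = lead (F s)" by simp
    with assms(4) s(1) that show False by (auto dest: inj_onD)
  qed
  have "lookup (sum F S) (lead (F s)) = lookup (F s) (lead (F s)) + (\<Sum>t\<in>S - {s}. lookup (F t) (lead (F s)))"
    unfolding sum.remove[OF assms(1) s(1), of F] by (simp add: lookup_add lookup_sum)
  also have "\<dots> = lookup (F s) (lead (F s))" using z by simp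
  also have "\<dots> \<noteq> 0" using lead_in_keys[OF assms(3)[OF s(1)]] by (simp add: in_keys_iff)
  finally have k: "lead (F s) \<in> keys (sum F S)" by (simp add: in_keys_iff)
  have "lead (sum F S) = lead (F s)"
  proof (rule leadI[OF k])
    fix m assume "m \<in> keys (sum F S)"
    then obtain t where t: "t \<in> S" "m \<in> keys (F t)" using keys_sum[of F S] by blast
    show "m \<le> lead (F s)" using lead_le[OF t(2)] le[OF t(1)] by simp
  qed
  moreover have "sum F S \<noteq> 0" using k by auto
  ultimately show ?thesis using s(1) by blast
qed

section \<open>Conjugate diagonal and almost-diagonal automorphisms\<close>

text \<open>\<open>a = p/q\<close> and \<open>g = R/S\<close> with \<open>p, q\<close> equal, up to a common monomial, to polynomials in one
  variable: the equation \<open>a(g) = x\<^sub>r\<close> compares leading monomials to \<open>e\<^sub>r \<in> \<int> (lead R - lead S)\<close>.\<close>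

lemma univariate_left_inverse_lead:
  fixes p q R S :: "'k::field mpoly"
  assumes pq: "p \<noteq> 0" "q \<noteq> 0" and RS: "R \<noteq> 0" "S \<noteq> 0" and ne: "lead R \<noteq> lead S"
    and inj: "inj_on (\<lambda>m. lookup m r) (keys p)" "inj_on (\<lambda>m. lookup m r) (keys q)"
    and eq: "coord r * (\<Sum>m\<in>keys q. scalar (lookup q m) * (to_fract R / to_fract S) ^ lookup m r) =
      (\<Sum>m\<in>keys p. scalar (lookup p m) * (to_fract R / to_fract S) ^ lookup m r)"
  shows "(int (lookup (lead R) r) - int (lookup (lead S) r) = 1 \<or> int (lookup (lead R) r) - int (lookup (lead S) r) = -1) \<and>
    (\<forall>i. i \<noteq> r \<longrightarrow> lookup (lead R) i = lookup (lead S) i)"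
proof -
  \<comment> \<open>\<open>N\<close> bounds the degrees of both sides, so multiplication by
    \<open>S^N\<close> clears all denominators and turns each term into the polynomial
    \<open>F\<close>.\<close>
  define N where "N = Max ((\<lambda>m. lookup m r) ` (keys p \<union> keys q))"
  have N: "lookup m r \<le> N" if "m \<in> keys p \<union> keys q" for m
    unfolding N_def using that by (intro Max_ge) auto
  define F where "F p m = Const (lookup p m) * (R ^ lookup m r * S ^ (N - lookup m r))" for p m
  have F: "to_fract S ^ N * (\<Sum>m\<in>keys p. scalar (lookup p m) * (to_fract R / to_fract S) ^ lookup m r) = to_fract (\<Sum>m\<in>keys p. F p m)"
    if le: "\<And>m. m \<in> keys p \<Longrightarrow> lookup m r \<le> N" for p :: "'k mpoly"
  proof -
    have "to_fract S ^ N * (scalar (lookup p m) * (to_fract R / to_fract S) ^ lookup m r) = to_fract (F p m)" if m: "m \<in> keys p" for m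
    proof -
      have "to_fract S ^ N = to_fract S ^ lookup m r * to_fract S ^ (N - lookup m r)"
        using le[OF m] by (simp flip: power_add)
      then show ?thesis using RS(2)
        by (simp add: F_def power_divide to_fract_Const to_fract.hom_power)
    qed
    then show ?thesis by (simp add: sum_distrib_left)
  qed
  have "to_fract (Var r * (\<Sum>m\<in>keys q. F q m)) = to_fract (\<Sum>m\<in>keys p. F p m)"
    using arg_cong[OF eq, of "\<lambda>x. to_fract S ^ N * x"] F[of p] F[of q] N
    by (simp add: to_fract_Var mult.left_commute)
  then have eq': "Var r * (\<Sum>m\<in>keys q. F q m) = (\<Sum>m\<in>keys p. F p m)" by (simp only: to_fract_eq_iff)
  have pow: "R ^ k \<noteq> 0" "S ^ k \<noteq> 0" for k using RS by simp_all
  have F0: "F p m \<noteq> 0" and Fl: "lookup (lead (F p m)) i = lookup m r * lookup (lead R) i + (N - lookup m r) * lookup (lead S) i"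
    if "m \<in> keys p" for p m i
  proof -
    have c: "lookup p m \<noteq> 0" using that by (simp add: in_keys_iff)
    then have "Const (lookup p m) \<noteq> (0 :: 'k mpoly)" by (metis lookup_single_eq lookup_zero)
    with pow show "F p m \<noteq> 0" unfolding F_def by (simp del: power_eq_0_iff)
    show "lookup (lead (F p m)) i = lookup m r * lookup (lead R) i + (N - lookup m r) * lookup (lead S) i"
      unfolding F_def lead_Const_mult[OF c] lead_mult[OF pow] lookup_add lead_power[OF RS(1)] lead_power[OF RS(2)] ..
  qed
  \<comment> \<open>In a coordinate where \<open>lead R\<close> and \<open>lead S\<close> differ,
    the exponent of the leading monomial of \<open>F p m\<close> determines
    \<open>lookup m r\<close>; hence distinct terms have distinct leading monomials.\<close>
  obtain j where j: "lookup (lead R) j \<noteq> lookup (lead S) j" by (metis ne poly_mapping_eqI)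
  have Fint: "int (lookup (lead (F p m)) i) = int N * int (lookup (lead S) i) +
      int (lookup m r) * (int (lookup (lead R) i) - int (lookup (lead S) i))"
    if "m \<in> keys p" "lookup m r \<le> N" for p m i
    unfolding Fl[OF that(1)] of_nat_add of_nat_mult of_nat_diff[OF that(2)] by (simp add: algebra_simps)
  have Finj: "inj_on (\<lambda>m. lead (F p m)) (keys p)"
    if "inj_on (\<lambda>m. lookup m r) (keys p)" "\<And>m. m \<in> keys p \<Longrightarrow> lookup m r \<le> N" for p
  proof (rule inj_onI)
    fix m m' assume m: "m \<in> keys p" "m' \<in> keys p" "lead (F p m) = lead (F p m')"
    then have "lookup m r = lookup m' r"
      using Fint[OF m(1) that(2)[OF m(1)], of j] Fint[OF m(2) that(2)[OF m(2)], of j] j by simp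
    with that(1) m show "m = m'" by (auto dest: inj_onD)
  qed
  have p: "\<exists>m\<in>keys p. lead (\<Sum>m\<in>keys p. F p m) = lead (F p m)"
    using lead_sum_distinct[of "keys p" "F p"] pq F0 Finj[OF inj(1)] N by auto
  have q: "(\<Sum>m\<in>keys q. F q m) \<noteq> 0 \<and> (\<exists>m\<in>keys q. lead (\<Sum>m\<in>keys q. F q m) = lead (F q m))"
    using lead_sum_distinct[of "keys q" "F q"] pq F0 Finj[OF inj(2)] N by auto
  obtain m where m: "m \<in> keys p" "lead (\<Sum>m\<in>keys p. F p m) = lead (F p m)" using p by blast
  obtain m' where m': "m' \<in> keys q" "lead (\<Sum>m\<in>keys q. F q m) = lead (F q m')" using q by blast
  have "lead (F p m) = single r 1 + lead (F q m')"
    using arg_cong[OF eq', of lead] lead_Var_mult[of "\<Sum>m\<in>keys q. F q m" r] q m m' by simp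
  then have "int (lookup (lead (F p m)) i) = (if i = r then 1 else 0) + int (lookup (lead (F q m')) i)" for i
    by (simp add: lookup_add lookup_single when_def)
  \<comment> \<open>An integer times the vector \<open>lead R - lead S\<close> is the unit vector at
    \<open>r\<close>; both factors at \<open>r\<close> are therefore units of the integers, and all
    other entries vanish.\<close>
  then have *: "(int (lookup m r) - int (lookup m' r)) * (int (lookup (lead R) i) - int (lookup (lead S) i)) = (if i = r then 1 else 0)" for i
    using Fint[OF m(1), of i] Fint[OF m'(1), of i] N m(1) m'(1) by (simp add: algebra_simps)
  from *[of r] have 1: "int (lookup (lead R) r) - int (lookup (lead S) r) = 1 \<or> int (lookup (lead R) r) - int (lookup (lead S) r) = -1"
    by (auto simp: zmult_eq_1_iff)
  have "lookup (lead R) i = lookup (lead S) i" if "i \<noteq> r" for i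
  proof -
    have "int (lookup m r) - int (lookup m' r) \<noteq> 0" using *[of r] by auto
    with *[of i] that show ?thesis by simp
  qed
  with 1 show ?thesis by blast
qed

section \<open>Components of a conjugating map as eigenfunctions\<close>

lemma birational_coord_nonzero:
  fixes h :: "'k::field ratfun vec"
  assumes h: "birational n h" and i: "i < n"
  shows "h $ i \<noteq> 0"
proof
  assume "h $ i = 0"
  then have "poly_subst h (Var i) = 0"
    by (simp add: poly_subst_peval comm_ring_hom.peval_Var[OF comm_ring_hom_scalar])
  moreover have "dim_vec h = n" using ratmapsD(1)[OF birationalD(1)[OF h]] .
  moreover have "Var i \<in> (polys n :: 'k mpoly set)" using i by simp
  ultimately have "Var i = (0 :: 'k mpoly)"
    using birationalD(2)[OF h] unfolding dominant_def by blast
  then show False using lookup_Var_single[of i i] by (metis lookup_zero zero_neq_one)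
qed

text \<open>Each pair of a numerator and a denominator monomial expresses \<open>\<mu>' i\<close> as
  a Laurent monomial in \<open>\<mu>\<close>. One pair suffices for the existence of an expression;
  the comparison of last components uses all of them.\<close>

lemma conjugate_eigenfunction:
  fixes \<mu> \<mu>' :: "nat \<Rightarrow> 'k::field_char_0"
  assumes c: "c \<Longrightarrow> \<mu> 0 = 1" and \<mu>: "nonzero n \<mu>" and h: "birational n h"
    and conj: "rat_comp (rat_comp h (pmap n (shift_diag c \<mu>))) (inv\<^bsub>Bir n\<^esub> h) = pmap n (shift_diag c \<mu>')"
    and i: "i < n" "\<not> (c \<and> i = 0)" and \<mu>': "\<mu>' i \<noteq> 0"
  obtains p q where "p \<in> polys n" "q \<in> polys n" "p \<noteq> 0" "q \<noteq> 0" "to_fract q * h $ i = to_fract p"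
    "\<And>m. m \<in> keys p \<union> keys q \<Longrightarrow> c \<Longrightarrow> lookup m 0 = 0"
    "\<And>m m'. m \<in> keys p \<Longrightarrow> m' \<in> keys q \<Longrightarrow> laurent n \<mu> (\<lambda>j. int (lookup m j) - int (lookup m' j)) = \<mu>' i"
proof -
  have f: "birational n (pmap n (shift_diag c \<mu>))" by (rule shift_diag_Aut(2)) (use c \<mu> in blast)+
  have "rat_subst (pmap n (shift_diag c \<mu>)) (h $ i) = scalar (\<mu>' i) * h $ i"
    using conjugate_shift_diag_eigen[OF h f conj i(1)] i(2) by auto
  then obtain p q where pq: "p \<in> polys n" "q \<in> polys n" "p \<noteq> 0" "q \<noteq> 0" "to_fract q * h $ i = to_fract p"
      "\<And>m. m \<in> keys p \<union> keys q \<Longrightarrow> c \<Longrightarrow> lookup m 0 = 0"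
      "\<And>m m'. m \<in> keys p \<Longrightarrow> m' \<in> keys q \<Longrightarrow> monom_eval \<mu> m = \<mu>' i * monom_eval \<mu> m'"
    using shift_diag_eigenfunction[where c=c and \<mu>=\<mu>, OF c _ ratmapsD(2)[OF birationalD(1)[OF h] i(1)] birational_coord_nonzero[OF h i(1)] _ \<mu>'] \<mu>
    by blast
  have "laurent n \<mu> (\<lambda>j. int (lookup m j) - int (lookup m' j)) = \<mu>' i" if "m \<in> keys p" "m' \<in> keys q" for m m'
  proof -
    have "laurent n \<mu> (\<lambda>j. int (lookup m' j)) \<noteq> 0" using laurent_nonzero[OF \<mu>] .
    then show ?thesis
      using pq(7)[OF that] laurent_diff[of n \<mu> "\<lambda>j. int (lookup m j)" "\<lambda>j. int (lookup m' j)"] \<mu>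
      unfolding monom_eval_laurent[OF polysD[OF pq(1) that(1)]] monom_eval_laurent[OF polysD[OF pq(2) that(2)]]
      by simp
  qed
  with pq(1-6) show thesis using that by blast
qed

lemma conjugate_shift_diag_laurent:
  fixes \<mu> \<mu>' :: "nat \<Rightarrow> 'k::field_char_0"
  assumes c: "c \<Longrightarrow> \<mu> 0 = 1" and \<mu>: "nonzero n \<mu>"
    and conj: "conjugate_in (Bir n) (pmap n (shift_diag c \<mu>)) (pmap n (shift_diag c \<mu>'))"
    and i: "i < n" "\<not> (c \<and> i = 0)" and \<mu>': "\<mu>' i \<noteq> 0"
  shows "\<exists>e. \<mu>' i = laurent n \<mu> e"
proof -
  obtain h where h: "birational n h"
    "rat_comp (rat_comp h (pmap n (shift_diag c \<mu>))) (inv\<^bsub>Bir n\<^esub> h) = pmap n (shift_diag c \<mu>')"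
    using conj unfolding conjugate_in_Bir_def by blast
  obtain p q where pq: "p \<in> polys n" "q \<in> polys n" "p \<noteq> 0" "q \<noteq> 0" "to_fract q * h $ i = to_fract p"
      "\<And>m. m \<in> keys p \<union> keys q \<Longrightarrow> c \<Longrightarrow> lookup m 0 = 0"
      "\<And>m m'. m \<in> keys p \<Longrightarrow> m' \<in> keys q \<Longrightarrow> laurent n \<mu> (\<lambda>j. int (lookup m j) - int (lookup m' j)) = \<mu>' i"
    by (rule conjugate_eigenfunction[where \<mu>=\<mu> and \<mu>'=\<mu>', OF c \<mu> h i \<mu>']) (assumption, rule that)
  then show ?thesis using pq(7)[OF lead_in_keys[OF pq(3)] lead_in_keys[OF pq(4)]] by metis
qed

lemma conjugate_by_inverse:
  assumes "birational n h" "birational n f" "rat_comp (rat_comp h f) (inv\<^bsub>Bir n\<^esub> h) = g"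
  shows "rat_comp (rat_comp (inv\<^bsub>Bir n\<^esub> h) g) (inv\<^bsub>Bir n\<^esub> (inv\<^bsub>Bir n\<^esub> h)) = f"
proof -
  interpret group "Bir n :: 'a ratfun vec monoid" by (rule group_Bir)
  have h: "h \<in> carrier (Bir n)" "f \<in> carrier (Bir n)" using assms by simp_all
  have "inv\<^bsub>Bir n\<^esub> h \<otimes>\<^bsub>Bir n\<^esub> (h \<otimes>\<^bsub>Bir n\<^esub> f \<otimes>\<^bsub>Bir n\<^esub> inv\<^bsub>Bir n\<^esub> h) \<otimes>\<^bsub>Bir n\<^esub> inv\<^bsub>Bir n\<^esub> (inv\<^bsub>Bir n\<^esub> h) = f"
    using h by (metis inv_closed inv_inv inv_solve_left' inv_solve_right m_closed m_assoc)
  then show ?thesis using assms(3) by simp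
qed

lemma monom_eval_off_index:
  assumes "keys m \<subseteq> {..r}" "\<And>i. i < r \<Longrightarrow> lookup m i = k i"
  shows "monom_eval f m = (\<Prod>i<r. f i ^ k i) * f r ^ lookup m r"
  unfolding monom_eval_superset[OF finite_atMost assms(1)] lessThan_Suc_atMost[symmetric]
  using assms(2) by simp

text \<open>With \<open>g\<close> the inverse of \<open>h\<close>, the last component
  \<open>h $ r = p/q\<close> is univariate in \<open>x\<^sub>r\<close> up to a common monomial.
  Inserting \<open>g\<close> must return \<open>x\<^sub>r\<close>, so for \<open>g $ r = R/S\<close>
  the leading exponents differ by plus or minus the unit vector at \<open>r\<close>. This difference
  also expresses \<open>\<mu> r\<close> through \<open>\<mu>'\<close>.\<close>

lemma conjugate_shift_diag_last:
  fixes \<mu> \<mu>' :: "nat \<Rightarrow> 'k::field_char_0"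
  assumes c: "c \<Longrightarrow> \<mu> 0 = 1" "c \<Longrightarrow> \<mu>' 0 = 1" and \<mu>: "nonzero (Suc r) \<mu>" "nonzero (Suc r) \<mu>'"
    and conj: "conjugate_in (Bir (Suc r)) (pmap (Suc r) (shift_diag c \<mu>)) (pmap (Suc r) (shift_diag c \<mu>'))"
    and r: "\<not> (c \<and> r = 0)"
    and ind: "\<And>e i. torsion (laurent r \<mu> e) \<Longrightarrow> i < r \<Longrightarrow> \<not> (c \<and> i = 0) \<Longrightarrow> e i = 0"
    and t: "torsion (\<mu> r)" "torsion (\<mu>' r)"
  shows "\<mu>' r = \<mu> r \<or> \<mu>' r = inverse (\<mu> r)"
proof -
  let ?n = "Suc r"
  obtain h where h: "birational ?n h"
    and conj: "rat_comp (rat_comp h (pmap ?n (shift_diag c \<mu>))) (inv\<^bsub>Bir ?n\<^esub> h) = pmap ?n (shift_diag c \<mu>')"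
    using conj unfolding conjugate_in_Bir_def by blast
  define g where "g = inv\<^bsub>Bir ?n\<^esub> h"
  have g: "birational ?n g" and hg: "rat_comp h g = rat_id ?n" using birational_inv[OF h] by (simp_all add: g_def)
  have f: "birational ?n (pmap ?n (shift_diag c \<mu>))" by (rule shift_diag_Aut(2)) (use c \<mu> in blast)+
  have conj': "rat_comp (rat_comp g (pmap ?n (shift_diag c \<mu>'))) (inv\<^bsub>Bir ?n\<^esub> g) = pmap ?n (shift_diag c \<mu>)"
    using conjugate_by_inverse[OF h f conj] by (simp add: g_def)
  have rn: "r < ?n" by simp
  obtain p q where pq: "p \<in> polys ?n" "q \<in> polys ?n" "p \<noteq> 0" "q \<noteq> 0" "to_fract q * h $ r = to_fract p"
      "\<And>m. m \<in> keys p \<union> keys q \<Longrightarrow> c \<Longrightarrow> lookup m 0 = 0"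
      "\<And>m m'. m \<in> keys p \<Longrightarrow> m' \<in> keys q \<Longrightarrow> laurent ?n \<mu> (\<lambda>j. int (lookup m j) - int (lookup m' j)) = \<mu>' r"
    by (rule conjugate_eigenfunction[where \<mu>=\<mu> and \<mu>'=\<mu>', OF c(1) \<mu>(1) h conj rn r]) (use \<mu>(2) in auto)
  obtain R S where RS: "R \<in> polys ?n" "S \<in> polys ?n" "R \<noteq> 0" "S \<noteq> 0" "to_fract S * g $ r = to_fract R"
      "\<And>m m'. m \<in> keys R \<Longrightarrow> m' \<in> keys S \<Longrightarrow> laurent ?n \<mu>' (\<lambda>j. int (lookup m j) - int (lookup m' j)) = \<mu> r"
    by (rule conjugate_eigenfunction[where \<mu>=\<mu>' and \<mu>'=\<mu>, OF c(2) \<mu>(2) g conj' rn r]) (use \<mu>(1) in auto)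
  \<comment> \<open>The exponents below \<open>r\<close> of numerator and denominator give a Laurent
    monomial equal to a torsion element; independence equates them. At the translated variable both
    vanish anyway.\<close>
  have agree1: "lookup m i = lookup m' i" if m: "m \<in> keys p" "m' \<in> keys q" "i < r" for m m' i
  proof (cases "c \<and> i = 0")
    case True with pq(6)[of m] pq(6)[of m'] m show ?thesis by simp
  next
    case False
    let ?e = "\<lambda>j. int (lookup m j) - int (lookup m' j)"
    have "laurent r \<mu> ?e * \<mu> r powi ?e r = \<mu>' r"
      using pq(7)[OF m(1,2)] by (simp add: laurent_def)
    moreover have "\<mu> r powi ?e r \<noteq> 0" using \<mu>(1) by simp
    ultimately have "laurent r \<mu> ?e = \<mu>' r * inverse (\<mu> r powi ?e r)"
      by (metis mult.assoc mult.right_neutral right_inverse)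
    then have "torsion (laurent r \<mu> ?e)" using t by (metis torsion_mult torsion_powi torsion_inverse)
    from ind[OF this m(3) False] show ?thesis by simp
  qed
  define k where "k = lookup (lead p)"
  have agq: "lookup m i = k i" if "m \<in> keys q" "i < r" for m i
    using agree1[OF lead_in_keys[OF pq(3)] that] by (simp add: k_def)
  have agp: "lookup m i = k i" if "m \<in> keys p" "i < r" for m i
    using agree1[OF that(1) lead_in_keys[OF pq(4)] that(2)] agq[OF lead_in_keys[OF pq(4)] that(2)] by simp
  have inj: "inj_on (\<lambda>m. lookup m r) (keys p)" if "p \<in> polys ?n" "\<And>m i. m \<in> keys p \<Longrightarrow> i < r \<Longrightarrow> lookup m i = k i"
    for p :: "'k mpoly"
  proof (rule inj_onI, rule poly_mapping_eqI)
    fix m m' i assume m: "m \<in> keys p" "m' \<in> keys p" "lookup m r = lookup m' r"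
    consider "i < r" | "i = r" | "i \<notin> {..<Suc r}" by fastforce
    then show "lookup m i = lookup m' i"
    proof cases
      case 3
      with polysD[OF that(1) m(1)] polysD[OF that(1) m(2)] have "i \<notin> keys m" "i \<notin> keys m'" by blast+
      then show ?thesis by (simp add: in_keys_iff)
    qed (use that(2) m in simp_all)
  qed
  \<comment> \<open>The image under \<open>g\<close> of the monomial common to all terms of
    \<open>p\<close> and \<open>q\<close>; being nonzero it cancels from the equation.\<close>
  define P where "P = (\<Prod>i<r. g $ i ^ k i)"
  have P: "P \<noteq> 0" using birational_coord_nonzero[OF g] by (simp add: P_def)
  have sub: "poly_subst g p = P * (\<Sum>m\<in>keys p. scalar (lookup p m) * (g $ r) ^ lookup m r)"
    if p: "p \<in> polys ?n" "\<And>m i. m \<in> keys p \<Longrightarrow> i < r \<Longrightarrow> lookup m i = k i" for p :: "'k mpoly"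
  proof -
    have "monom_eval (\<lambda>i. g $ i) m = P * (g $ r) ^ lookup m r" if m: "m \<in> keys p" for m
      unfolding P_def using polysD[OF p(1) m] p(2)[OF m] by (intro monom_eval_off_index) (auto simp: lessThan_Suc_atMost)
    then show ?thesis
      by (simp add: poly_subst_peval peval_def sum_distrib_left mult.left_commute)
  qed
  have dg: "dim_vec g = ?n" "dim_vec h = ?n" using ratmapsD(1) birationalD(1) g h by blast+
  have reg: "reg g = ratfuns ?n" using reg_dominant[OF birationalD(2)[OF g]] dg by simp
  have hr: "rat_subst g (h $ r) = coord r" using arg_cong[OF hg, of "\<lambda>v. v $ r"] dg by simp
  have "rat_subst g (to_fract q * h $ r) = poly_subst g q * coord r"
    using reg_add_mult(4)[OF reg_poly, of q g "h $ r"] pq(2) dg reg hr ratmapsD(2)[OF birationalD(1)[OF h] rn]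
    by (simp add: rat_subst_poly)
  then have "poly_subst g q * coord r = poly_subst g p" using pq(1,5) dg by (simp add: rat_subst_poly)
  moreover have gr: "g $ r = to_fract R / to_fract S" using RS(4,5) by (simp add: field_simps)
  ultimately have eq: "coord r * (\<Sum>m\<in>keys q. scalar (lookup q m) * (to_fract R / to_fract S) ^ lookup m r) =
      (\<Sum>m\<in>keys p. scalar (lookup p m) * (to_fract R / to_fract S) ^ lookup m r)"
    using sub[OF pq(1) agp] sub[OF pq(2) agq] P by (simp add: mult_ac)
  note lRS = RS(6)[OF lead_in_keys[OF RS(3)] lead_in_keys[OF RS(4)]]
  show ?thesis
  proof (cases "lead R = lead S")
    \<comment> \<open>Equal leading monomials express \<open>\<mu> r\<close> by the zero exponent
      vector, so it is 1; then \<open>\<mu>' r\<close>, a power of it, is 1 as well.\<close>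
    case True
    then have 1: "\<mu> r = 1" using lRS by (simp add: laurent_def)
    have "laurent r \<mu> (\<lambda>j. int (lookup (lead p) j) - int (lookup (lead q) j)) = 1"
      unfolding laurent_def using agree1[OF lead_in_keys[OF pq(3)] lead_in_keys[OF pq(4)]] by simp
    then have "\<mu>' r = 1" using pq(7)[OF lead_in_keys[OF pq(3)] lead_in_keys[OF pq(4)]] 1 by (simp add: laurent_def)
    with 1 show ?thesis by simp
  next
    case False
    from univariate_left_inverse_lead[OF pq(3,4) RS(3,4) False inj[OF pq(1) agp] inj[OF pq(2) agq] eq]
    have d: "int (lookup (lead R) r) - int (lookup (lead S) r) = 1 \<or> int (lookup (lead R) r) - int (lookup (lead S) r) = -1"
      "\<And>i. i \<noteq> r \<Longrightarrow> lookup (lead R) i = lookup (lead S) i" by blast+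
    have "\<mu> r = \<mu>' r powi (int (lookup (lead R) r) - int (lookup (lead S) r))"
      unfolding lRS[symmetric] laurent_def using d(2) by simp
    with d(1) show ?thesis by (auto simp: power_int_minus)
  qed
qed

section \<open>Monomial maps\<close>

definition laurent_map :: "nat \<Rightarrow> (nat \<Rightarrow> nat \<Rightarrow> int) \<Rightarrow> 'k::field ratfun vec" where
  "laurent_map n E = vec n (\<lambda>i. laurent n coord (E i))"

lemma laurent_map_index [simp]: "dim_vec (laurent_map n E) = n"
  "i < n \<Longrightarrow> laurent_map n E $ i = laurent n coord (E i)"
  by (simp_all add: laurent_map_def)

lemma scalar_power: "scalar (a ^ k) = scalar a ^ k"
  by (rule scalar.hom_power)

lemma scalar_powi: "scalar (a powi k) = scalar a powi k"
proof -
  have "scalar (inverse a) = inverse (scalar a)" using scalar_divide[of 1 a] by (simp add: divide_inverse)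
  then show ?thesis by (simp add: power_int_def scalar_power)
qed

lemma scalar_laurent: "scalar (laurent n \<mu> e) = laurent n (\<lambda>j. scalar (\<mu> j)) e"
  by (simp add: laurent_def scalar_powi scalar.hom_prod)

lemma reg_laurent:
  assumes "dim_vec g = n" "\<And>j. j < n \<Longrightarrow> g $ j \<noteq> 0"
  shows "laurent n coord e \<in> reg g \<and> rat_subst g (laurent n coord e) = laurent n (\<lambda>j. g $ j) e"
proof -
  have "coord j powi e j \<in> reg g \<and> rat_subst g (coord j powi e j) = (g $ j) powi e j" if "j < n" for j
    using reg_powi[of "coord j" g "e j"] assms that by simp
  then show ?thesis using reg_prod[of "{..<n}" "\<lambda>j. coord j powi e j" g] unfolding laurent_def by simp
qed

lemma laurent_map_comp:
  assumes EF: "\<And>i k. i < n \<Longrightarrow> k < n \<Longrightarrow> (\<Sum>j<n. E i j * F j k) = (if i = k then 1 else 0)" and i: "i < n"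
  shows "(laurent_map n E :: 'k::field ratfun vec) $ i \<in> reg (laurent_map n F) \<and>
    rat_subst (laurent_map n F :: 'k ratfun vec) (laurent_map n E $ i) = coord i"
proof -
  have nz: "nonzero n (coord :: nat \<Rightarrow> 'k ratfun)" by simp
  have "laurent n coord (E i) \<in> reg (laurent_map n F :: 'k ratfun vec) \<and>
      rat_subst (laurent_map n F :: 'k ratfun vec) (laurent n coord (E i)) = laurent n (\<lambda>j. laurent_map n F $ j) (E i)"
    by (rule reg_laurent) (use laurent_nonzero[OF nz] in auto)
  moreover have "laurent n (\<lambda>j. (laurent_map n F :: 'k ratfun vec) $ j) (E i) = laurent n (\<lambda>j. laurent n coord (F j)) (E i)"
    by (rule laurent_cong) auto
  moreover have "\<dots> = laurent n coord (\<lambda>k. if k = i then 1 else 0)"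
    unfolding laurent_laurent[OF nz] by (rule laurent_cong) (simp_all add: EF i)
  ultimately show ?thesis using i by (simp add: laurent_unit)
qed

text \<open>Weights transform by the same exponents as coordinates. With a translation the first row
  and column of \<open>E\<close> are trivial: the translated coordinate is kept and enters no other
  component, so the translation commutes with the monomial map.\<close>

lemma laurent_map_conjugates:
  fixes \<mu> :: "nat \<Rightarrow> 'k::field"
  assumes EF: "\<And>i k. i < n \<Longrightarrow> k < n \<Longrightarrow> (\<Sum>j<n. E i j * F j k) = (if i = k then 1 else 0)"
    and FE: "\<And>i k. i < n \<Longrightarrow> k < n \<Longrightarrow> (\<Sum>j<n. F i j * E j k) = (if i = k then 1 else 0)"
    and c: "c \<Longrightarrow> \<mu> 0 = 1"
    and E0: "\<And>j. c \<Longrightarrow> j < n \<Longrightarrow> E 0 j = (if j = 0 then 1 else 0)" "\<And>j. c \<Longrightarrow> j < n \<Longrightarrow> E j 0 = (if j = 0 then 1 else 0)"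
    and \<mu>: "nonzero n \<mu>"
  shows "birational n (laurent_map n E :: 'k ratfun vec)"
    and "rat_comp (rat_comp (laurent_map n E) (pmap n (shift_diag c \<mu>))) (inv\<^bsub>Bir n\<^esub> (laurent_map n E)) =
      pmap n (shift_diag c (\<lambda>i. laurent n \<mu> (E i)))"
proof -
  let ?f = "pmap n (shift_diag c \<mu>)" and ?h = "laurent_map n E :: 'k ratfun vec"
  have rat: "laurent_map n E \<in> ratmaps n" for E
    by (rule ratmapsI) (auto simp: laurent_def intro!: ratfuns_prod ratfuns_powi)
  show h: "birational n ?h"
    by (rule birationalI(1)[OF rat rat[of F]]) (use laurent_map_comp[OF EF] laurent_map_comp[OF FE] in blast)+
  have f: "birational n ?f" by (rule shift_diag_Aut(2)) (use c \<mu> in blast)+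
  have sd: "to_fract (shift_diag c \<mu> j) = scalar (\<mu> j) * coord j + (if c \<and> j = 0 then 1 else 0)" for j and \<mu> :: "nat \<Rightarrow> 'k"
    by (simp add: shift_diag_def to_fract_Const to_fract_Var)
  have nz: "?f $ j \<noteq> 0" if "j < n" for j using birational_coord_nonzero[OF f that] .
  have comm: "rat_comp ?h ?f = rat_comp (pmap n (shift_diag c (\<lambda>i. laurent n \<mu> (E i)))) ?h"
  proof (rule eq_vecI)
    fix i assume "i < dim_vec (rat_comp (pmap n (shift_diag c (\<lambda>i. laurent n \<mu> (E i)))) ?h)"
    then have i: "i < n" by simp
    have L: "rat_comp ?h ?f $ i = laurent n (\<lambda>j. ?f $ j) (E i)"
      using reg_laurent[of ?f n "E i"] nz i by simp
    have "rat_subst ?h (scalar a * coord i + b) = scalar a * ?h $ i + b" if "b = 0 \<or> b = 1" for a b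
    proof -
      have "rat_subst ?h b = b" "b \<in> reg ?h" using that by auto
      then show ?thesis using i reg_add_mult[of "scalar a" ?h "coord i"] reg_add_mult[of "scalar a * coord i" ?h b] by simp
    qed
    then have R: "rat_comp (pmap n (shift_diag c (\<lambda>i. laurent n \<mu> (E i)))) ?h $ i =
        scalar (laurent n \<mu> (E i)) * laurent n coord (E i) + (if c \<and> i = 0 then 1 else 0)"
      using i by (simp add: sd)
    have "laurent n (\<lambda>j. ?f $ j) (E i) = scalar (laurent n \<mu> (E i)) * laurent n coord (E i) + (if c \<and> i = 0 then 1 else 0)"
    proof (cases "c \<and> i = 0")
      case True
      have u: "laurent n \<nu> (E i) = \<nu> 0" if "\<nu> 0 \<noteq> 0" for \<nu> :: "nat \<Rightarrow> 'b::field"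
      proof -
        have "laurent n \<nu> (E i) = laurent n \<nu> (\<lambda>j. if j = 0 then 1 else 0)" using E0(1) True by (intro laurent_cong) auto
        then show ?thesis using laurent_unit[of 0 n \<nu> 1] i True by simp
      qed
      have "laurent n (\<lambda>j. ?f $ j) (E i) = scalar (\<mu> 0) * coord 0 + (if c \<and> 0 = (0::nat) then 1 else 0)"
        using u[of "\<lambda>j. ?f $ j"] nz[of 0] i True unfolding sd[symmetric] by simp
      then show ?thesis using u[of \<mu>] u[of "coord :: nat \<Rightarrow> 'k ratfun"] True c by simp
    next
      case False
      have "laurent n (\<lambda>j. ?f $ j) (E i) = laurent n (\<lambda>j. scalar (\<mu> j) * coord j) (E i)"
        unfolding laurent_def using E0(2) False i by (intro prod.cong refl) (auto simp: sd)
      also have "\<dots> = laurent n (\<lambda>j. scalar (\<mu> j)) (E i) * laurent n coord (E i)" by (rule laurent_mult)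
      also have "laurent n (\<lambda>j. scalar (\<mu> j)) (E i) = scalar (laurent n \<mu> (E i))"
        by (rule scalar_laurent[symmetric])
      finally show ?thesis using False by simp
    qed
    then show "rat_comp ?h ?f $ i = rat_comp (pmap n (shift_diag c (\<lambda>i. laurent n \<mu> (E i)))) ?h $ i"
      unfolding L R .
  qed simp
  interpret group "Bir n :: 'k ratfun vec monoid" by (rule group_Bir)
  have c': "laurent n \<mu> (E 0) = 1" if c "0 < n"
    using laurent_unit[of 0 n \<mu> 1] laurent_cong[of n \<mu> \<mu> "E 0" "\<lambda>j. if j = 0 then 1 else 0"] E0(1) c that by auto
  have g: "birational n (pmap n (shift_diag c (\<lambda>i. laurent n \<mu> (E i))))"
  proof (cases "n = 0")
    case True
    then have "pmap n (shift_diag c (\<lambda>i. laurent n \<mu> (E i))) = ?f" by (intro pmap_cong) simp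
    with f show ?thesis by simp
  next
    case False
    then show ?thesis using c' laurent_nonzero[OF \<mu>] by (intro shift_diag_Aut(2)) auto
  qed
  show "rat_comp (rat_comp ?h ?f) (inv\<^bsub>Bir n\<^esub> ?h) = pmap n (shift_diag c (\<lambda>i. laurent n \<mu> (E i)))"
    using inv_solve_right[of "pmap n (shift_diag c (\<lambda>i. laurent n \<mu> (E i)))" "rat_comp ?h ?f" ?h]
      birational_rat_comp[OF h f] h g comm by simp
qed

section \<open>Conjugacy classes in the Cremona group\<close>

text \<open>For \<open>c = False\<close> this is \<open>diag_aut\<close> in dimension \<open>m\<close>, for \<open>c = True\<close> it is \<open>almost_diag_aut\<close>
  in dimension \<open>m + 1\<close>; \<open>block_exponents\<close> treats \<open>monomial_map\<close> and \<open>monomial_map1\<close> alike.\<close>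

definition eigs :: "bool \<Rightarrow> (nat \<Rightarrow> 'k::one) \<Rightarrow> nat \<Rightarrow> 'k" where
  "eigs c \<mu> i = (if c then if i = 0 then 1 else \<mu> (i - 1) else \<mu> i)"

definition std_map :: "bool \<Rightarrow> nat \<Rightarrow> (nat \<Rightarrow> 'k::field) \<Rightarrow> 'k ratfun vec" where
  "std_map c m \<mu> = pmap (m + of_bool c) (shift_diag c (eigs c \<mu>))"

definition block_exponents :: "bool \<Rightarrow> (nat \<Rightarrow> nat \<Rightarrow> int) \<Rightarrow> nat \<Rightarrow> nat \<Rightarrow> int" where
  "block_exponents c A i j = (if c then if i = 0 \<or> j = 0 then if i = j then 1 else 0 else A (i - 1) (j - 1) else A i j)"

lemma eigs_0 [simp]: "eigs True \<mu> 0 = 1"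
  and eigs_Suc [simp]: "eigs True \<mu> (Suc i) = \<mu> i"
  and eigs_False [simp]: "eigs False \<mu> = \<mu>"
  by (simp_all add: eigs_def fun_eq_iff)

lemma eigs_nonzero: "nonzero m \<mu> \<Longrightarrow> nonzero (m + of_bool c) (eigs c \<mu> :: nat \<Rightarrow> 'k::field)"
  by (auto simp: eigs_def)

text \<open>The eigenvalue 1 of the translated coordinate contributes nothing, so characters in
  \<open>m + 1\<close> variables reduce to characters in \<open>m\<close> variables.\<close>

lemma laurent_eigs: "laurent (m + of_bool c) (eigs c \<mu>) e = laurent m \<mu> (\<lambda>i. e (i + of_bool c))"
proof (cases c)
  case True
  then show ?thesis unfolding laurent_def by (simp add: prod.lessThan_Suc_shift del: prod.lessThan_Suc)
qed (simp add: laurent_def)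

lemma laurent_block_exponents:
  "i < m + of_bool c \<Longrightarrow> laurent (m + of_bool c) (eigs c \<mu>) (block_exponents c A i) = eigs c (\<lambda>i. laurent m \<mu> (A i)) i"
  unfolding laurent_eigs by (auto simp: block_exponents_def eigs_def laurent_def)

lemma block_exponents_inverse:
  assumes "\<And>i k. i < m \<Longrightarrow> k < m \<Longrightarrow> (\<Sum>j<m. A i j * B j k) = (if i = k then 1 else 0)"
    and "i < m + of_bool c" "k < m + of_bool c"
  shows "(\<Sum>j<m + of_bool c. block_exponents c A i j * block_exponents c B j k) = (if i = k then 1 else 0)"
proof (cases c)
  case True
  then show ?thesis using assms
    by (cases i; cases k) (simp_all add: block_exponents_def sum.lessThan_Suc_shift del: sum.lessThan_Suc)
qed (use assms in \<open>simp add: block_exponents_def\<close>)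

lemma std_map_birational: "nonzero m \<mu> \<Longrightarrow> birational (m + of_bool c) (std_map c m \<mu>)"
  unfolding std_map_def by (rule shift_diag_Aut(2)) (use eigs_nonzero in \<open>auto simp: eigs_def\<close>)

lemma std_map_cong: "(\<And>i. i < m \<Longrightarrow> \<mu> i = \<nu> i) \<Longrightarrow> std_map c m \<mu> = std_map c m \<nu>"
  unfolding std_map_def by (rule pmap_cong) (auto simp: shift_diag_def eigs_def)

lemma monomial_conjugates:
  fixes \<mu> :: "nat \<Rightarrow> 'k::field"
  assumes AB: "\<And>i k. i < m \<Longrightarrow> k < m \<Longrightarrow> (\<Sum>j<m. A i j * B j k) = (if i = k then 1 else 0)"
    and BA: "\<And>i k. i < m \<Longrightarrow> k < m \<Longrightarrow> (\<Sum>j<m. B i j * A j k) = (if i = k then 1 else 0)"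
    and \<mu>: "nonzero m \<mu>"
  shows "birational (m + of_bool c) (laurent_map (m + of_bool c) (block_exponents c A) :: 'k ratfun vec)"
    and "rat_comp (rat_comp (laurent_map (m + of_bool c) (block_exponents c A)) (std_map c m \<mu>))
      (inv\<^bsub>Bir (m + of_bool c)\<^esub> (laurent_map (m + of_bool c) (block_exponents c A))) =
      std_map c m (\<lambda>i. laurent m \<mu> (A i))"
proof -
  note lc = laurent_map_conjugates[where E="block_exponents c A" and F="block_exponents c B" and n="m + of_bool c"
      and c=c and \<mu>="eigs c \<mu>", OF block_exponents_inverse[OF AB] block_exponents_inverse[OF BA] _ _ _ eigs_nonzero[OF \<mu>]]
  show "birational (m + of_bool c) (laurent_map (m + of_bool c) (block_exponents c A) :: 'k ratfun vec)"
    by (rule lc(1)) (auto simp: block_exponents_def)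
  have "pmap (m + of_bool c) (shift_diag c (\<lambda>i. laurent (m + of_bool c) (eigs c \<mu>) (block_exponents c A i))) =
      std_map c m (\<lambda>i. laurent m \<mu> (A i))"
    unfolding std_map_def by (rule pmap_cong) (simp add: shift_diag_def laurent_block_exponents)
  moreover have "rat_comp (rat_comp (laurent_map (m + of_bool c) (block_exponents c A)) (std_map c m \<mu>))
      (inv\<^bsub>Bir (m + of_bool c)\<^esub> (laurent_map (m + of_bool c) (block_exponents c A))) =
      pmap (m + of_bool c) (shift_diag c (\<lambda>i. laurent (m + of_bool c) (eigs c \<mu>) (block_exponents c A i)))"
    unfolding std_map_def by (rule lc(2)) (auto simp: block_exponents_def)
  ultimately show "rat_comp (rat_comp (laurent_map (m + of_bool c) (block_exponents c A)) (std_map c m \<mu>))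
      (inv\<^bsub>Bir (m + of_bool c)\<^esub> (laurent_map (m + of_bool c) (block_exponents c A))) =
      std_map c m (\<lambda>i. laurent m \<mu> (A i))" by simp
qed

lemma mono_equiv_conjugate:
  fixes \<mu> :: "nat \<Rightarrow> 'k::field"
  assumes \<mu>: "nonzero m \<mu>" and eq: "mono_equiv m \<mu> \<mu>'"
  shows "conjugate_in (Bir (m + of_bool c)) (std_map c m \<mu>) (std_map c m \<mu>')"
proof -
  obtain A B where AB:
    "\<And>i k. i < m \<Longrightarrow> k < m \<Longrightarrow> (\<Sum>j<m. A i j * B j k) = (if i = k then 1 else (0::int))"
    "\<And>i k. i < m \<Longrightarrow> k < m \<Longrightarrow> (\<Sum>j<m. B i j * A j k) = (if i = k then 1 else (0::int))"
    and \<mu>': "\<And>i. i < m \<Longrightarrow> \<mu>' i = laurent m \<mu> (A i)"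
    by (rule mono_equivE[OF eq]) (rule that)
  have eq': "std_map c m \<mu>' = std_map c m (\<lambda>i. laurent m \<mu> (A i))" by (rule std_map_cong) (rule \<mu>')
  show ?thesis
    unfolding conjugate_in_Bir_def eq'
    by (intro exI[of _ "laurent_map (m + of_bool c) (block_exponents c A)"] conjI
      monomial_conjugates[OF AB \<mu>])
qed

text \<open>One direction is conjugation by a monomial map. For the other, birational conjugacy is
  shown to have the four properties demanded by \<open>mono_equiv_if_conjugate\<close>.\<close>

theorem conjugate_std_map_iff:
  fixes \<mu> \<mu>' :: "nat \<Rightarrow> 'k::{alg_closed_field, field_char_0}"
  assumes \<mu>: "nonzero m \<mu>" "nonzero m \<mu>'"
  shows "conjugate_in (Bir (m + of_bool c)) (std_map c m \<mu>) (std_map c m \<mu>') \<longleftrightarrow> mono_equiv m \<mu> \<mu>'"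
proof
  let ?C = "\<lambda>\<mu> \<mu>' :: nat \<Rightarrow> 'k. conjugate_in (Bir (m + of_bool c)) (std_map c m \<mu>) (std_map c m \<mu>')"
  have sym: "?C \<mu>' \<mu>" if "nonzero m \<mu>" "?C \<mu> \<mu>'" for \<mu> \<mu>'
    using conjugate_in_sym[OF group_Bir _ that(2)] std_map_birational[OF that(1)] by simp
  show "mono_equiv m \<mu> \<mu>'" if "?C \<mu> \<mu>'"
  proof (rule mono_equiv_if_conjugate[where C="?C", OF _ _ _ _ \<mu> that])
    fix \<mu> \<mu>' \<beta> :: "nat \<Rightarrow> 'k"
    assume \<mu>: "nonzero m \<mu>" "nonzero m \<mu>'" and C: "?C \<mu> \<mu>'" and eq: "mono_equiv m \<mu> \<beta>"
    have "?C \<beta> \<mu>" using sym[OF \<mu>(1) mono_equiv_conjugate[OF \<mu>(1) eq]] .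
    then show "?C \<beta> \<mu>'"
      using conjugate_in_trans[OF group_Bir _ _ C] std_map_birational[OF mono_equiv_nonzero[OF eq \<mu>(1)]] by simp
  next
    fix \<mu> \<mu>' :: "nat \<Rightarrow> 'k" and i
    assume \<mu>: "nonzero m \<mu>" "nonzero m \<mu>'" and C: "?C \<mu> \<mu>'" and i: "i < m"
    have "\<exists>e. eigs c \<mu>' (i + of_bool c) = laurent (m + of_bool c) (eigs c \<mu>) e"
      by (rule conjugate_shift_diag_laurent[OF _ eigs_nonzero[OF \<mu>(1)] C[unfolded std_map_def]])
        (use i \<mu>(2) in \<open>auto simp: eigs_def\<close>)
    then show "\<exists>e. \<mu>' i = laurent m \<mu> e" unfolding laurent_eigs by (cases c) auto
  next
    fix \<mu> \<mu>' :: "nat \<Rightarrow> 'k" and r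
    assume \<mu>: "nonzero m \<mu>" "nonzero m \<mu>'" and C: "?C \<mu> \<mu>'" and m: "m = Suc r" and ind: "mult_indep r \<mu>"
      and t: "torsion (\<mu> r)" "torsion (\<mu>' r)"
    \<comment> \<open>With a translation, the last coordinate of the map has index
      \<open>r + 1\<close>, while the last entry of the tuple has index \<open>r\<close>.\<close>
    have Suc: "m + of_bool c = Suc (r + of_bool c)" using m by simp
    have "eigs c \<mu>' (r + of_bool c) = eigs c \<mu> (r + of_bool c) \<or>
        eigs c \<mu>' (r + of_bool c) = inverse (eigs c \<mu> (r + of_bool c))"
    proof (rule conjugate_shift_diag_last[OF _ _ eigs_nonzero[OF \<mu>(1), of c, unfolded Suc]
          eigs_nonzero[OF \<mu>(2), of c, unfolded Suc] C[unfolded std_map_def Suc]])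
      fix e i assume e: "torsion (laurent (r + of_bool c) (eigs c \<mu>) e)" and i: "i < r + of_bool c" "\<not> (c \<and> i = 0)"
      have "\<forall>j<r. e (j + of_bool c) = 0" using ind e unfolding laurent_eigs mult_indep_def by blast
      then show "e i = 0" using i by (cases c; cases i) auto
    qed (use t in \<open>auto simp: eigs_def\<close>)
    then show "\<mu>' r = \<mu> r \<or> \<mu>' r = inverse (\<mu> r)" by (cases c) auto
  qed (use sym in blast)+
qed (rule mono_equiv_conjugate[OF \<mu>(1)])

lemma diag_aut_std_map: "\<mu> \<in> carrier_vec n \<Longrightarrow> diag_aut \<mu> = std_map False n (\<lambda>i. \<mu> $ i)"
  by (intro eq_vecI) (auto simp: diag_aut_def std_map_def shift_diag_def to_fract_Const to_fract_Var)

lemma almost_diag_aut_std_map: "\<nu> \<in> carrier_vec m \<Longrightarrow> almost_diag_aut \<nu> = std_map True m (\<lambda>i. \<nu> $ i)"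
  by (intro eq_vecI)
    (auto simp: almost_diag_aut_def std_map_def shift_diag_def eigs_def to_fract_Const to_fract_Var split: nat.split)

lemma monomial_map_laurent_map:
  "A \<in> carrier_mat n n \<Longrightarrow> monomial_map A = laurent_map n (block_exponents False (\<lambda>i j. A $$ (i, j)))"
  by (intro eq_vecI) (auto simp: monomial_map_def laurent_def block_exponents_def)

lemma monomial_map1_laurent_map:
  "B \<in> carrier_mat m m \<Longrightarrow> monomial_map1 B = laurent_map (Suc m) (block_exponents True (\<lambda>i j. B $$ (i, j)))"
  by (intro eq_vecI)
    (auto simp: monomial_map1_def laurent_def block_exponents_def prod.lessThan_Suc_shift split: nat.split
      simp del: prod.lessThan_Suc)

lemma torus_act_laurent:
  "A \<in> carrier_mat m m \<Longrightarrow> torus_act A \<mu> = vec m (\<lambda>i. laurent m (\<lambda>j. \<mu> $ j) (\<lambda>j. A $$ (i, j)))"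
  by (auto simp: torus_act_def laurent_def)

lemma torus_nonzero: "\<mu> \<in> torus m \<Longrightarrow> nonzero m (\<lambda>i. \<mu> $ i)" "\<mu> \<in> torus m \<Longrightarrow> \<mu> \<in> carrier_vec m"
  by (auto simp: torus_def)

lemma mono_equiv_torus_act:
  assumes "\<mu>' \<in> carrier_vec m"
  shows "mono_equiv m (\<lambda>i. \<mu> $ i) (\<lambda>i. \<mu>' $ i) \<longleftrightarrow> (\<exists>A\<in>GL m. \<mu>' = torus_act A \<mu>)"
  unfolding mono_equiv_def using assms
  by (intro bex_cong refl) (auto simp: torus_act_laurent[OF GL_carrier] vec_eq_iff)

text \<open>A conjugacy yields an integer matrix on the eigenvalues, and the monomial map of that
  same matrix realizes the conjugation. This closes the circle between the two criteria.\<close>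

lemma std_map_conjugate_monomial:
  fixes \<mu> \<mu>' :: "'k::{alg_closed_field, field_char_0} vec"
  assumes \<mu>: "\<mu> \<in> torus m" "\<mu>' \<in> torus m"
  shows "conjugate_in (Bir (m + of_bool c)) (std_map c m (\<lambda>i. \<mu> $ i)) (std_map c m (\<lambda>i. \<mu>' $ i)) \<longleftrightarrow>
      (\<exists>A\<in>GL m. \<mu>' = torus_act A \<mu>)"
    and "conjugate_in (Bir (m + of_bool c)) (std_map c m (\<lambda>i. \<mu> $ i)) (std_map c m (\<lambda>i. \<mu>' $ i)) \<longleftrightarrow>
      (\<exists>A\<in>GL m. rat_comp (rat_comp (laurent_map (m + of_bool c) (block_exponents c (\<lambda>i j. A $$ (i, j)))) (std_map c m (\<lambda>i. \<mu> $ i)))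
      (inv\<^bsub>Bir (m + of_bool c)\<^esub> (laurent_map (m + of_bool c) (block_exponents c (\<lambda>i j. A $$ (i, j))))) = std_map c m (\<lambda>i. \<mu>' $ i))"
      (is "?conj \<longleftrightarrow> (\<exists>A\<in>GL m. ?mono A)")
proof -
  show 1: "?conj \<longleftrightarrow> (\<exists>A\<in>GL m. \<mu>' = torus_act A \<mu>)"
    using conjugate_std_map_iff[OF torus_nonzero(1)[OF \<mu>(1)] torus_nonzero(1)[OF \<mu>(2)]]
      mono_equiv_torus_act[OF torus_nonzero(2)[OF \<mu>(2)]] by blast
  have mono: "birational (m + of_bool c) (laurent_map (m + of_bool c) (block_exponents c (\<lambda>i j. A $$ (i, j))) :: 'k ratfun vec) \<and>
      (\<mu>' = torus_act A \<mu> \<longrightarrow> ?mono A)" if A: "A \<in> GL m" for A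
  proof -
    obtain B where B: "B \<in> GL m" "A * B = 1\<^sub>m m" "B * A = 1\<^sub>m m" by (rule GL_inverse[OF A])
    note car = GL_carrier[OF A] GL_carrier[OF B(1)]
    have AB: "(\<Sum>j<m. A $$ (i, j) * B $$ (j, k)) = (if i = k then 1 else 0)" if "i < m" "k < m" for i k
      using arg_cong[OF B(2), of "\<lambda>M. M $$ (i, k)"] that car by (simp add: scalar_prod_def atLeast0LessThan)
    have BA: "(\<Sum>j<m. B $$ (i, j) * A $$ (j, k)) = (if i = k then 1 else 0)" if "i < m" "k < m" for i k
      using arg_cong[OF B(3), of "\<lambda>M. M $$ (i, k)"] that car by (simp add: scalar_prod_def atLeast0LessThan)
    have "std_map c m (\<lambda>i. laurent m (\<lambda>j. \<mu> $ j) (\<lambda>j. A $$ (i, j))) = std_map c m (\<lambda>i. \<mu>' $ i)" if "\<mu>' = torus_act A \<mu>"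
      by (rule std_map_cong) (simp add: that torus_act_laurent[OF car(1)])
    then show ?thesis
      using monomial_conjugates[where c=c, OF AB BA torus_nonzero(1)[OF \<mu>(1)]] by simp
  qed
  show "?conj \<longleftrightarrow> (\<exists>A\<in>GL m. ?mono A)"
  proof
    assume ?conj
    then show "\<exists>A\<in>GL m. ?mono A" using 1 mono by blast
  next
    assume "\<exists>A\<in>GL m. ?mono A"
    then show ?conj unfolding conjugate_in_Bir_def using mono by blast
  qed
qed

section \<open>Automorphisms of finite order\<close>

lemma (in group) ord_conjugate:
  assumes f: "f \<in> carrier G" and conj: "conjugate_in G f g"
  shows "ord g = ord f"
proof -
  obtain h where h: "h \<in> carrier G" and g: "g = h \<otimes> f \<otimes> inv h" using conj by (auto simp: conjugate_in_def)
  have gc: "g \<in> carrier G" using f h g by simp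
  have pow: "g [^] k = h \<otimes> f [^] k \<otimes> inv h" for k :: nat
  proof (induction k)
    case 0
    show ?case using h by simp
  next
    case (Suc k)
    have "inv h \<otimes> (h \<otimes> (f \<otimes> inv h)) = f \<otimes> inv h" using f h by (simp add: m_assoc[symmetric])
    then show ?case using Suc f h g by (simp add: m_assoc)
  qed
  have "g [^] k = \<one> \<longleftrightarrow> f [^] k = \<one>" for k :: nat
  proof -
    have x: "f [^] k \<in> carrier G" using f by simp
    have "h \<otimes> f [^] k = h" if "h \<otimes> f [^] k \<otimes> inv h = \<one>"
    proof -
      have "h \<otimes> f [^] k = h \<otimes> f [^] k \<otimes> inv h \<otimes> h" using h x by (simp add: m_assoc)
      with that h show ?thesis by simp
    qed
    then show ?thesis unfolding pow using h x by (auto simp: l_cancel_one)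
  qed
  then have "ord g dvd k \<longleftrightarrow> ord f dvd k" for k using pow_eq_id f gc by blast
  then show ?thesis by (metis dvd_antisym dvd_refl)
qed

lemma polys_of_nat [simp]: "of_nat k \<in> polys n"
  using polys_Const[of "of_nat k" n] by simp

lemma peval_of_nat [simp]: "peval Const F (of_nat k :: 'k::comm_ring_1 mpoly) = of_nat k"
  using Const.peval_Const[of F "of_nat k"] by simp

lemma pmap_eq_iff: "pmap n F = pmap n G \<longleftrightarrow> (\<forall>i<n. F i = G i)"
  by (auto simp: vec_eq_iff pmap_def)

lemma std_map_power:
  fixes \<mu> :: "nat \<Rightarrow> 'k::field_char_0"
  shows "std_map c m \<mu> [^]\<^bsub>Bir (m + of_bool c)\<^esub> (k::nat) = 
    pmap (m + of_bool c) (\<lambda>i. Const (eigs c \<mu> i ^ k) * Var i + (if c \<and> i = 0 then of_nat k else 0))"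
proof (induction k)
  case 0
  have "(\<lambda>i. Const (eigs c \<mu> i ^ 0) * Var i + (if c \<and> i = 0 then of_nat 0 else 0)) = Var"
    by (simp add: fun_eq_iff)
  then show ?case by (simp add: rat_id_pmap nat_pow_def)
next
  case (Suc k)
  have "std_map c m \<mu> [^]\<^bsub>Bir (m + of_bool c)\<^esub> Suc k =
      rat_comp (pmap (m + of_bool c) (\<lambda>i. Const (eigs c \<mu> i ^ k) * Var i + (if c \<and> i = 0 then of_nat k else 0)))
        (pmap (m + of_bool c) (shift_diag c (eigs c \<mu>)))"
    using Suc monoid.nat_pow_Suc[OF group.is_monoid[OF group_Bir]] by (simp add: std_map_def)
  also have "\<dots> = pmap (m + of_bool c) (\<lambda>i. Const (eigs c \<mu> i ^ Suc k) * Var i + (if c \<and> i = 0 then of_nat (Suc k) else 0))"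
    by (subst rat_comp_pmap) 
      (auto intro!: pmap_cong polys_add polys_mult simp: shift_diag_def eigs_def Const.peval_add Const.peval_mult
        Const.peval_Const Const.peval_Var Const.hom_mult Const.hom_add Const.hom_one algebra_simps)
  finally show ?case .
qed

text \<open>The \<open>k\<close>-th power translates the first coordinate by \<open>k\<close>, which
  in characteristic 0 is zero only for \<open>k = 0\<close>; almost-diagonal maps thus have infinite
  order.\<close>

lemma std_map_power_eq_id:
  fixes \<mu> :: "nat \<Rightarrow> 'k::field_char_0"
  shows "std_map c m \<mu> [^]\<^bsub>Bir (m + of_bool c)\<^esub> (k::nat) = \<one>\<^bsub>Bir (m + of_bool c)\<^esub> \<longleftrightarrow>
    (\<forall>i<m. \<mu> i ^ k = 1) \<and> (c \<longrightarrow> k = 0)"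
proof -
  let ?F = "\<lambda>i. Const (eigs c \<mu> i ^ k) * Var i + (if c \<and> i = 0 then of_nat k else 0)"
  have "?F i = Var i \<longleftrightarrow> eigs c \<mu> i ^ k = 1 \<and> (c \<and> i = 0 \<longrightarrow> k = 0)" for i
  proof
    assume eq: "?F i = Var i"
    show "eigs c \<mu> i ^ k = 1 \<and> (c \<and> i = 0 \<longrightarrow> k = 0)"
      using arg_cong[OF eq, of "\<lambda>p. lookup p (single i 1)"] arg_cong[OF eq, of "\<lambda>p. lookup p 0"] single1_neq_0[of i]
      by (auto simp: lookup_add lookup_Const_mult lookup_Const lookup_Var_single lookup_Var_0 lookup_of_nat when_def split: if_splits simp del: One_nat_def)
  qed (auto simp: Const.hom_one)
  then have "pmap (m + of_bool c) ?F = pmap (m + of_bool c) Var \<longleftrightarrow>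
      (\<forall>i<m + of_bool c. eigs c \<mu> i ^ k = 1 \<and> (c \<and> i = 0 \<longrightarrow> k = 0))"
    unfolding pmap_eq_iff by (simp only:)
  also have "\<dots> \<longleftrightarrow> (\<forall>i<m. \<mu> i ^ k = 1) \<and> (c \<longrightarrow> k = 0)"
    by (cases c) (auto simp: All_less_Suc2)
  finally show ?thesis unfolding std_map_power Bir_simps rat_id_pmap .
qed

text \<open>The order is 0 for elements of infinite order, so \<open>d \<noteq> 0\<close> expresses
  finiteness and rules out the almost-diagonal case. The last conclusion states the order in terms
  of the eigenvalues.\<close>

lemma finite_order_conjugate_diag:
  fixes M :: "'k::{alg_closed_field, field_char_0} mat"
  assumes n: "0 < n" and M: "(M, b) \<in> affine_data n" and d: "group.ord (Bir n) (affine_map M b) = d" "d \<noteq> 0"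
  obtains \<mu> where "\<mu> \<in> torus n" "conjugate_in (Bir n) (affine_map M b) (diag_aut \<mu>)" "\<And>k. (\<forall>i<n. \<mu> $ i ^ k = 1) \<longleftrightarrow> d dvd k"
proof -
  interpret group "Bir n :: 'k ratfun vec monoid" by (rule group_Bir)
  have f: "affine_map M b \<in> carrier (Bir n)" using affine_data_Aut(2)[OF M] by simp
  have pow: "g [^]\<^bsub>Bir n\<^esub> k = \<one>\<^bsub>Bir n\<^esub> \<longleftrightarrow> d dvd k" if "conjugate_in (Bir n) (affine_map M b) g" for g and k :: nat
    using pow_eq_id[OF conjugate_in_closed[OF group_Bir f that]] ord_conjugate[OF f that] d(1) by simp
  have "\<not> conjugate_in (Bir n) (affine_map M b) (almost_diag_aut \<nu>)" if \<nu>: "\<nu> \<in> torus (n - 1)" for \<nu>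
  proof
    assume conj: "conjugate_in (Bir n) (affine_map M b) (almost_diag_aut \<nu>)"
    have "almost_diag_aut \<nu> = std_map True (n - 1) (\<lambda>i. \<nu> $ i)" "n - 1 + of_bool True = n"
      using almost_diag_aut_std_map[OF torus_nonzero(2)[OF \<nu>]] n by simp_all
    then show False using pow[OF conj, of d] std_map_power_eq_id[where c=True and m="n - 1" and \<mu>="\<lambda>i. \<nu> $ i" and k=d] d(2) by simp
  qed
  then obtain \<mu> where \<mu>: "\<mu> \<in> torus n" "conjugate_in (Bir n) (affine_map M b) (diag_aut \<mu>)"
    using affine_conjugate_diag_or_almost_diag[OF n M] by blast
  show thesis
    by (rule that[OF \<mu>]) (use pow[OF \<mu>(2)] std_map_power_eq_id[where c=False and m=n and \<mu>="\<lambda>i. \<mu> $ i"]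
      diag_aut_std_map[OF torus_nonzero(2)[OF \<mu>(1)]] in simp)
qed

theorem same_finite_order_conjugate:
  fixes M M' :: "'k::{alg_closed_field, field_char_0} mat"
  assumes n: "1 < n" and M: "(M, b) \<in> affine_data n" "(M', b') \<in> affine_data n"
    and ord: "group.ord (Bir n) (affine_map M b) \<noteq> 0" "group.ord (Bir n) (affine_map M b) = group.ord (Bir n) (affine_map M' b')"
  shows "conjugate_in (Bir n) (affine_map M b) (affine_map M' b')"
proof -
  let ?d = "group.ord (Bir n) (affine_map M b)"
  have n0: "0 < n" using n by simp
  obtain \<mu> where \<mu>: "\<mu> \<in> torus n" "conjugate_in (Bir n) (affine_map M b) (diag_aut \<mu>)" "\<And>k. (\<forall>i<n. \<mu> $ i ^ k = 1) \<longleftrightarrow> ?d dvd k"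
    using finite_order_conjugate_diag[OF n0 M(1) refl ord(1)] by blast
  obtain \<mu>' where \<mu>': "\<mu>' \<in> torus n" "conjugate_in (Bir n) (affine_map M' b') (diag_aut \<mu>')" "\<And>k. (\<forall>i<n. \<mu>' $ i ^ k = 1) \<longleftrightarrow> ?d dvd k"
    using finite_order_conjugate_diag[OF n0 M(2) ord(2)[symmetric] ord(1)] by blast
  have "mono_equiv n (\<lambda>i. \<mu> $ i) (\<lambda>i. \<mu>' $ i)"
    by (rule mono_equiv_torsion[OF n torus_nonzero(1)[OF \<mu>(1)] torus_nonzero(1)[OF \<mu>'(1)] _ \<mu>(3) \<mu>'(3)]) (use ord(1) in simp)
  from mono_equiv_conjugate[OF torus_nonzero(1)[OF \<mu>(1)] this, of False]
  have c: "conjugate_in (Bir n) (diag_aut \<mu>) (diag_aut \<mu>')"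
    using diag_aut_std_map[OF torus_nonzero(2)[OF \<mu>(1)]] diag_aut_std_map[OF torus_nonzero(2)[OF \<mu>'(1)]] by simp
  have f: "affine_map M b \<in> carrier (Bir n)" "affine_map M' b' \<in> carrier (Bir n)"
    using affine_data_Aut(2)[OF M(1)] affine_data_Aut(2)[OF M(2)] by simp_all
  have c': "conjugate_in (Bir n) (affine_map M b) (diag_aut \<mu>')" by (rule conjugate_in_trans[OF group_Bir f(1) \<mu>(2) c])
  show ?thesis
    by (rule conjugate_in_trans[OF group_Bir f(1) c' conjugate_in_sym[OF group_Bir f(2) \<mu>'(2)]])
qed

theorem theorem1:
  fixes n :: nat
  assumes "n \<ge> 1"
  shows
    "(\<forall>(M, b) \<in> affine_data n. \<forall>(M', b') \<in> affine_data n.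
       fixes_point M b \<longrightarrow> fixes_point M' b' \<longrightarrow>
       (conjugate_in (Aut n) (affine_map M b) (affine_map M' b') \<longleftrightarrow>
        (\<exists>J :: (nat \<times> 'k::{alg_closed_field, field_char_0}) multiset.
           has_affine_jnf n (affine_map M b) J \<and> has_affine_jnf n (affine_map M' b') J))) \<and>
    (\<forall>(M, b) \<in> (affine_data n :: ('k mat \<times> 'k vec) set). \<not> fixes_point M b \<longrightarrow>
       (\<exists>\<nu> \<in> torus (n - 1). conjugate_in (Aut n) (affine_map M b) (almost_diag_aut \<nu>) \<and>
         (\<forall>\<nu>' \<in> torus (n - 1). conjugate_in (Aut n) (affine_map M b) (almost_diag_aut \<nu>') \<longrightarrow>
           (\<exists>\<sigma>. \<sigma> permutes {..<n - 1} \<and> \<nu>' = vec (n - 1) (\<lambda>i. \<nu> $ \<sigma> i))))) \<and>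
    (\<forall>(M, b) \<in> (affine_data n :: ('k mat \<times> 'k vec) set).
       ((\<exists>\<mu> \<in> torus n. conjugate_in (Bir n) (affine_map M b) (diag_aut \<mu>)) \<or>
        (\<exists>\<nu> \<in> torus (n - 1). conjugate_in (Bir n) (affine_map M b) (almost_diag_aut \<nu>))) \<and>
       \<not> ((\<exists>\<mu> \<in> torus n. conjugate_in (Bir n) (affine_map M b) (diag_aut \<mu>)) \<and>
          (\<exists>\<nu> \<in> torus (n - 1). conjugate_in (Bir n) (affine_map M b) (almost_diag_aut \<nu>)))) \<and>
    (\<forall>\<mu> \<in> (torus n :: 'k vec set). \<forall>\<mu>' \<in> torus n.
       (conjugate_in (Bir n) (diag_aut \<mu>) (diag_aut \<mu>') \<longleftrightarrow>
        (\<exists>A \<in> GL n. \<mu>' = torus_act A \<mu>)) \<and>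
       (conjugate_in (Bir n) (diag_aut \<mu>) (diag_aut \<mu>') \<longleftrightarrow>
        (\<exists>A \<in> GL n. monomial_map A \<otimes>\<^bsub>Bir n\<^esub> diag_aut \<mu> \<otimes>\<^bsub>Bir n\<^esub>
           inv\<^bsub>Bir n\<^esub> (monomial_map A) = diag_aut \<mu>'))) \<and>
    (\<forall>\<nu> \<in> (torus (n - 1) :: 'k vec set). \<forall>\<nu>' \<in> torus (n - 1).
       (conjugate_in (Bir n) (almost_diag_aut \<nu>) (almost_diag_aut \<nu>') \<longleftrightarrow>
        (\<exists>B \<in> GL (n - 1). \<nu>' = torus_act B \<nu>)) \<and>
       (conjugate_in (Bir n) (almost_diag_aut \<nu>) (almost_diag_aut \<nu>') \<longleftrightarrow>
        (\<exists>B \<in> GL (n - 1). monomial_map1 B \<otimes>\<^bsub>Bir n\<^esub> almost_diag_aut \<nu> \<otimes>\<^bsub>Bir n\<^esub>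
           inv\<^bsub>Bir n\<^esub> (monomial_map1 B) = almost_diag_aut \<nu>'))) \<and>
    (n > 1 \<longrightarrow>
      (\<forall>(M, b) \<in> (affine_data n :: ('k mat \<times> 'k vec) set). \<forall>(M', b') \<in> affine_data n.
         group.ord (Bir n) (affine_map M b) \<noteq> 0 \<longrightarrow>
         group.ord (Bir n) (affine_map M b) = group.ord (Bir n) (affine_map M' b') \<longrightarrow>
         conjugate_in (Bir n) (affine_map M b) (affine_map M' b')))"
  proof -
  have n: "0 < n" using assms by simp
  have n1: "n - 1 + of_bool True = n" "n + of_bool False = n" "Suc (n - 1) = n" using assms by simp_all
  have diag: "diag_aut \<mu> = std_map False n (\<lambda>i. \<mu> $ i)" "diag_aut \<mu> = pmap n (shift_diag False (\<lambda>i. \<mu> $ i))"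
    "birational n (diag_aut \<mu>)" if "\<mu> \<in> torus n" for \<mu> :: "'k vec"
    using diag_aut_std_map[OF torus_nonzero(2)[OF that]] std_map_birational[OF torus_nonzero(1)[OF that], of False]
    by (simp_all add: std_map_def)
  have almost: "almost_diag_aut \<nu> = std_map True (n - 1) (\<lambda>i. \<nu> $ i)" "birational n (almost_diag_aut \<nu>)"
    "almost_diag_aut \<nu> = pmap n (shift_diag True (eigs True (\<lambda>i. \<nu> $ i)))"
    if "\<nu> \<in> torus (n - 1)" for \<nu> :: "'k vec"
    using almost_diag_aut_std_map[OF torus_nonzero(2)[OF that]] std_map_birational[OF torus_nonzero(1)[OF that], of True] n1
    by (simp_all add: std_map_def)
  have 1: "\<exists>\<nu>\<in>torus (n - 1). conjugate_in (Aut n) (affine_map M b) (almost_diag_aut \<nu>) \<and>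
      (\<forall>\<nu>'\<in>torus (n - 1). conjugate_in (Aut n) (affine_map M b) (almost_diag_aut \<nu>') \<longrightarrow>
        (\<exists>\<sigma>. \<sigma> permutes {..<n - 1} \<and> \<nu>' = vec (n - 1) (\<lambda>i. \<nu> $ \<sigma> i)))"
    if M: "(M, b) \<in> affine_data n" "\<not> fixes_point M b" for M :: "'k mat" and b
  proof -
    obtain \<nu> where \<nu>: "\<nu> \<in> torus (n - 1)" "conjugate_in (Aut n) (affine_map M b) (almost_diag_aut \<nu>)"
      using affine_no_fixed_point[OF M] by blast
    have "\<exists>\<sigma>. \<sigma> permutes {..<n - 1} \<and> \<nu>' = vec (n - 1) (\<lambda>i. \<nu> $ \<sigma> i)"
      if \<nu>': "\<nu>' \<in> torus (n - 1)" "conjugate_in (Aut n) (affine_map M b) (almost_diag_aut \<nu>')" for \<nu>'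
    proof -
      have "conjugate_in (Aut n) (almost_diag_aut \<nu>) (affine_map M b)"
        using conjugate_in_sym[OF group_Aut affine_data_Aut(1)[OF M(1)] \<nu>(2)] .
      from conjugate_in_Aut_trans[OF almost(2)[OF \<nu>(1)] this \<nu>'(2)]
      show ?thesis by (rule almost_diag_conjugate_Aut_permutation[OF n \<nu>(1) \<nu>'(1)])
    qed
    with \<nu> show ?thesis by blast
  qed
  have 2: "\<not> ((\<exists>\<mu>\<in>torus n. conjugate_in (Bir n) (affine_map M b) (diag_aut \<mu>)) \<and>
      (\<exists>\<nu>\<in>torus (n - 1). conjugate_in (Bir n) (affine_map M b) (almost_diag_aut \<nu>)))"
    if M: "(M, b) \<in> affine_data n" for M :: "'k mat" and b
  proof
    assume "(\<exists>\<mu>\<in>torus n. conjugate_in (Bir n) (affine_map M b) (diag_aut \<mu>)) \<and>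
      (\<exists>\<nu>\<in>torus (n - 1). conjugate_in (Bir n) (affine_map M b) (almost_diag_aut \<nu>))"
    then obtain \<mu> \<nu> where \<mu>: "\<mu> \<in> torus n" "conjugate_in (Bir n) (affine_map M b) (diag_aut \<mu>)"
      and \<nu>: "\<nu> \<in> torus (n - 1)" "conjugate_in (Bir n) (affine_map M b) (almost_diag_aut \<nu>)" by blast
    have "affine_map M b \<in> carrier (Bir n)" using affine_data_Aut(2)[OF M] by simp
    from conjugate_in_sym[OF group_Bir this \<mu>(2)]
    have "conjugate_in (Bir n) (diag_aut \<mu>) (almost_diag_aut \<nu>)"
      using conjugate_in_trans[OF group_Bir _ _ \<nu>(2)] diag(3)[OF \<mu>(1)] by simp
    then show False
      using diag_not_conjugate_almost_diag[where \<mu>="\<lambda>i. \<mu> $ i" and \<mu>'="eigs True (\<lambda>i. \<nu> $ i)" and n=n] n torus_nonzero(1)[OF \<mu>(1)] eigs_0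
      unfolding diag(2)[OF \<mu>(1)] almost(3)[OF \<nu>(1)] by blast
  qed
  have 3: "(conjugate_in (Bir n) (diag_aut \<mu>) (diag_aut \<mu>') \<longleftrightarrow> (\<exists>A\<in>GL n. \<mu>' = torus_act A \<mu>)) \<and>
      (conjugate_in (Bir n) (diag_aut \<mu>) (diag_aut \<mu>') \<longleftrightarrow>
        (\<exists>A\<in>GL n. monomial_map A \<otimes>\<^bsub>Bir n\<^esub> diag_aut \<mu> \<otimes>\<^bsub>Bir n\<^esub> inv\<^bsub>Bir n\<^esub> (monomial_map A) = diag_aut \<mu>'))"
    if \<mu>: "\<mu> \<in> torus n" "\<mu>' \<in> torus n" for \<mu> \<mu>' :: "'k vec"
  proof -
    have "(\<exists>A\<in>GL n. monomial_map A \<otimes>\<^bsub>Bir n\<^esub> diag_aut \<mu> \<otimes>\<^bsub>Bir n\<^esub> inv\<^bsub>Bir n\<^esub> (monomial_map A) = diag_aut \<mu>') \<longleftrightarrow>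
      (\<exists>A\<in>GL n. rat_comp (rat_comp (laurent_map n (block_exponents False (\<lambda>i j. A $$ (i, j)))) (diag_aut \<mu>))
        (inv\<^bsub>Bir n\<^esub> (laurent_map n (block_exponents False (\<lambda>i j. A $$ (i, j))))) = diag_aut \<mu>')"
      by (intro bex_cong refl) (simp add: monomial_map_laurent_map[OF GL_carrier])
    then show ?thesis
      using std_map_conjugate_monomial[OF \<mu>, of False] unfolding n1 diag(1)[OF \<mu>(1)] diag(1)[OF \<mu>(2)] by blast
  qed
  have 4: "(conjugate_in (Bir n) (almost_diag_aut \<nu>) (almost_diag_aut \<nu>') \<longleftrightarrow> (\<exists>B\<in>GL (n - 1). \<nu>' = torus_act B \<nu>)) \<and>
      (conjugate_in (Bir n) (almost_diag_aut \<nu>) (almost_diag_aut \<nu>') \<longleftrightarrow>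
        (\<exists>B\<in>GL (n - 1). monomial_map1 B \<otimes>\<^bsub>Bir n\<^esub> almost_diag_aut \<nu> \<otimes>\<^bsub>Bir n\<^esub> inv\<^bsub>Bir n\<^esub> (monomial_map1 B) = almost_diag_aut \<nu>'))"
    if \<nu>: "\<nu> \<in> torus (n - 1)" "\<nu>' \<in> torus (n - 1)" for \<nu> \<nu>' :: "'k vec"
  proof -
    have "(\<exists>B\<in>GL (n - 1). monomial_map1 B \<otimes>\<^bsub>Bir n\<^esub> almost_diag_aut \<nu> \<otimes>\<^bsub>Bir n\<^esub> inv\<^bsub>Bir n\<^esub> (monomial_map1 B) = almost_diag_aut \<nu>') \<longleftrightarrow>
      (\<exists>B\<in>GL (n - 1). rat_comp (rat_comp (laurent_map n (block_exponents True (\<lambda>i j. B $$ (i, j)))) (almost_diag_aut \<nu>))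
        (inv\<^bsub>Bir n\<^esub> (laurent_map n (block_exponents True (\<lambda>i j. B $$ (i, j))))) = almost_diag_aut \<nu>')"
      by (intro bex_cong refl) (simp add: monomial_map1_laurent_map[OF GL_carrier] n1(3) del: One_nat_def)
    then show ?thesis
      using std_map_conjugate_monomial[OF \<nu>, of True] unfolding n1 almost(1)[OF \<nu>(1)] almost(1)[OF \<nu>(2)] by blast
  qed
  \<comment> \<open>Curries the quantifiers over pairs so that the goals match the theorems stated
    for separate \<open>M\<close> and \<open>b\<close>.\<close>
  have pairs: "(\<forall>(M, b)\<in>A. P M b) \<longleftrightarrow> (\<forall>M b. (M, b) \<in> A \<longrightarrow> P M b)" for A :: "('k mat \<times> 'k vec) set" and P by auto
  show ?thesis
    unfolding pairs
  proof (intro conjI, goal_cases)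
    case 1
    show ?case using conjugate_affine_fixed_point_iff by blast
  next
    case 2
    show ?case using 1 by blast
  next
    case 3
    show ?case using affine_conjugate_diag_or_almost_diag[OF n] 2 by blast
  next
    case 4
    show ?case using 3 by blast
  next
    case 5
    show ?case using 4 by blast
  next
    case 6
    show ?case using same_finite_order_conjugate by blast
  qed
qed

end
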